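(* Let $X$ be a smooth affine scheme of finite type over $\mathrm{Spec}\,\mathbb Q_p$ such that $X(\mathbb Q_p)$ is Zariski dense in $X$. Then $\mathcal C^{\mathrm{alg}}(X(\mathbb Q_p),L)$ is dense in $\mathcal C^{\mathrm{la}}(X(\mathbb Q_p),L)$.
   Context: $L$ is a finite extension of $\mathbb Q_p$. Choosing a closed embedding $X\hookrightarrow\mathbb A^n_{\mathbb Q_p}$ identifies $X(\mathbb Q_p)$ with a closed subset of $\mathbb Q_p^n$; by smoothness it is a locally $\mathbb Q_p$-analytic submanifold of $\mathbb Q_p^n$, and this gives $X(\mathbb Q_p)$ its structure of locally analytic manifold. For an open subset $U$ of $X(\mathbb Q_p)$, $\mathcal C^{\mathrm{la}}(U,L)$ is the space of locally analytic $L$-valued functions on $U$ with its usual locally convex (inductive limit) topology. $\mathcal C^{\mathrm{alg}}(X(\mathbb Q_p),L)$ is the image of the map $\Gamma(X,\mathcal O_X)\otimes_{\mathbb Q_p}L\to\mathcal C(X(\mathbb Q_p),L)$ given by evaluating regular functions at $\mathbb Q_p$-points. *)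

theory Defs
  imports
    "HOL-Library.Poly_Mapping"
    "HOL-Computational_Algebra.Primes"
    "HOL-Algebra.Ideal"
    "HOL-Analysis.Infinite_Sum"
    "HOL-Analysis.Function_Topology"
    "Jordan_Normal_Form.Determinant"
begin

section \<open>Non-archimedean fields, \<open>p\<close>-adic numbers and their finite extensions\<close>

text \<open>
  The class of real normed fields does not cover these, so the absolute value is a new parameter;
  the topology is that of the metric it defines.
\<close>

class nonarch_field = field + metric_space +
  fixes vnorm :: "'a \<Rightarrow> real"
  assumes dist_vnorm: "dist x y = vnorm (x - y)"
    and vnorm_mult: "vnorm (x * y) = vnorm x * vnorm y"
    and vnorm_add_le_max: "vnorm (x + y) \<le> max (vnorm x) (vnorm y)"

definition padic_abs :: "nat \<Rightarrow> rat \<Rightarrow> real" where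
  "padic_abs p z = (case quotient_of z of (a, b) \<Rightarrow>
     if a = 0 then 0
     else real p powi (int (multiplicity (int p) b) - int (multiplicity (int p) a)))"

text \<open>
  There is no type depending on a term \<open>p\<close>. The field of \<open>p\<close>-adic numbers is therefore any
  completion of the rationals with respect to the \<open>p\<close>-adic absolute value: completeness is the
  sort constraint, and the two conditions below say that the rationals are embedded isometrically
  and densely. Such a field is unique up to unique isometric isomorphism.
\<close>

definition is_padic_field ::
    "nat \<Rightarrow> 'q::{nonarch_field, field_char_0, complete_space} itself \<Rightarrow> bool" where
  "is_padic_field p _ \<longleftrightarrow>
     (\<forall>z. vnorm (of_rat z :: 'q) = padic_abs p z) \<and>
     closure (range (of_rat :: rat \<Rightarrow> 'q)) = UNIV"

text \<open>
  The absolute value of the extension is the one prolonging that of the base field; over a complete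
  base it exists and is unique.
\<close>

definition finite_extension :: "('q::nonarch_field \<Rightarrow> 'l::nonarch_field) \<Rightarrow> bool" where
  "finite_extension \<iota> \<longleftrightarrow>
     \<iota> 1 = 1 \<and> (\<forall>x y. \<iota> (x + y) = \<iota> x + \<iota> y) \<and> (\<forall>x y. \<iota> (x * y) = \<iota> x * \<iota> y) \<and>
     (\<forall>x. vnorm (\<iota> x) = vnorm x) \<and>
     (\<exists>B. finite_dimensional_vector_space (\<lambda>c y. \<iota> c * y) B)"


section \<open>Polynomials in \<open>n\<close> variables\<close>

type_synonym 'a mpoly = "(nat \<Rightarrow>\<^sub>0 nat) \<Rightarrow>\<^sub>0 'a"

definition multi_indices :: "nat \<Rightarrow> (nat \<Rightarrow>\<^sub>0 nat) set" where
  "multi_indices n = {\<alpha>. Poly_Mapping.keys \<alpha> \<subseteq> {..<n}}"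

definition multi_degree :: "(nat \<Rightarrow>\<^sub>0 nat) \<Rightarrow> nat" where
  "multi_degree \<alpha> = (\<Sum>i\<in>Poly_Mapping.keys \<alpha>. Poly_Mapping.lookup \<alpha> i)"

definition monom_value :: "(nat \<Rightarrow>\<^sub>0 nat) \<Rightarrow> (nat \<Rightarrow> 'a::comm_ring_1) \<Rightarrow> 'a" where
  "monom_value \<alpha> x = (\<Prod>i\<in>Poly_Mapping.keys \<alpha>. x i ^ Poly_Mapping.lookup \<alpha> i)"

definition mpoly_value :: "'a::comm_ring_1 mpoly \<Rightarrow> (nat \<Rightarrow> 'a) \<Rightarrow> 'a" where
  "mpoly_value f x = (\<Sum>\<alpha>\<in>Poly_Mapping.keys f. Poly_Mapping.lookup f \<alpha> * monom_value \<alpha> x)"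

definition mpoly_deriv :: "nat \<Rightarrow> 'a::comm_ring_1 mpoly \<Rightarrow> 'a mpoly" where
  "mpoly_deriv i f = (\<Sum>\<alpha>\<in>Poly_Mapping.keys f.
     Poly_Mapping.single (\<alpha> - Poly_Mapping.single i 1)
       (Poly_Mapping.lookup f \<alpha> * of_nat (Poly_Mapping.lookup \<alpha> i)))"

definition poly_ring :: "nat \<Rightarrow> 'a::comm_ring_1 mpoly ring" where
  "poly_ring n =
     \<lparr>carrier = {f. Poly_Mapping.keys f \<subseteq> multi_indices n},
      monoid.mult = (*), one = 1, ring.zero = 0, ring.add = (+)\<rparr>"

lemma cring_poly_ring: "cring (poly_ring n :: 'a::comm_ring_1 mpoly ring)"
proof -
  have sum_closed: "Poly_Mapping.keys (f + g) \<subseteq> multi_indices n"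
    if "Poly_Mapping.keys f \<subseteq> multi_indices n" "Poly_Mapping.keys g \<subseteq> multi_indices n"
    for f g :: "'a mpoly"
    using that keys_add[of f g] by blast
  have mult_closed: "Poly_Mapping.keys (f * g) \<subseteq> multi_indices n"
    if "Poly_Mapping.keys f \<subseteq> multi_indices n" "Poly_Mapping.keys g \<subseteq> multi_indices n"
    for f g :: "'a mpoly"
  proof
    fix \<gamma> assume "\<gamma> \<in> Poly_Mapping.keys (f * g)"
    then obtain \<alpha> \<beta> where "\<gamma> = \<alpha> + \<beta>" "\<alpha> \<in> Poly_Mapping.keys f" "\<beta> \<in> Poly_Mapping.keys g"
      using keys_mult[of f g] by blast
    then show "\<gamma> \<in> multi_indices n"
      using that keys_add[of \<alpha> \<beta>] unfolding multi_indices_def by blast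
  qed
  have one_closed: "Poly_Mapping.keys (1 :: 'a mpoly) \<subseteq> multi_indices n"
    by (simp add: multi_indices_def)
  show ?thesis
  proof (rule cringI)
    show "abelian_group (poly_ring n :: 'a mpoly ring)"
    proof (rule abelian_groupI)
      fix f :: "'a mpoly" assume "f \<in> carrier (poly_ring n)"
      then show "\<exists>g\<in>carrier (poly_ring n). g \<oplus>\<^bsub>poly_ring n\<^esub> f = \<zero>\<^bsub>poly_ring n\<^esub>"
        by (intro bexI[of _ "- f"]) (auto simp: poly_ring_def)
    qed (auto simp: poly_ring_def sum_closed[THEN subsetD] algebra_simps)
    show "Group.comm_monoid (poly_ring n :: 'a mpoly ring)"
      using one_closed
      by (intro comm_monoidI)
        (auto simp: poly_ring_def mult_closed[THEN subsetD] algebra_simps)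
  qed (auto simp: poly_ring_def algebra_simps)
qed


section \<open>Closed subschemes of affine space\<close>

text \<open>
  An affine scheme of finite type with a closed embedding into affine \<open>n\<close>-space is the spectrum of
  the quotient of the polynomial ring by an ideal \<open>I\<close>. Its points are the primes containing \<open>I\<close>,
  and its Zariski topology has the distinguished open sets as a basis.
\<close>

definition scheme_points :: "nat \<Rightarrow> 'a::comm_ring_1 mpoly set \<Rightarrow> 'a mpoly set set" where
  "scheme_points n I = {P. primeideal P (poly_ring n) \<and> I \<subseteq> P}"

definition zariski_topology :: "nat \<Rightarrow> 'a::comm_ring_1 mpoly set \<Rightarrow> 'a mpoly set topology" where
  "zariski_topology n I =
     topology_generated_by
       ((\<lambda>f. {P \<in> scheme_points n I. f \<notin> P}) ` carrier (poly_ring n))"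

text \<open>Points of affine \<open>n\<close>-space are sequences vanishing from index \<open>n\<close> on.\<close>

definition affine_points :: "nat \<Rightarrow> (nat \<Rightarrow> 'a::zero) set" where
  "affine_points n = {x. \<forall>i\<ge>n. x i = 0}"

definition rational_points :: "nat \<Rightarrow> 'a::comm_ring_1 mpoly set \<Rightarrow> (nat \<Rightarrow> 'a) set" where
  "rational_points n I = {x \<in> affine_points n. \<forall>f\<in>I. mpoly_value f x = 0}"

definition point_ideal :: "nat \<Rightarrow> (nat \<Rightarrow> 'a::comm_ring_1) \<Rightarrow> 'a mpoly set" where
  "point_ideal n x = {f \<in> carrier (poly_ring n). mpoly_value f x = 0}"

definition rational_points_dense :: "nat \<Rightarrow> 'a::comm_ring_1 mpoly set \<Rightarrow> bool" where
  "rational_points_dense n I \<longleftrightarrow>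
     zariski_topology n I closure_of (point_ideal n ` rational_points n I)
       = topspace (zariski_topology n I)"

text \<open>
  Smoothness over the base field: around every point \<open>P\<close> the ideal is generated, after inverting
  some \<open>g\<close> outside \<open>P\<close>, by \<open>c\<close> of its elements, whose Jacobian matrix has a \<open>c \<times> c\<close> minor that is
  nonzero in the residue field of \<open>P\<close>. The codimension \<open>c\<close> may depend on \<open>P\<close>.
\<close>

definition smooth_scheme :: "nat \<Rightarrow> 'a::comm_ring_1 mpoly set \<Rightarrow> bool" where
  "smooth_scheme n I \<longleftrightarrow>
     (\<forall>P\<in>scheme_points n I.
        \<exists>c (f :: nat \<Rightarrow> 'a mpoly) (\<sigma> :: nat \<Rightarrow> nat). \<exists>g\<in>carrier (poly_ring n) - P.
          f ` {..<c} \<subseteq> I \<and>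
          (\<forall>h\<in>I. \<exists>k. g ^ k * h \<in> genideal (poly_ring n) (f ` {..<c})) \<and>
          \<sigma> ` {..<c} \<subseteq> {..<n} \<and>
          Determinant.det (Matrix.mat c c (\<lambda>(i, j). mpoly_deriv (\<sigma> j) (f i))) \<notin> P)"


section \<open>Power series and locally analytic functions\<close>

text \<open>
  Throughout, \<open>\<iota>\<close> is the embedding of the base field into the field of values.
\<close>

definition polydisc :: "nat \<Rightarrow> (nat \<Rightarrow> 'q::nonarch_field) \<Rightarrow> real \<Rightarrow> (nat \<Rightarrow> 'q) set" where
  "polydisc d c r = {x \<in> affine_points d. \<forall>i<d. vnorm (x i - c i) \<le> r}"

text \<open>
  \<open>a\<close> is a family of coefficients with \<open>|a \<alpha>| r\<^bsup>|\<alpha>|\<^esup>\<close> tending to \<open>0\<close>, and on \<open>S\<close> the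
  function \<open>f\<close> is the sum of the corresponding power series centred at \<open>c\<close>.
\<close>

definition power_series_on ::
    "('q::nonarch_field \<Rightarrow> 'l::nonarch_field) \<Rightarrow> nat \<Rightarrow> (nat \<Rightarrow> 'q) \<Rightarrow> real \<Rightarrow>
     ((nat \<Rightarrow>\<^sub>0 nat) \<Rightarrow> 'l) \<Rightarrow> ((nat \<Rightarrow> 'q) \<Rightarrow> 'l) \<Rightarrow> (nat \<Rightarrow> 'q) set \<Rightarrow> bool" where
  "power_series_on \<iota> d c r a f S \<longleftrightarrow>
     (\<forall>\<alpha>. \<alpha> \<notin> multi_indices d \<longrightarrow> a \<alpha> = 0) \<and>
     (\<forall>\<epsilon>>0. finite {\<alpha> \<in> multi_indices d. \<epsilon> \<le> vnorm (a \<alpha>) * r ^ multi_degree \<alpha>}) \<and>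
     (\<forall>x\<in>S. ((\<lambda>\<alpha>. a \<alpha> * \<iota> (monom_value \<alpha> (\<lambda>i. x i - c i))) has_sum f x) (multi_indices d))"

text \<open>
  For open \<open>S\<close> this is local analyticity on \<open>S\<close>; for general \<open>S\<close> it says that \<open>f\<close> is locally the
  restriction of a convergent power series in the \<open>n\<close> ambient coordinates.
\<close>

definition locally_analytic_on ::
    "('q::nonarch_field \<Rightarrow> 'l::nonarch_field) \<Rightarrow> nat \<Rightarrow> (nat \<Rightarrow> 'q) set \<Rightarrow>
     ((nat \<Rightarrow> 'q) \<Rightarrow> 'l) \<Rightarrow> bool" where
  "locally_analytic_on \<iota> n S f \<longleftrightarrow>
     (\<forall>x\<in>S. \<exists>r>0. \<exists>a. power_series_on \<iota> n x r a f (S \<inter> polydisc n x r))"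

text \<open>
  The \<open>d\<close>-dimensional charts of a locally analytic submanifold \<open>M\<close> of affine \<open>n\<close>-space: a
  bijection from an open subset of \<open>M\<close> onto an open subset of \<open>d\<close>-space that is locally the
  restriction of an analytic map and whose inverse is analytic as a map into \<open>n\<close>-space. These form
  the maximal atlas of \<open>M\<close>. The product topology on sequences induces the usual topology on
  \<^term>\<open>affine_points n\<close>.
\<close>

definition analytic_chart ::
    "nat \<Rightarrow> (nat \<Rightarrow> 'q::nonarch_field) set \<Rightarrow> nat \<Rightarrow> (nat \<Rightarrow> 'q) set \<Rightarrow>
     ((nat \<Rightarrow> 'q) \<Rightarrow> (nat \<Rightarrow> 'q)) \<Rightarrow> bool" where
  "analytic_chart n M d V \<phi> \<longleftrightarrow>
     openin (top_of_set M) V \<and> openin (top_of_set (affine_points d)) (\<phi> ` V) \<and> inj_on \<phi> V \<and>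
     (\<forall>i<d. locally_analytic_on (\<lambda>t. t) n V (\<lambda>x. \<phi> x i)) \<and>
     (\<forall>i<n. locally_analytic_on (\<lambda>t. t) d (\<phi> ` V) (\<lambda>u. inv_into V \<phi> u i))"

text \<open>Functions on \<open>M\<close> are represented as functions that vanish outside \<open>M\<close>.\<close>

definition C_la ::
    "('q::nonarch_field \<Rightarrow> 'l::nonarch_field) \<Rightarrow> nat \<Rightarrow> (nat \<Rightarrow> 'q) set \<Rightarrow>
     ((nat \<Rightarrow> 'q) \<Rightarrow> 'l) set" where
  "C_la \<iota> n M =
     {f. (\<forall>x. x \<notin> M \<longrightarrow> f x = 0) \<and>
         (\<forall>d V \<phi>. analytic_chart n M d V \<phi> \<longrightarrow>
            locally_analytic_on \<iota> d (\<phi> ` V) (f \<circ> inv_into V \<phi>))}"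


section \<open>The locally convex topology on locally analytic functions\<close>

record 'q ball_chart =
  chart_dim :: nat
  chart_dom :: "(nat \<Rightarrow> 'q) set"
  chart_map :: "(nat \<Rightarrow> 'q) \<Rightarrow> (nat \<Rightarrow> 'q)"
  chart_centre :: "nat \<Rightarrow> 'q"
  chart_radius :: real

definition is_ball_chart ::
    "nat \<Rightarrow> (nat \<Rightarrow> 'q::nonarch_field) set \<Rightarrow> 'q ball_chart \<Rightarrow> bool" where
  "is_ball_chart n M D \<longleftrightarrow>
     analytic_chart n M (chart_dim D) (chart_dom D) (chart_map D) \<and>
     chart_centre D \<in> affine_points (chart_dim D) \<and> chart_radius D > 0 \<and>
     chart_map D ` chart_dom D = polydisc (chart_dim D) (chart_centre D) (chart_radius D)"

text \<open>
  The steps of the inductive limit are indexed by the partitions of \<open>M\<close> into domains of charts onto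
  polydiscs. The step of index \<open>\<D>\<close> is the product over \<open>D \<in> \<D>\<close> of the Banach spaces of functions
  given by one strictly convergent power series in the chart \<open>D\<close>.
\<close>

definition la_index ::
    "nat \<Rightarrow> (nat \<Rightarrow> 'q::nonarch_field) set \<Rightarrow> 'q ball_chart set \<Rightarrow> bool" where
  "la_index n M \<D> \<longleftrightarrow>
     (\<forall>D\<in>\<D>. is_ball_chart n M D) \<and> (\<Union>D\<in>\<D>. chart_dom D) = M \<and>
     (\<forall>D\<in>\<D>. \<forall>E\<in>\<D>. D \<noteq> E \<longrightarrow> chart_dom D \<inter> chart_dom E = {})"

definition chart_expansion ::
    "('q::nonarch_field \<Rightarrow> 'l::nonarch_field) \<Rightarrow> 'q ball_chart \<Rightarrow> ((nat \<Rightarrow> 'q) \<Rightarrow> 'l) \<Rightarrow>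
     ((nat \<Rightarrow>\<^sub>0 nat) \<Rightarrow> 'l) \<Rightarrow> bool" where
  "chart_expansion \<iota> D f a \<longleftrightarrow>
     power_series_on \<iota> (chart_dim D) (chart_centre D) (chart_radius D) a
       (f \<circ> inv_into (chart_dom D) (chart_map D))
       (polydisc (chart_dim D) (chart_centre D) (chart_radius D))"

definition la_step ::
    "('q::nonarch_field \<Rightarrow> 'l::nonarch_field) \<Rightarrow> (nat \<Rightarrow> 'q) set \<Rightarrow> 'q ball_chart set \<Rightarrow>
     ((nat \<Rightarrow> 'q) \<Rightarrow> 'l) set" where
  "la_step \<iota> M \<D> =
     {f. (\<forall>x. x \<notin> M \<longrightarrow> f x = 0) \<and> (\<forall>D\<in>\<D>. \<exists>a. chart_expansion \<iota> D f a)}"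

text \<open>
  The Banach norm \<open>sup |a \<alpha>| r\<^bsup>|\<alpha>|\<^esup>\<close>; over a nontrivially valued field the coefficients of an
  expansion are unique.
\<close>

definition chart_norm ::
    "('q::nonarch_field \<Rightarrow> 'l::nonarch_field) \<Rightarrow> 'q ball_chart \<Rightarrow> ((nat \<Rightarrow> 'q) \<Rightarrow> 'l) \<Rightarrow> real"
  where
  "chart_norm \<iota> D f =
     (SUP \<alpha>\<in>multi_indices (chart_dim D).
        vnorm ((THE a. chart_expansion \<iota> D f a) \<alpha>) * chart_radius D ^ multi_degree \<alpha>)"

definition nonarch_seminorm_on ::
    "((nat \<Rightarrow> 'q) \<Rightarrow> 'l::nonarch_field) set \<Rightarrow> (((nat \<Rightarrow> 'q) \<Rightarrow> 'l) \<Rightarrow> real) \<Rightarrow> bool" where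
  "nonarch_seminorm_on F q \<longleftrightarrow>
     (\<forall>f\<in>F. 0 \<le> q f) \<and>
     (\<forall>f\<in>F. \<forall>c. q (\<lambda>x. c * f x) = vnorm c * q f) \<and>
     (\<forall>f\<in>F. \<forall>g\<in>F. q (\<lambda>x. f x + g x) \<le> max (q f) (q g))"

text \<open>
  The inductive limit topology is the finest locally convex topology for which the inclusions of
  all steps are continuous, so it is defined by all seminorms whose restriction to every step is
  continuous. A seminorm on a product of Banach spaces is continuous iff it is bounded by a multiple
  of the sum of finitely many of the norms of the factors.
\<close>

definition la_seminorm ::
    "('q::nonarch_field \<Rightarrow> 'l::nonarch_field) \<Rightarrow> nat \<Rightarrow> (nat \<Rightarrow> 'q) set \<Rightarrow>
     (((nat \<Rightarrow> 'q) \<Rightarrow> 'l) \<Rightarrow> real) \<Rightarrow> bool" where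
  "la_seminorm \<iota> n M q \<longleftrightarrow>
     nonarch_seminorm_on (C_la \<iota> n M) q \<and>
     (\<forall>\<D>. la_index n M \<D> \<longrightarrow>
        (\<exists>J C. finite J \<and> J \<subseteq> \<D> \<and>
           (\<forall>f\<in>la_step \<iota> M \<D>. q f \<le> C * (\<Sum>D\<in>J. chart_norm \<iota> D f))))"

definition la_topology ::
    "('q::nonarch_field \<Rightarrow> 'l::nonarch_field) \<Rightarrow> nat \<Rightarrow> (nat \<Rightarrow> 'q) set \<Rightarrow>
     ((nat \<Rightarrow> 'q) \<Rightarrow> 'l) topology" where
  "la_topology \<iota> n M =
     topology_generated_by
       {{g \<in> C_la \<iota> n M. q (\<lambda>x. g x - f x) < \<epsilon>} | q f \<epsilon>.
          la_seminorm \<iota> n M q \<and> f \<in> C_la \<iota> n M \<and> 0 < \<epsilon>}"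

lemma topspace_la_topology: "topspace (la_topology \<iota> n M) = C_la \<iota> n M"
proof -
  have zero: "la_seminorm \<iota> n M (\<lambda>_. 0)"
    by (auto simp: la_seminorm_def nonarch_seminorm_on_def intro!: exI[of _ "{}"])
  show ?thesis
    unfolding la_topology_def topology_generated_by_topspace
  proof (intro equalityI subsetI)
    fix f assume f: "f \<in> C_la \<iota> n M"
    show "f \<in> \<Union>{{g \<in> C_la \<iota> n M. q (\<lambda>x. g x - f x) < \<epsilon>} | q f \<epsilon>.
        la_seminorm \<iota> n M q \<and> f \<in> C_la \<iota> n M \<and> 0 < \<epsilon>}"
    proof (rule UnionI)
      show "{g \<in> C_la \<iota> n M. (\<lambda>_. 0) (\<lambda>x. g x - f x) < (1::real)} \<in>
        {{g \<in> C_la \<iota> n M. q (\<lambda>x. g x - f x) < \<epsilon>} | q f \<epsilon>.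
          la_seminorm \<iota> n M q \<and> f \<in> C_la \<iota> n M \<and> 0 < \<epsilon>}"
        unfolding mem_Collect_eq
        by (rule exI[of _ "\<lambda>_. 0"], rule exI[of _ f], rule exI[of _ "1::real"])
          (use zero f in simp)
    qed (simp add: f)
  qed (elim UnionE CollectE exE conjE, simp)
qed


section \<open>Algebraic functions\<close>

text \<open>
  The image of the tensor product of the coordinate ring with \<open>L\<close>: a tensor is a finite sum of
  \<open>h k \<otimes> l k\<close>, and regular functions on the scheme are classes of polynomials modulo \<open>I\<close>, all
  representatives of a class having the same values at the rational points.
\<close>

definition C_alg ::
    "('q::nonarch_field \<Rightarrow> 'l::nonarch_field) \<Rightarrow> nat \<Rightarrow> 'q mpoly set \<Rightarrow>
     ((nat \<Rightarrow> 'q) \<Rightarrow> 'l) set" where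
  "C_alg \<iota> n I =
     {f. \<exists>m (h :: nat \<Rightarrow> 'q mpoly) (l :: nat \<Rightarrow> 'l).
           h ` {..<m} \<subseteq> carrier (poly_ring n) \<and>
           f = (\<lambda>x. if x \<in> rational_points n I
                    then \<Sum>k<m. \<iota> (mpoly_value (h k) x) * l k else 0)}"

end

theory Submission
  imports Defs "HOL-Real_Asymp.Real_Asymp"
begin

text \<open>
  By the maximal-minor form of the implicit function theorem, near each of its points the manifold
  of rational points is the graph, over a projection to some of the coordinates, of power series of
  Gauss norm at most the radius of the polydisc. Hence small ambient polydiscs cut out ball charts,
  and they can be chosen to partition the manifold so that the given function is one power series
  in each chart. A continuous seminorm only sees finitely many charts of the partition. On each of
  these the function is approximated by a polynomial in the ambient coordinates, by truncation. The
  polynomials are then glued with approximate indicator functions \<open>1 - (1 - t)\<^sup>k\<close> that are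
  polynomials as well, and for which the Gauss norms on disjoint ambient polydiscs are controlled.
\<close>

section \<open>Non-archimedean fields\<close>

text \<open>The obstacle is that a step of the inductive limit is normed by coefficients and not by
  values: on Z_p the polynomial t^p - t has values of norm at most 1/p, but Gauss norm 1. So it is
  not enough to separate points; the separating polynomials must be controlled as power series in
  each chart. This succeeds because a single radius r measures the ambient ball, the disc onto which
  it is projected, and the Gauss norm of the inverse coordinates around the centre. Suppose a and b
  are centres of disjoint balls, with r the larger radius, belonging to a. Some coordinate has |a_i
  - b_i| > r, and the function (y_i - b_i) / (a_i - b_i) then has Gauss norm below 1 on the ball of
  b, while on the ball of a its difference from 1 has Gauss norm below 1. Powers do the rest. The
  manifold need not be compact and the partition may be infinite. Only finitely many charts are
  approximated, but polynomials have finite Gauss norm in all of them, so the error stays in the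
  step of the whole partition.\<close>

context nonarch_field
begin

lemma vnorm_zero [simp]: "vnorm 0 = 0"
  using dist_vnorm[of 0 0] by simp

lemma vnorm_ge_0 [simp]: "0 \<le> vnorm x"
  using dist_vnorm[of x 0] zero_le_dist[of x 0] by simp

lemma vnorm_eq_0_iff [simp]: "vnorm x = 0 \<longleftrightarrow> x = 0"
  using dist_vnorm[of x 0] dist_eq_0_iff[of x 0] by simp

lemma vnorm_one [simp]: "vnorm 1 = 1"
  using vnorm_mult[of 1 1] vnorm_eq_0_iff[of 1] by simp

lemma vnorm_minus_commute: "vnorm (x - y) = vnorm (y - x)"
  using dist_vnorm dist_commute by metis

lemma vnorm_uminus [simp]: "vnorm (- x) = vnorm x"
  using vnorm_minus_commute[of 0 x] by simp

lemma vnorm_diff_le_max: "vnorm (x - y) \<le> max (vnorm x) (vnorm y)"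
  using vnorm_add_le_max[of x "- y"] by simp

lemma vnorm_add_le: "vnorm x \<le> C \<Longrightarrow> vnorm y \<le> C \<Longrightarrow> vnorm (x + y) \<le> C"
  using vnorm_add_le_max[of x y] by linarith

lemma vnorm_diff_triangle: "vnorm (x - y) \<le> C \<Longrightarrow> vnorm (y - z) \<le> C \<Longrightarrow> vnorm (x - z) \<le> C"
  using vnorm_add_le[of "x - y" C "y - z"] by (simp add: algebra_simps)

lemma vnorm_add_less: "vnorm x < C \<Longrightarrow> vnorm y < C \<Longrightarrow> vnorm (x + y) < C"
  using vnorm_add_le_max[of x y] by linarith

lemma vnorm_diff_le_less: "vnorm x < C \<Longrightarrow> vnorm y < C \<Longrightarrow> vnorm (x - y) < C"
  using vnorm_diff_le_max[of x y] by linarith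

lemma vnorm_power: "vnorm (x ^ k) = vnorm x ^ k"
  by (induction k) (simp_all add: vnorm_mult)

lemma vnorm_sum_le:
  assumes "0 \<le> C" "\<And>i. i \<in> A \<Longrightarrow> vnorm (f i) \<le> C"
  shows "vnorm (sum f A) \<le> C"
  using assms(2) by (induction A rule: infinite_finite_induct) (auto simp: assms(1) vnorm_add_le)

lemma vnorm_sum_less:
  assumes "0 < C" "\<And>i. i \<in> A \<Longrightarrow> vnorm (f i) < C"
  shows "vnorm (sum f A) < C"
  using assms(2)
proof (induction A rule: infinite_finite_induct)
  case (insert a A)
  then have "vnorm (f a) < C" "vnorm (sum f A) < C"
    by auto
  then show ?case
    using insert by (simp add: vnorm_add_less)
qed (use assms(1) in auto)

end

lemma vnorm_inverse: "vnorm (inverse x) = inverse (vnorm (x::'a::nonarch_field))"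
proof (cases "x = 0")
  case False
  then have "vnorm x * vnorm (inverse x) = 1"
    by (simp flip: vnorm_mult)
  then show ?thesis
    using inverse_unique[of "vnorm x"] by simp
qed simp

text \<open>Gives access to the general rules for \<open>has_sum\<close>, in particular those for
  sums and negatives of families.\<close>

instance nonarch_field \<subseteq> topological_ab_group_add
proof
  fix a b :: 'a
  have ev: "\<forall>\<^sub>F y in nhds c. vnorm (y - c) < e" if "0 < e" for c :: 'a and e
    using that by (auto simp: eventually_nhds_metric dist_vnorm)
  show "((\<lambda>x. fst x + snd x) \<longlongrightarrow> a + b) (nhds a \<times>\<^sub>F nhds b)"
    unfolding tendsto_iff dist_vnorm
  proof (intro allI impI)
    fix e :: real assume e: "0 < e"
    show "\<forall>\<^sub>F x in nhds a \<times>\<^sub>F nhds b. vnorm (fst x + snd x - (a + b)) < e"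
      by (rule eventually_mono[OF eventually_prodI[OF ev[OF e, of a] ev[OF e, of b]]])
        (simp only: add_diff_add vnorm_add_less)
  qed
  show "(uminus \<longlongrightarrow> - a) (nhds a)"
    unfolding tendsto_iff dist_vnorm minus_diff_minus vnorm_uminus using ev by blast
qed

subsection \<open>Unconditional sums\<close>

text \<open>Convergence to 0 along the cofinite filter, for a nonnegative family. It abstracts the
  coefficient condition of \<open>power_series_on\<close> to arbitrary index sets, since products of
  series are summed over pairs.\<close>

definition null_family :: "'i set \<Rightarrow> ('i \<Rightarrow> real) \<Rightarrow> bool" where
  "null_family A t \<longleftrightarrow> (\<forall>\<epsilon>>0. finite {i\<in>A. \<epsilon> \<le> t i})"

lemma null_familyD: "null_family A t \<Longrightarrow> 0 < \<epsilon> \<Longrightarrow> finite {i\<in>A. \<epsilon> \<le> t i}"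
  by (simp add: null_family_def)

lemma null_family_mono:
  assumes "null_family A t" "\<And>i. i \<in> A \<Longrightarrow> s i \<le> t i"
  shows "null_family A s"
  unfolding null_family_def
proof (intro allI impI)
  fix \<epsilon> :: real assume "0 < \<epsilon>"
  then show "finite {i\<in>A. \<epsilon> \<le> s i}"
    by (rule finite_subset[OF _ null_familyD[OF assms(1)], rotated]) (use assms(2) in force)
qed

lemma null_family_max:
  assumes "null_family A s" "null_family A t"
  shows "null_family A (\<lambda>i. max (s i) (t i))"
  unfolding null_family_def
proof (intro allI impI)
  fix \<epsilon> :: real assume "0 < \<epsilon>"
  then have "finite ({i\<in>A. \<epsilon> \<le> s i} \<union> {i\<in>A. \<epsilon> \<le> t i})"
    using assms by (simp add: null_family_def)
  then show "finite {i\<in>A. \<epsilon> \<le> max (s i) (t i)}"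
    by (rule finite_subset[rotated]) auto
qed

text \<open>If a product of bounded factors is at least \<epsilon>, each factor is at least
  \<epsilon> divided by the bound of the other, which confines the pair to a product of two finite
  sets.\<close>

lemma null_family_prod:
  assumes s: "null_family A s" and t: "null_family B t"
    and "\<And>i. i \<in> A \<Longrightarrow> 0 \<le> s i \<and> s i \<le> C" "\<And>j. j \<in> B \<Longrightarrow> 0 \<le> t j \<and> t j \<le> D"
  shows "null_family (A \<times> B) (\<lambda>(i, j). s i * t j)"
  unfolding null_family_def
proof (intro allI impI)
  fix \<epsilon> :: real assume \<epsilon>: "0 < \<epsilon>"
  \<comment> \<open>Bounds of at least 1 keep the divisions below legitimate when \<open>C\<close>
    or \<open>D\<close> is not positive.\<close>
  define C' D' where "C' = max C 1" and "D' = max D 1"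
  have pos: "0 < C'" "0 < D'" by (auto simp: C'_def D'_def)
  have "finite ({i\<in>A. \<epsilon> / D' \<le> s i} \<times> {j\<in>B. \<epsilon> / C' \<le> t j})"
    using s t \<epsilon> pos by (auto simp: null_family_def)
  moreover have "{p \<in> A \<times> B. \<epsilon> \<le> (case p of (i, j) \<Rightarrow> s i * t j)} \<subseteq> {i\<in>A. \<epsilon> / D' \<le> s i} \<times> {j\<in>B. \<epsilon> / C' \<le> t j}"
  proof clarsimp
    fix i j assume ij: "i \<in> A" "j \<in> B" "\<epsilon> \<le> s i * t j"
    have 1: "0 \<le> s i" "s i \<le> C'" "0 \<le> t j" "t j \<le> D'"
      using assms(3)[OF ij(1)] assms(4)[OF ij(2)] by (auto simp: C'_def D'_def)
    have "s i * t j \<le> s i * D'" "s i * t j \<le> C' * t j"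
      using 1 by (auto intro: mult_left_mono mult_right_mono)
    then show "\<epsilon> / D' \<le> s i \<and> \<epsilon> / C' \<le> t j"
      using ij(3) pos by (auto simp: field_simps)
  qed
  ultimately show "finite {p \<in> A \<times> B. \<epsilon> \<le> (case p of (i, j) \<Rightarrow> s i * t j)}"
    by (rule finite_subset[rotated])
qed

lemma has_sum_iff_vnorm:
  fixes f :: "'i \<Rightarrow> 'a::nonarch_field"
  shows "(f has_sum s) A \<longleftrightarrow>
    (\<forall>\<epsilon>>0. \<exists>F. finite F \<and> F \<subseteq> A \<and> (\<forall>G. finite G \<longrightarrow> F \<subseteq> G \<longrightarrow> G \<subseteq> A \<longrightarrow> vnorm (sum f G - s) < \<epsilon>))"
  unfolding has_sum_def tendsto_iff eventually_finite_subsets_at_top dist_vnorm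
  by (simp only: imp_conjL)

text \<open>Once a finite set contains all terms of norm at least \<epsilon>, enlarging it changes
  the partial sum by less than \<epsilon>. So a null family has to be tested only on some
  arbitrarily large finite sets.\<close>

lemma has_sum_vnormI:
  fixes f :: "'i \<Rightarrow> 'a::nonarch_field"
  assumes null: "null_family A (\<lambda>i. vnorm (f i))"
    and ex: "\<And>\<epsilon> E. 0 < \<epsilon> \<Longrightarrow> finite E \<Longrightarrow> E \<subseteq> A \<Longrightarrow>
      \<exists>F. finite F \<and> E \<subseteq> F \<and> F \<subseteq> A \<and> vnorm (sum f F - s) < \<epsilon>"
  shows "(f has_sum s) A"
  unfolding has_sum_iff_vnorm
proof (intro allI impI)
  fix \<epsilon> :: real assume \<epsilon>: "0 < \<epsilon>"
  obtain F where F: "finite F" "{i\<in>A. \<epsilon> \<le> vnorm (f i)} \<subseteq> F" "F \<subseteq> A" "vnorm (sum f F - s) < \<epsilon>"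
    using ex[OF \<epsilon> null_familyD[OF null \<epsilon>]] by auto
  have "vnorm (sum f G - s) < \<epsilon>" if G: "finite G" "F \<subseteq> G" "G \<subseteq> A" for G
  proof -
    have "vnorm (sum f (G - F)) < \<epsilon>"
      using F G \<epsilon> by (intro vnorm_sum_less) auto
    moreover have "sum f G - s = sum f (G - F) + (sum f F - s)"
      using sum.subset_diff[OF G(2,1), of f] by simp
    ultimately show ?thesis
      using F(4) by (simp only: vnorm_add_less)
  qed
  then show "\<exists>F. finite F \<and> F \<subseteq> A \<and> (\<forall>G. finite G \<longrightarrow> F \<subseteq> G \<longrightarrow> G \<subseteq> A \<longrightarrow> vnorm (sum f G - s) < \<epsilon>)"
    using F by blast
qed

lemma has_sum_vnormE:
  fixes f :: "'i \<Rightarrow> 'a::nonarch_field"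
  assumes "(f has_sum s) A" "0 < \<epsilon>"
  obtains F where "finite F" "F \<subseteq> A"
    "\<And>G. finite G \<Longrightarrow> F \<subseteq> G \<Longrightarrow> G \<subseteq> A \<Longrightarrow> vnorm (sum f G - s) < \<epsilon>"
  using assms unfolding has_sum_iff_vnorm by metis

lemma has_sum_vnorm_le:
  fixes f :: "'i \<Rightarrow> 'a::nonarch_field"
  assumes "(f has_sum s) A" "0 \<le> C" "\<And>i. i \<in> A \<Longrightarrow> vnorm (f i) \<le> C"
  shows "vnorm s \<le> C"
proof (rule field_le_epsilon)
  fix \<epsilon> :: real assume "0 < \<epsilon>"
  then obtain F where F: "finite F" "F \<subseteq> A" "vnorm (sum f F - s) < \<epsilon>"
    using has_sum_vnormE[OF assms(1)] by (metis subset_refl)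
  have "vnorm (sum f F) \<le> C"
    using F assms by (intro vnorm_sum_le) auto
  moreover have "s = sum f F - (sum f F - s)" by simp
  ultimately show "vnorm s \<le> C + \<epsilon>"
    using F(3) assms(2) \<open>0 < \<epsilon>\<close> vnorm_diff_le_max[of "sum f F" "sum f F - s"] by auto
qed

lemma has_sum_vnorm_Times:
  fixes f :: "'i \<Rightarrow> 'a::nonarch_field" and g :: "'j \<Rightarrow> 'a"
  assumes f: "(f has_sum s) A" "null_family A (\<lambda>i. vnorm (f i))" "\<And>i. i \<in> A \<Longrightarrow> vnorm (f i) \<le> C"
    and g: "(g has_sum t) B" "null_family B (\<lambda>i. vnorm (g i))" "\<And>i. i \<in> B \<Longrightarrow> vnorm (g i) \<le> D"
  shows "((\<lambda>(i, j). f i * g j) has_sum (s * t)) (A \<times> B)"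
proof (rule has_sum_vnormI)
  show "null_family (A \<times> B) (\<lambda>p. vnorm (case p of (i, j) \<Rightarrow> f i * g j))"
    using null_family_prod[OF f(2) g(2), of C D] f(3) g(3) by (simp add: vnorm_mult case_prod_unfold)
next
  fix \<epsilon> :: real and E assume \<epsilon>: "0 < \<epsilon>" and E: "finite E" "E \<subseteq> A \<times> B"
  \<comment> \<open>\<open>K\<close> exceeds both |s| and the norm of the partial sum of
    \<open>g\<close>, the latter because that sum is within \<delta> \<le> \<epsilon> of
    \<open>t\<close>. These are the factors that multiply the two errors when the difference is
    split below.\<close>
  define K where "K = vnorm s + vnorm t + \<epsilon> + 1"
  have "0 < K" using \<epsilon> vnorm_ge_0[of s] vnorm_ge_0[of t] unfolding K_def by linarith
  define \<delta> where "\<delta> = min \<epsilon> (\<epsilon> / K)"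
  have "0 < \<delta>" using \<epsilon> \<open>0 < K\<close> by (simp add: \<delta>_def)
  obtain F1 where F1: "finite F1" "F1 \<subseteq> A" "\<And>G. finite G \<Longrightarrow> F1 \<subseteq> G \<Longrightarrow> G \<subseteq> A \<Longrightarrow> vnorm (sum f G - s) < \<delta>"
    using has_sum_vnormE[OF f(1) \<open>0 < \<delta>\<close>] by metis
  obtain F2 where F2: "finite F2" "F2 \<subseteq> B" "\<And>G. finite G \<Longrightarrow> F2 \<subseteq> G \<Longrightarrow> G \<subseteq> B \<Longrightarrow> vnorm (sum g G - t) < \<delta>"
    using has_sum_vnormE[OF g(1) \<open>0 < \<delta>\<close>] by metis
  define G1 G2 where "G1 = F1 \<union> fst ` E" and "G2 = F2 \<union> snd ` E"
  have G: "finite G1" "finite G2" "G1 \<subseteq> A" "G2 \<subseteq> B" "E \<subseteq> G1 \<times> G2"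
    using F1 F2 E by (auto simp: G1_def G2_def intro: rev_image_eqI)
  have 1: "vnorm (sum f G1 - s) < \<delta>" and 2: "vnorm (sum g G2 - t) < \<delta>"
    using F1(3)[of G1] F2(3)[of G2] G by (auto simp: G1_def G2_def)
  have "vnorm (sum g G2) \<le> max (vnorm (sum g G2 - t)) (vnorm t)"
    using vnorm_add_le_max[of "sum g G2 - t" t] by simp
  then have "vnorm (sum g G2) < K"
    using 2 vnorm_ge_0[of s] vnorm_ge_0[of t] \<epsilon> unfolding K_def \<delta>_def by linarith
  have "vnorm s < K" using \<epsilon> vnorm_ge_0[of t] unfolding K_def by linarith
  have "vnorm ((sum f G1 - s) * sum g G2) < \<delta> * K"
    unfolding vnorm_mult using 1 \<open>vnorm (sum g G2) < K\<close> by (intro mult_strict_mono') auto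
  moreover have "vnorm (s * (sum g G2 - t)) < K * \<delta>"
    unfolding vnorm_mult using 2 \<open>vnorm s < K\<close> by (intro mult_strict_mono') auto
  moreover have "\<delta> * K \<le> \<epsilon>"
    using \<open>0 < K\<close> \<epsilon> by (auto simp: \<delta>_def min_def field_simps)
  ultimately have "vnorm ((sum f G1 - s) * sum g G2) < \<epsilon>" "vnorm (s * (sum g G2 - t)) < \<epsilon>"
    by (simp_all add: mult.commute)
  then have "vnorm ((sum f G1 - s) * sum g G2 + s * (sum g G2 - t)) < \<epsilon>"
    by (rule vnorm_add_less)
  moreover have "(\<Sum>(i, j)\<in>G1 \<times> G2. f i * g j) - s * t
      = (sum f G1 - s) * sum g G2 + s * (sum g G2 - t)"
    by (simp add: sum_product sum.cartesian_product[symmetric] algebra_simps)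
  ultimately show "\<exists>F. finite F \<and> E \<subseteq> F \<and> F \<subseteq> A \<times> B \<and> vnorm ((\<Sum>p\<in>F. case p of (i, j) \<Rightarrow> f i * g j) - s * t) < \<epsilon>"
    using G by (intro exI[of _ "G1 \<times> G2"]) auto
qed

text \<open>Finitely many finite fibres make up a finite index set, so their total is an ordinary
  partial sum. In the Cauchy product the fibres are the decompositions of a multi-index.\<close>

lemma has_sum_vnorm_fibres:
  fixes t :: "'i \<Rightarrow> 'a::nonarch_field"
  assumes t: "(t has_sum s) P" "null_family P (\<lambda>i. vnorm (t i))"
    and \<pi>: "\<pi> ` P \<subseteq> \<Gamma>" "\<And>\<gamma>. \<gamma> \<in> \<Gamma> \<Longrightarrow> finite {p\<in>P. \<pi> p = \<gamma>}"
  shows "((\<lambda>\<gamma>. \<Sum>p | p \<in> P \<and> \<pi> p = \<gamma>. t p) has_sum s) \<Gamma>"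
proof (rule has_sum_vnormI)
  let ?c = "\<lambda>\<gamma>. \<Sum>p | p \<in> P \<and> \<pi> p = \<gamma>. t p"
  show "null_family \<Gamma> (\<lambda>\<gamma>. vnorm (?c \<gamma>))"
    unfolding null_family_def
  proof (intro allI impI)
    fix \<epsilon> :: real assume \<epsilon>: "0 < \<epsilon>"
    have "{\<gamma>\<in>\<Gamma>. \<epsilon> \<le> vnorm (?c \<gamma>)} \<subseteq> \<pi> ` {p\<in>P. \<epsilon> \<le> vnorm (t p)}"
    proof
      fix \<gamma> assume "\<gamma> \<in> {\<gamma>\<in>\<Gamma>. \<epsilon> \<le> vnorm (?c \<gamma>)}"
      then have "\<not> vnorm (?c \<gamma>) < \<epsilon>" by simp
      then obtain p where "p \<in> P" "\<pi> p = \<gamma>" "\<not> vnorm (t p) < \<epsilon>"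
        using vnorm_sum_less[OF \<epsilon>, of "{p\<in>P. \<pi> p = \<gamma>}" t] by blast
      then show "\<gamma> \<in> \<pi> ` {p\<in>P. \<epsilon> \<le> vnorm (t p)}"
        by (intro image_eqI[of _ _ p]) auto
    qed
    then show "finite {\<gamma>\<in>\<Gamma>. \<epsilon> \<le> vnorm (?c \<gamma>)}"
      by (rule finite_subset) (use null_familyD[OF t(2) \<epsilon>] in simp)
  qed
  fix \<epsilon> :: real and E assume \<epsilon>: "0 < \<epsilon>" and E: "finite E" "E \<subseteq> \<Gamma>"
  obtain F where F: "finite F" "F \<subseteq> P" "\<And>G. finite G \<Longrightarrow> F \<subseteq> G \<Longrightarrow> G \<subseteq> P \<Longrightarrow> vnorm (sum t G - s) < \<epsilon>"
    using has_sum_vnormE[OF t(1) \<epsilon>] by metis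
  define H where "H = E \<union> \<pi> ` F"
  have H: "finite H" "H \<subseteq> \<Gamma>"
    using E F(1,2) \<pi>(1) unfolding H_def by blast+
  define G where "G = (\<Union>\<gamma>\<in>H. {p\<in>P. \<pi> p = \<gamma>})"
  have "sum ?c H = sum t G"
    unfolding G_def using H \<pi>(2) by (subst sum.UNION_disjoint) (auto simp: subset_iff)
  moreover have "finite G" "F \<subseteq> G" "G \<subseteq> P"
  proof -
    show "finite G" unfolding G_def using H \<pi>(2) by blast
    show "F \<subseteq> G" "G \<subseteq> P" using F(2) by (auto simp: G_def H_def)
  qed
  ultimately show "\<exists>F. finite F \<and> E \<subseteq> F \<and> F \<subseteq> \<Gamma> \<and> vnorm (sum ?c F - s) < \<epsilon>"
    using F(3)[of G] H by (intro exI[of _ H]) (auto simp: H_def)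
qed

text \<open>Only the largest missing term matters ultrametrically, so the partial sums over the
  terms of norm at least 1/(k+1) form a Cauchy sequence; its limit is the unconditional sum.\<close>

lemma has_sum_vnorm_exists:
  fixes t :: "'i \<Rightarrow> 'a::{nonarch_field, complete_space}"
  assumes null: "null_family A (\<lambda>i. vnorm (t i))"
  shows "\<exists>s. (t has_sum s) A"
proof -
  define E where "E k = {i\<in>A. inverse (real (Suc k)) \<le> vnorm (t i)}" for k
  have fin: "finite (E k)" for k
    using null by (simp add: E_def null_family_def)
  have mono: "E k \<subseteq> E m" if "k \<le> m" for k m
  proof -
    have "inverse (real (Suc m)) \<le> inverse (real (Suc k))"
      using that by (intro le_imp_inverse_le) auto
    then show ?thesis
      by (simp only: E_def Collect_mono_iff) (blast intro: order.trans)
  qed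
  have diff: "vnorm (sum t G - sum t (E k)) < inverse (real (Suc k))"
    if "finite G" "E k \<subseteq> G" "G \<subseteq> A" for G k
  proof -
    have "sum t G - sum t (E k) = sum t (G - E k)"
      using sum.subset_diff[OF that(2,1), of t] by simp
    also have "vnorm \<dots> < inverse (real (Suc k))"
      using that by (intro vnorm_sum_less) (auto simp: E_def)
    finally show ?thesis .
  qed
  have "Cauchy (\<lambda>k. sum t (E k))"
  proof (rule metric_CauchyI)
    fix e :: real assume "0 < e"
    then obtain M where M: "inverse (real (Suc M)) < e" using reals_Archimedean by blast
    have 1: "vnorm (sum t (E m) - sum t (E M)) < e" if "m \<ge> M" for m
    proof -
      have "E m \<subseteq> A" by (auto simp: E_def)
      then show ?thesis
        using order.strict_trans[OF diff[OF fin mono[OF that]] M] by blast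
    qed
    have "dist (sum t (E m)) (sum t (E n)) < e" if "m \<ge> M" "n \<ge> M" for m n
      using vnorm_diff_le_less[OF 1[OF that(1)] 1[OF that(2)]] by (simp add: dist_vnorm)
    then show "\<exists>M. \<forall>m\<ge>M. \<forall>n\<ge>M. dist (sum t (E m)) (sum t (E n)) < e" by blast
  qed
  then obtain s where s: "(\<lambda>k. sum t (E k)) \<longlonglongrightarrow> s"
    using Cauchy_convergent convergent_def by blast
  have "(t has_sum s) A"
    unfolding has_sum_iff_vnorm
  proof (intro allI impI)
    fix \<epsilon> :: real assume \<epsilon>: "0 < \<epsilon>"
    obtain K where K: "\<And>k. k \<ge> K \<Longrightarrow> vnorm (sum t (E k) - s) < \<epsilon>"
      using s \<epsilon> unfolding lim_sequentially dist_vnorm by blast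
    obtain M where M: "inverse (real (Suc M)) < \<epsilon>" using \<epsilon> reals_Archimedean by blast
    define k where "k = max K M"
    have k: "inverse (real (Suc k)) < \<epsilon>"
      using M by (rule le_less_trans[rotated], intro le_imp_inverse_le) (auto simp: k_def)
    have "vnorm (sum t G - s) < \<epsilon>" if "finite G" "E k \<subseteq> G" "G \<subseteq> A" for G
    proof -
      have "sum t G - s = (sum t G - sum t (E k)) + (sum t (E k) - s)" by simp
      moreover have "vnorm (sum t G - sum t (E k)) < \<epsilon>"
        using diff[OF that] k by (rule order.strict_trans)
      moreover have "vnorm (sum t (E k) - s) < \<epsilon>"
        by (rule K) (simp add: k_def)
      ultimately show ?thesis
        by (simp only: vnorm_add_less)
    qed
    then show "\<exists>F. finite F \<and> F \<subseteq> A \<and> (\<forall>G. finite G \<longrightarrow> F \<subseteq> G \<longrightarrow> G \<subseteq> A \<longrightarrow> vnorm (sum t G - s) < \<epsilon>)"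
      using fin[of k] by (intro exI[of _ "E k"]) (auto simp: E_def)
  qed
  then show ?thesis ..
qed

section \<open>Multi-indices\<close>

lemma lookup_notin_multi_indices: "\<alpha> \<in> multi_indices d \<Longrightarrow> d \<le> i \<Longrightarrow> Poly_Mapping.lookup \<alpha> i = 0"
  by (force simp: multi_indices_def in_keys_iff subset_iff)

lemma multi_indicesI:
  assumes "\<And>i. d \<le> i \<Longrightarrow> Poly_Mapping.lookup \<alpha> i = 0"
  shows "\<alpha> \<in> multi_indices d"
proof -
  have "i < d" if "Poly_Mapping.lookup \<alpha> i \<noteq> 0" for i
    by (rule ccontr) (use assms that in simp)
  then show ?thesis
    by (auto simp: multi_indices_def in_keys_iff)
qed

lemma zero_in_multi_indices [simp]: "0 \<in> multi_indices d"
  by (rule multi_indicesI) simp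

lemma multi_indices_add_iff: "\<alpha> + \<beta> \<in> multi_indices d \<longleftrightarrow> \<alpha> \<in> multi_indices d \<and> \<beta> \<in> multi_indices d"
proof safe
  assume "\<alpha> + \<beta> \<in> multi_indices d"
  then have "\<And>i. d \<le> i \<Longrightarrow> Poly_Mapping.lookup \<alpha> i = 0 \<and> Poly_Mapping.lookup \<beta> i = 0"
    using lookup_notin_multi_indices[of "\<alpha> + \<beta>" d] by (simp add: lookup_add)
  then show "\<alpha> \<in> multi_indices d" "\<beta> \<in> multi_indices d"
    by (auto intro: multi_indicesI)
qed (auto intro!: multi_indicesI simp: lookup_add lookup_notin_multi_indices)

lemma single_in_multi_indices: "i < d \<Longrightarrow> Poly_Mapping.single i k \<in> multi_indices d"
  by (rule multi_indicesI) (auto simp: lookup_single when_def)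

lemma multi_degree_superset:
  "finite A \<Longrightarrow> Poly_Mapping.keys \<alpha> \<subseteq> A \<Longrightarrow> multi_degree \<alpha> = (\<Sum>i\<in>A. Poly_Mapping.lookup \<alpha> i)"
  unfolding multi_degree_def by (rule sum.mono_neutral_left) (auto simp: in_keys_iff)

lemma multi_degree_eq: "\<alpha> \<in> multi_indices d \<Longrightarrow> multi_degree \<alpha> = (\<Sum>i<d. Poly_Mapping.lookup \<alpha> i)"
  by (rule multi_degree_superset) (auto simp: multi_indices_def)

lemma multi_degree_zero [simp]: "multi_degree 0 = 0"
  by (simp add: multi_degree_def)

lemma multi_degree_single [simp]: "multi_degree (Poly_Mapping.single i k) = k"
  by (simp add: multi_degree_def)

lemma keys_add_subset: "Poly_Mapping.keys (\<alpha> + \<beta> :: nat \<Rightarrow>\<^sub>0 nat) = Poly_Mapping.keys \<alpha> \<union> Poly_Mapping.keys \<beta>"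
  by (auto simp: in_keys_iff lookup_add)

lemma multi_degree_add: "multi_degree (\<alpha> + \<beta>) = multi_degree \<alpha> + multi_degree \<beta>"
proof -
  let ?A = "Poly_Mapping.keys \<alpha> \<union> Poly_Mapping.keys \<beta>"
  have "multi_degree (\<alpha> + \<beta>) = (\<Sum>i\<in>?A. Poly_Mapping.lookup (\<alpha> + \<beta>) i)"
    by (rule multi_degree_superset) (auto simp: keys_add_subset)
  also have "\<dots> = multi_degree \<alpha> + multi_degree \<beta>"
    by (simp add: lookup_add sum.distrib multi_degree_superset[of ?A])
  finally show ?thesis .
qed

lemma finite_multi_index_box:
  assumes "finite A"
  shows "finite {\<alpha> :: nat \<Rightarrow>\<^sub>0 nat. Poly_Mapping.keys \<alpha> \<subseteq> A \<and> (\<forall>i\<in>A. Poly_Mapping.lookup \<alpha> i \<le> N)}"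
    (is "finite ?S")
proof (rule finite_imageD)
  have "Poly_Mapping.lookup ` ?S \<subseteq> {f. \<forall>i. (i \<in> A \<longrightarrow> f i \<in> {..N}) \<and> (i \<notin> A \<longrightarrow> f i = 0)}"
    unfolding image_subset_iff by (force simp: in_keys_iff)
  then show "finite (Poly_Mapping.lookup ` ?S)"
    by (rule finite_subset) (rule finite_set_of_finite_funs, use assms in simp_all)
  show "inj_on Poly_Mapping.lookup ?S"
    by (simp add: inj_on_def lookup_inject)
qed

lemma lookup_le_multi_degree: "Poly_Mapping.lookup \<alpha> i \<le> multi_degree \<alpha>"
  unfolding multi_degree_def
  by (cases "i \<in> Poly_Mapping.keys \<alpha>") (auto intro: member_le_sum simp: in_keys_iff)

lemma finite_multi_indices_degree: "finite {\<alpha> \<in> multi_indices d. multi_degree \<alpha> \<le> N}"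
  by (rule finite_subset[OF _ finite_multi_index_box[of "{..<d}" N]])
    (auto simp: multi_indices_def intro: order_trans[OF lookup_le_multi_degree])

lemma finite_add_decompositions: "finite {p :: (nat \<Rightarrow>\<^sub>0 nat) \<times> (nat \<Rightarrow>\<^sub>0 nat). fst p + snd p = \<gamma>}"
proof -
  let ?S = "{\<alpha>. Poly_Mapping.keys \<alpha> \<subseteq> Poly_Mapping.keys \<gamma> \<and> (\<forall>i\<in>Poly_Mapping.keys \<gamma>. Poly_Mapping.lookup \<alpha> i \<le> multi_degree \<gamma>)}"
  have "{p. fst p + snd p = \<gamma>} \<subseteq> ?S \<times> ?S"
  proof clarsimp
    fix \<alpha> \<beta>
    have "Poly_Mapping.lookup \<alpha> i \<le> multi_degree (\<alpha> + \<beta>)" "Poly_Mapping.lookup \<beta> i \<le> multi_degree (\<alpha> + \<beta>)" for i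
      using lookup_le_multi_degree[of "\<alpha> + \<beta>" i] by (auto simp: lookup_add)
    then show "Poly_Mapping.keys \<alpha> \<subseteq> Poly_Mapping.keys (\<alpha> + \<beta>) \<and>
      (\<forall>i\<in>Poly_Mapping.keys (\<alpha> + \<beta>). Poly_Mapping.lookup \<alpha> i \<le> multi_degree (\<alpha> + \<beta>)) \<and>
      Poly_Mapping.keys \<beta> \<subseteq> Poly_Mapping.keys (\<alpha> + \<beta>) \<and>
      (\<forall>i\<in>Poly_Mapping.keys (\<alpha> + \<beta>). Poly_Mapping.lookup \<beta> i \<le> multi_degree (\<alpha> + \<beta>))"
      by (auto simp: keys_add_subset)
  qed
  then show ?thesis
    by (rule finite_subset) (simp add: finite_multi_index_box)
qed

lemma monom_value_superset:
  "finite A \<Longrightarrow> Poly_Mapping.keys \<alpha> \<subseteq> A \<Longrightarrow> monom_value \<alpha> x = (\<Prod>i\<in>A. x i ^ Poly_Mapping.lookup \<alpha> i)"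
  unfolding monom_value_def by (rule prod.mono_neutral_left) (auto simp: in_keys_iff)

lemma monom_value_zero [simp]: "monom_value 0 x = 1"
  by (simp add: monom_value_def)

lemma monom_value_single [simp]: "monom_value (Poly_Mapping.single i k) x = x i ^ k"
  by (auto simp: monom_value_def)

lemma monom_value_add: "monom_value (\<alpha> + \<beta>) x = monom_value \<alpha> x * monom_value \<beta> x"
proof -
  let ?A = "Poly_Mapping.keys \<alpha> \<union> Poly_Mapping.keys \<beta>"
  have "monom_value (\<alpha> + \<beta>) x = (\<Prod>i\<in>?A. x i ^ Poly_Mapping.lookup (\<alpha> + \<beta>) i)"
    by (rule monom_value_superset) (auto simp: keys_add_subset)
  also have "\<dots> = monom_value \<alpha> x * monom_value \<beta> x"
    by (simp add: lookup_add power_add prod.distrib monom_value_superset[of ?A])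
  finally show ?thesis .
qed

lemma vnorm_prod: "vnorm (prod f A) = (\<Prod>i\<in>A. vnorm (f i))"
  by (induction A rule: infinite_finite_induct) (auto simp: vnorm_mult)

lemma vnorm_monom_value_le:
  fixes z :: "nat \<Rightarrow> 'a::nonarch_field"
  assumes "\<alpha> \<in> multi_indices d" "\<And>i. i < d \<Longrightarrow> vnorm (z i) \<le> r"
  shows "vnorm (monom_value \<alpha> z) \<le> r ^ multi_degree \<alpha>"
proof -
  have "vnorm (monom_value \<alpha> z) = (\<Prod>i\<in>Poly_Mapping.keys \<alpha>. vnorm (z i) ^ Poly_Mapping.lookup \<alpha> i)"
    by (simp add: monom_value_def vnorm_prod vnorm_power)
  also have "\<dots> \<le> (\<Prod>i\<in>Poly_Mapping.keys \<alpha>. r ^ Poly_Mapping.lookup \<alpha> i)"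
    using assms by (intro prod_mono conjI power_mono) (auto simp: multi_indices_def)
  also have "\<dots> = r ^ multi_degree \<alpha>"
    by (simp add: power_sum multi_degree_def)
  finally show ?thesis .
qed

lemma has_sum_single_support:
  fixes f :: "'i \<Rightarrow> 'a::nonarch_field"
  assumes "j \<in> A" "\<And>i. i \<in> A \<Longrightarrow> i \<noteq> j \<Longrightarrow> f i = 0" "f j = s"
  shows "(f has_sum s) A"
proof -
  have "(f has_sum sum f {j}) {j}" by (rule has_sum_finite) simp
  then show ?thesis
    using has_sum_cong_neutral[of A "{j}" f f s] assms by auto
qed

section \<open>Strictly convergent power series\<close>

text \<open>Besides the field extension, the identity of the base field is an instance: chart
  coordinates are series over the base field, functions take values in the extension, and the same
  lemmas treat both.\<close>

locale isometric_embedding =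
  fixes \<iota> :: "'q::nonarch_field \<Rightarrow> 'l::nonarch_field"
  assumes emb_one: "\<iota> 1 = 1"
    and emb_add: "\<iota> (x + y) = \<iota> x + \<iota> y"
    and emb_mult: "\<iota> (x * y) = \<iota> x * \<iota> y"
    and vnorm_emb: "vnorm (\<iota> x) = vnorm x"
begin

lemma emb_zero: "\<iota> 0 = 0"
  using emb_add[of 0 0] by (metis add.right_neutral add_left_cancel)

lemma emb_uminus: "\<iota> (- x) = - \<iota> x"
  using emb_add[of x "- x"] by (simp add: eq_neg_iff_add_eq_0 add.commute emb_zero)

lemma emb_diff: "\<iota> (x - y) = \<iota> x - \<iota> y"
  using emb_add[of x "- y"] by (simp add: emb_uminus)

lemma emb_sum: "\<iota> (sum f A) = (\<Sum>i\<in>A. \<iota> (f i))"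
  by (induction A rule: infinite_finite_induct) (auto simp: emb_add emb_zero)

lemma has_sum_emb:
  assumes "(f has_sum s) A"
  shows "((\<lambda>i. \<iota> (f i)) has_sum \<iota> s) A"
  using assms unfolding has_sum_iff_vnorm by (simp add: vnorm_emb flip: emb_sum emb_diff)

end

interpretation id_emb: isometric_embedding "\<lambda>t :: 'q::nonarch_field. t"
  by standard auto

lemma finite_extension_imp_isometric_embedding: "finite_extension \<iota> \<Longrightarrow> isometric_embedding \<iota>"
  unfolding finite_extension_def by unfold_locales auto

section \<open>Gauss norms of convergent power series\<close>

lemma power_series_on_null:
  "power_series_on \<iota> d c r a f S \<Longrightarrow> null_family (multi_indices d) (\<lambda>\<alpha>. vnorm (a \<alpha>) * r ^ multi_degree \<alpha>)"
  by (simp add: power_series_on_def null_family_def)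

lemma power_series_onI:
  assumes "\<And>\<alpha>. \<alpha> \<notin> multi_indices d \<Longrightarrow> a \<alpha> = 0"
    and "null_family (multi_indices d) (\<lambda>\<alpha>. vnorm (a \<alpha>) * r ^ multi_degree \<alpha>)"
    and "\<And>x. x \<in> S \<Longrightarrow> ((\<lambda>\<alpha>. a \<alpha> * \<iota> (monom_value \<alpha> (\<lambda>i. x i - c i))) has_sum f x) (multi_indices d)"
  shows "power_series_on \<iota> d c r a f S"
  using assms by (auto simp: power_series_on_def null_family_def)

lemma power_series_on_subset:
  "power_series_on \<iota> d c r a f S \<Longrightarrow> T \<subseteq> S \<Longrightarrow> power_series_on \<iota> d c r a f T"
  by (auto simp: power_series_on_def)

lemma power_series_on_cong:
  "power_series_on \<iota> d c r a f S \<Longrightarrow> (\<And>x. x \<in> S \<Longrightarrow> f x = g x) \<Longrightarrow> power_series_on \<iota> d c r a g S"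
  by (auto simp: power_series_on_def)

lemma power_series_on_shrink:
  assumes "power_series_on \<iota> d c r a f S" "0 \<le> r'" "r' \<le> r"
  shows "power_series_on \<iota> d c r' a f S"
proof (rule power_series_onI)
  show "null_family (multi_indices d) (\<lambda>\<alpha>. vnorm (a \<alpha>) * r' ^ multi_degree \<alpha>)"
    by (rule null_family_mono[OF power_series_on_null[OF assms(1)]])
      (use assms in \<open>auto intro!: mult_left_mono power_mono\<close>)
qed (use assms in \<open>auto simp: power_series_on_def\<close>)

text \<open>The Gauss norm as a relation. On a general set \<open>T\<close> a function may have
  several expansions, so there is no distinguished coefficient family to read a norm from; one
  expansion satisfying the bound is enough.\<close>

definition gauss_bounded ::
    "('q::nonarch_field \<Rightarrow> 'l::nonarch_field) \<Rightarrow> nat \<Rightarrow> (nat \<Rightarrow> 'q) \<Rightarrow> real \<Rightarrow> (nat \<Rightarrow> 'q) set \<Rightarrow>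
      ((nat \<Rightarrow> 'q) \<Rightarrow> 'l) \<Rightarrow> real \<Rightarrow> bool" where
  "gauss_bounded \<iota> d c r T u C \<longleftrightarrow>
     (\<exists>a. power_series_on \<iota> d c r a u T \<and> (\<forall>\<alpha>. vnorm (a \<alpha>) * r ^ multi_degree \<alpha> \<le> C))"

lemma gauss_boundedI:
  "power_series_on \<iota> d c r a u T \<Longrightarrow> (\<And>\<alpha>. vnorm (a \<alpha>) * r ^ multi_degree \<alpha> \<le> C) \<Longrightarrow>
    gauss_bounded \<iota> d c r T u C"
  by (auto simp: gauss_bounded_def)

lemma gauss_bounded_mono: "gauss_bounded \<iota> d c r T u C \<Longrightarrow> C \<le> D \<Longrightarrow> gauss_bounded \<iota> d c r T u D"
  unfolding gauss_bounded_def by (meson order_trans)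

lemma gauss_bounded_nonneg:
  assumes "gauss_bounded \<iota> d c r T u C"
  shows "0 \<le> C"
proof -
  obtain a where "power_series_on \<iota> d c r a u T" "\<And>\<alpha>. vnorm (a \<alpha>) * r ^ multi_degree \<alpha> \<le> C"
    using assms by (auto simp: gauss_bounded_def)
  from this(2)[of 0] show "0 \<le> C"
    using vnorm_ge_0[of "a 0"] by (simp del: vnorm_ge_0)
qed

lemma gauss_bounded_cong:
  "gauss_bounded \<iota> d c r T u C \<Longrightarrow> (\<And>x. x \<in> T \<Longrightarrow> u x = v x) \<Longrightarrow> gauss_bounded \<iota> d c r T v C"
  unfolding gauss_bounded_def using power_series_on_cong by metis

lemma power_series_on_bdd:
  assumes "power_series_on \<iota> d c r a u T"
  obtains C where "\<And>\<alpha>. vnorm (a \<alpha>) * r ^ multi_degree \<alpha> \<le> C"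
proof -
  let ?t = "\<lambda>\<alpha>. vnorm (a \<alpha>) * r ^ multi_degree \<alpha>"
  have "finite {\<alpha>\<in>multi_indices d. 1 \<le> ?t \<alpha>}"
    using null_familyD[OF power_series_on_null[OF assms], of 1] by simp
  then obtain B where B: "\<And>\<alpha>. \<alpha> \<in> multi_indices d \<Longrightarrow> 1 \<le> ?t \<alpha> \<Longrightarrow> ?t \<alpha> \<le> B"
    using bdd_above_finite[of "?t ` {\<alpha>\<in>multi_indices d. 1 \<le> ?t \<alpha>}"] unfolding bdd_above_def by auto
  have "?t \<alpha> \<le> max 1 B" for \<alpha>
  proof (cases "\<alpha> \<in> multi_indices d")
    case True
    then show ?thesis using B[of \<alpha>] by (cases "1 \<le> ?t \<alpha>") auto
  next
    case False
    then show ?thesis using assms by (simp add: power_series_on_def)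
  qed
  then show ?thesis using that by blast
qed

lemma power_series_on_imp_gauss_bounded:
  "power_series_on \<iota> d c r a u T \<Longrightarrow> \<exists>C. gauss_bounded \<iota> d c r T u C"
  by (meson gauss_boundedI power_series_on_bdd)

context isometric_embedding
begin

lemma gauss_bounded_emb:
  assumes "gauss_bounded (\<lambda>t. t) d c r T u C"
  shows "gauss_bounded \<iota> d c r T (\<lambda>x. \<iota> (u x)) C"
proof -
  obtain a where a: "power_series_on (\<lambda>t. t) d c r a u T" "\<And>\<alpha>. vnorm (a \<alpha>) * r ^ multi_degree \<alpha> \<le> C"
    using assms by (auto simp: gauss_bounded_def)
  show ?thesis
  proof (rule gauss_boundedI)
    show "power_series_on \<iota> d c r (\<lambda>\<alpha>. \<iota> (a \<alpha>)) (\<lambda>x. \<iota> (u x)) T"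
      using a(1) by (auto simp: power_series_on_def emb_mult emb_zero vnorm_emb dest!: has_sum_emb bspec)
  qed (use a(2) in \<open>simp add: vnorm_emb\<close>)
qed

lemma gauss_bounded_const:
  assumes "0 < r" "vnorm k \<le> C"
  shows "gauss_bounded \<iota> d c r T (\<lambda>_. k) C"
proof (rule gauss_boundedI)
  let ?a = "\<lambda>\<alpha> :: nat \<Rightarrow>\<^sub>0 nat. if \<alpha> = 0 then k else 0"
  have C: "0 \<le> C" using vnorm_ge_0[of k] assms(2) by linarith
  then show "vnorm (?a \<alpha>) * r ^ multi_degree \<alpha> \<le> C" for \<alpha>
    using assms by simp
  show "power_series_on \<iota> d c r ?a (\<lambda>_. k) T"
  proof (rule power_series_onI)
    show "null_family (multi_indices d) (\<lambda>\<alpha>. vnorm (?a \<alpha>) * r ^ multi_degree \<alpha>)"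
      unfolding null_family_def
      by (intro allI impI, rule finite_subset[of _ "{0}"]) (auto split: if_splits)
    show "((\<lambda>\<alpha>. ?a \<alpha> * \<iota> (monom_value \<alpha> (\<lambda>i. x i - c i))) has_sum k) (multi_indices d)" for x
      by (rule has_sum_single_support[of 0]) (auto simp: emb_one)
  qed auto
qed

lemma gauss_bounded_coord:
  assumes "0 < r" "i < d"
  shows "gauss_bounded \<iota> d c r T (\<lambda>x. \<iota> (x i - c i)) r"
proof (rule gauss_boundedI)
  let ?a = "\<lambda>\<alpha> :: nat \<Rightarrow>\<^sub>0 nat. if \<alpha> = Poly_Mapping.single i 1 then 1 else (0 :: 'l)"
  show "vnorm (?a \<alpha>) * r ^ multi_degree \<alpha> \<le> r" for \<alpha>
    using assms by simp
  show "power_series_on \<iota> d c r ?a (\<lambda>x. \<iota> (x i - c i)) T"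
  proof (rule power_series_onI)
    show "null_family (multi_indices d) (\<lambda>\<alpha>. vnorm (?a \<alpha>) * r ^ multi_degree \<alpha>)"
      unfolding null_family_def
      by (intro allI impI, rule finite_subset[of _ "{Poly_Mapping.single i 1}"]) (auto split: if_splits)
    show "((\<lambda>\<alpha>. ?a \<alpha> * \<iota> (monom_value \<alpha> (\<lambda>i. x i - c i))) has_sum \<iota> (x i - c i)) (multi_indices d)" for x
      by (rule has_sum_single_support[of "Poly_Mapping.single i 1"])
        (use assms in \<open>auto simp: single_in_multi_indices\<close>)
  qed (use assms in \<open>auto simp: single_in_multi_indices\<close>)
qed

lemma gauss_bounded_add:
  assumes "gauss_bounded \<iota> d c r T u C" "gauss_bounded \<iota> d c r T v C" "0 \<le> r"
  shows "gauss_bounded \<iota> d c r T (\<lambda>x. u x + v x) C"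
proof -
  obtain a b where a: "power_series_on \<iota> d c r a u T" "\<And>\<alpha>. vnorm (a \<alpha>) * r ^ multi_degree \<alpha> \<le> C"
    and b: "power_series_on \<iota> d c r b v T" "\<And>\<alpha>. vnorm (b \<alpha>) * r ^ multi_degree \<alpha> \<le> C"
    using assms by (auto simp: gauss_bounded_def)
  have le: "vnorm (a \<alpha> + b \<alpha>) * r ^ multi_degree \<alpha>
      \<le> max (vnorm (a \<alpha>) * r ^ multi_degree \<alpha>) (vnorm (b \<alpha>) * r ^ multi_degree \<alpha>)" for \<alpha>
    using mult_right_mono[OF vnorm_add_le_max[of "a \<alpha>" "b \<alpha>"], of "r ^ multi_degree \<alpha>"] assms(3)
    by (simp add: max_mult_distrib_right)
  show ?thesis
  proof (rule gauss_boundedI)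
    show "vnorm (a \<alpha> + b \<alpha>) * r ^ multi_degree \<alpha> \<le> C" for \<alpha>
      using le[of \<alpha>] a(2)[of \<alpha>] b(2)[of \<alpha>] by linarith
    show "power_series_on \<iota> d c r (\<lambda>\<alpha>. a \<alpha> + b \<alpha>) (\<lambda>x. u x + v x) T"
    proof (rule power_series_onI)
      show "null_family (multi_indices d) (\<lambda>\<alpha>. vnorm (a \<alpha> + b \<alpha>) * r ^ multi_degree \<alpha>)"
        by (rule null_family_mono[OF null_family_max[OF power_series_on_null[OF a(1)] power_series_on_null[OF b(1)]] le])
      show "((\<lambda>\<alpha>. (a \<alpha> + b \<alpha>) * \<iota> (monom_value \<alpha> (\<lambda>i. x i - c i))) has_sum (u x + v x)) (multi_indices d)" if "x \<in> T" for x
        unfolding distrib_right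
        using a(1) b(1) that by (intro has_sum_add) (auto simp: power_series_on_def)
    qed (use a b in \<open>auto simp: power_series_on_def\<close>)
  qed
qed

lemma vnorm_term_le:
  assumes "x \<in> polydisc d c r" "\<alpha> \<in> multi_indices d"
  shows "vnorm (a * \<iota> (monom_value \<alpha> (\<lambda>i. x i - c i))) \<le> vnorm a * r ^ multi_degree \<alpha>"
  unfolding vnorm_mult vnorm_emb
  using assms by (intro mult_left_mono vnorm_monom_value_le) (auto simp: polydisc_def)

lemma gauss_bounded_vnorm_le:
  assumes "gauss_bounded \<iota> d c r T u C" "x \<in> T" "x \<in> polydisc d c r"
  shows "vnorm (u x) \<le> C"
proof -
  obtain a where a: "power_series_on \<iota> d c r a u T" "\<And>\<alpha>. vnorm (a \<alpha>) * r ^ multi_degree \<alpha> \<le> C"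
    using assms by (auto simp: gauss_bounded_def)
  show ?thesis
    by (rule has_sum_vnorm_le[where f = "\<lambda>\<alpha>. a \<alpha> * \<iota> (monom_value \<alpha> (\<lambda>i. x i - c i))" and A = "multi_indices d"])
      (use a assms gauss_bounded_nonneg[OF assms(1)] in
        \<open>auto simp: power_series_on_def intro: order_trans[OF vnorm_term_le]\<close>)
qed

text \<open>The Cauchy product works because the weights \<open>r ^ multi_degree \<alpha>\<close>
  are multiplicative: a coefficient of the product is a finite sum over decompositions,
  ultrametrically no larger than its largest summand. \<open>T\<close> lies in the polydisc so that
  both series are null families at its points.\<close>

lemma gauss_bounded_mult:
  assumes u: "gauss_bounded \<iota> d c r T u C" and v: "gauss_bounded \<iota> d c r T v D"
    and r: "0 \<le> r" and T: "T \<subseteq> polydisc d c r"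
  shows "gauss_bounded \<iota> d c r T (\<lambda>x. u x * v x) (C * D)"
proof -
  let ?M = "multi_indices d"
  obtain a b where a: "power_series_on \<iota> d c r a u T" "\<And>\<alpha>. vnorm (a \<alpha>) * r ^ multi_degree \<alpha> \<le> C"
    and b: "power_series_on \<iota> d c r b v T" "\<And>\<alpha>. vnorm (b \<alpha>) * r ^ multi_degree \<alpha> \<le> D"
    using assms by (auto simp: gauss_bounded_def)
  have C: "0 \<le> C" and D: "0 \<le> D"
    using gauss_bounded_nonneg[OF u] gauss_bounded_nonneg[OF v] .
  define w where "w = (\<lambda>(\<alpha>, \<beta>). (vnorm (a \<alpha>) * r ^ multi_degree \<alpha>) * (vnorm (b \<beta>) * r ^ multi_degree \<beta>))"
  have w_null: "null_family (?M \<times> ?M) w"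
    unfolding w_def
    by (rule null_family_prod[where C = C and D = D])
      (use power_series_on_null[OF a(1)] power_series_on_null[OF b(1)] a(2) b(2) r in auto)
  have w_le: "w p \<le> C * D" for p
    unfolding w_def using a(2) b(2) C r by (auto intro!: mult_mono split: prod.split)
  define fib where "fib \<gamma> = {p. p \<in> ?M \<times> ?M \<and> fst p + snd p = \<gamma>}" for \<gamma>
  have fib_fin: "finite (fib \<gamma>)" for \<gamma>
    unfolding fib_def by (rule finite_subset[OF _ finite_add_decompositions[of \<gamma>]]) auto
  define e where "e \<gamma> = (\<Sum>p\<in>fib \<gamma>. a (fst p) * b (snd p))" for \<gamma>
  have term_w: "vnorm (a (fst p) * b (snd p)) * r ^ multi_degree \<gamma> = w p" if "p \<in> fib \<gamma>" for p \<gamma>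
    using that by (auto simp: fib_def w_def vnorm_mult multi_degree_add power_add)
  \<comment> \<open>A single pair dominates the coefficient. Knowing the pair, and not only the
    bound, also yields the decay: large coefficients come from large pairs, of which there are
    finitely many.\<close>
  have e_le: "\<exists>p\<in>fib \<gamma>. vnorm (e \<gamma>) * r ^ multi_degree \<gamma> \<le> w p" if "fib \<gamma> \<noteq> {}" for \<gamma>
  proof -
    let ?v = "\<lambda>p. vnorm (a (fst p) * b (snd p))"
    have "Max (?v ` fib \<gamma>) \<in> ?v ` fib \<gamma>"
      using that fib_fin[of \<gamma>] by (intro Max_in) auto
    then obtain p where "p \<in> fib \<gamma>" "?v p = Max (?v ` fib \<gamma>)" by auto
    then have p: "p \<in> fib \<gamma>" "\<And>q. q \<in> fib \<gamma> \<Longrightarrow> ?v q \<le> ?v p"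
      using fib_fin[of \<gamma>] by auto
    have "vnorm (e \<gamma>) \<le> vnorm (a (fst p) * b (snd p))"
      unfolding e_def using p by (intro vnorm_sum_le) auto
    then show ?thesis
      using p(1) r by (auto intro!: bexI[of _ p] mult_right_mono simp flip: term_w[OF p(1)])
  qed
  have fib_empty: "fib \<gamma> = {} \<Longrightarrow> e \<gamma> = 0" for \<gamma> by (simp add: e_def)
  show ?thesis
  proof (rule gauss_boundedI)
    show "vnorm (e \<gamma>) * r ^ multi_degree \<gamma> \<le> C * D" for \<gamma>
    proof (cases "fib \<gamma> = {}")
      case False
      then obtain p where "vnorm (e \<gamma>) * r ^ multi_degree \<gamma> \<le> w p" using e_le by blast
      then show ?thesis using w_le by (rule order_trans)
    qed (use C D fib_empty in auto)
    show "power_series_on \<iota> d c r e (\<lambda>x. u x * v x) T"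
    proof (rule power_series_onI)
      show "e \<gamma> = 0" if "\<gamma> \<notin> ?M" for \<gamma>
        by (rule fib_empty) (use that in \<open>auto simp: fib_def multi_indices_add_iff\<close>)
      show "null_family ?M (\<lambda>\<gamma>. vnorm (e \<gamma>) * r ^ multi_degree \<gamma>)"
        unfolding null_family_def
      proof (intro allI impI)
        fix \<epsilon> :: real assume \<epsilon>: "0 < \<epsilon>"
        have "{\<gamma> \<in> ?M. \<epsilon> \<le> vnorm (e \<gamma>) * r ^ multi_degree \<gamma>} \<subseteq> (\<lambda>p. fst p + snd p) ` {p \<in> ?M \<times> ?M. \<epsilon> \<le> w p}"
        proof
          fix \<gamma> assume \<gamma>: "\<gamma> \<in> {\<gamma> \<in> ?M. \<epsilon> \<le> vnorm (e \<gamma>) * r ^ multi_degree \<gamma>}"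
          then have "e \<gamma> \<noteq> 0" using \<epsilon> by auto
          then have "fib \<gamma> \<noteq> {}" using fib_empty by blast
          then obtain p where "p \<in> fib \<gamma>" "vnorm (e \<gamma>) * r ^ multi_degree \<gamma> \<le> w p" using e_le by blast
          then show "\<gamma> \<in> (\<lambda>p. fst p + snd p) ` {p \<in> ?M \<times> ?M. \<epsilon> \<le> w p}"
            using \<gamma> by (intro image_eqI[of _ _ p]) (auto simp: fib_def)
        qed
        then show "finite {\<gamma> \<in> ?M. \<epsilon> \<le> vnorm (e \<gamma>) * r ^ multi_degree \<gamma>}"
          by (rule finite_subset) (use null_familyD[OF w_null \<epsilon>] in simp)
      qed
      fix x assume x: "x \<in> T"
      let ?m = "\<lambda>\<alpha>. \<iota> (monom_value \<alpha> (\<lambda>i. x i - c i))"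
      have xp: "x \<in> polydisc d c r" using x T by auto
      have bnd: "vnorm (a \<alpha> * ?m \<alpha>) \<le> vnorm (a \<alpha>) * r ^ multi_degree \<alpha>"
        "vnorm (b \<alpha> * ?m \<alpha>) \<le> vnorm (b \<alpha>) * r ^ multi_degree \<alpha>" if "\<alpha> \<in> ?M" for \<alpha>
        by (rule vnorm_term_le[OF xp that])+
      have prod: "((\<lambda>(\<alpha>, \<beta>). (a \<alpha> * ?m \<alpha>) * (b \<beta> * ?m \<beta>)) has_sum (u x * v x)) (?M \<times> ?M)"
      proof (rule has_sum_vnorm_Times[where C = C and D = D])
        show "((\<lambda>\<alpha>. a \<alpha> * ?m \<alpha>) has_sum u x) ?M" "((\<lambda>\<alpha>. b \<alpha> * ?m \<alpha>) has_sum v x) ?M"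
          using a(1) b(1) x by (auto simp: power_series_on_def)
        show "null_family ?M (\<lambda>\<alpha>. vnorm (a \<alpha> * ?m \<alpha>))"
          by (rule null_family_mono[OF power_series_on_null[OF a(1)] bnd(1)])
        show "null_family ?M (\<lambda>\<alpha>. vnorm (b \<alpha> * ?m \<alpha>))"
          by (rule null_family_mono[OF power_series_on_null[OF b(1)] bnd(2)])
        show "vnorm (a \<alpha> * ?m \<alpha>) \<le> C" "vnorm (b \<alpha> * ?m \<alpha>) \<le> D" if "\<alpha> \<in> ?M" for \<alpha>
          by (rule order_trans[OF bnd(1)[OF that] a(2)], rule order_trans[OF bnd(2)[OF that] b(2)])
      qed
      have null: "null_family (?M \<times> ?M) (\<lambda>p. vnorm (case p of (\<alpha>, \<beta>) \<Rightarrow> (a \<alpha> * ?m \<alpha>) * (b \<beta> * ?m \<beta>)))"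
      proof (rule null_family_mono[OF w_null])
        fix p assume "p \<in> ?M \<times> ?M"
        then show "vnorm (case p of (\<alpha>, \<beta>) \<Rightarrow> (a \<alpha> * ?m \<alpha>) * (b \<beta> * ?m \<beta>)) \<le> w p"
          using bnd(1)[of "fst p"] bnd(2)[of "snd p"] r
          by (simp add: w_def case_prod_unfold vnorm_mult[of "a _ * _"] mult_mono mem_Times_iff)
      qed
      have "((\<lambda>\<gamma>. \<Sum>p | p \<in> ?M \<times> ?M \<and> fst p + snd p = \<gamma>.
          case p of (\<alpha>, \<beta>) \<Rightarrow> (a \<alpha> * ?m \<alpha>) * (b \<beta> * ?m \<beta>)) has_sum (u x * v x)) ?M"
        by (rule has_sum_vnorm_fibres[OF prod null])
          (use fib_fin in \<open>auto simp: multi_indices_add_iff fib_def\<close>)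
      moreover have "(\<Sum>p | p \<in> ?M \<times> ?M \<and> fst p + snd p = \<gamma>.
          case p of (\<alpha>, \<beta>) \<Rightarrow> (a \<alpha> * ?m \<alpha>) * (b \<beta> * ?m \<beta>)) = e \<gamma> * ?m \<gamma>" for \<gamma>
        unfolding e_def sum_distrib_right fib_def
        by (rule sum.cong) (auto simp: monom_value_add emb_mult mult_ac)
      ultimately show "((\<lambda>\<gamma>. e \<gamma> * ?m \<gamma>) has_sum (u x * v x)) ?M"
        by (simp only:)
    qed
  qed
qed

end

subsection \<open>Ultrametric bounds on functions\<close>

text \<open>
  Abstracts the relation "the norm of \<open>u\<close> is at most \<open>C\<close>" for submultiplicative ultrametric
  norms. It is applied to Gauss norms and to the supremum norm.
\<close>

locale ultra_bound =
  fixes N :: "('s \<Rightarrow> 'a::nonarch_field) \<Rightarrow> real \<Rightarrow> bool"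
  assumes nonneg: "N u C \<Longrightarrow> 0 \<le> C"
    and const: "vnorm k \<le> C \<Longrightarrow> N (\<lambda>_. k) C"
    and add: "N u C \<Longrightarrow> N v C \<Longrightarrow> N (\<lambda>s. u s + v s) C"
    and mult: "N u C \<Longrightarrow> N v D \<Longrightarrow> N (\<lambda>s. u s * v s) (C * D)"
    and mono: "N u C \<Longrightarrow> C \<le> D \<Longrightarrow> N u D"
begin

lemma zero: "0 \<le> C \<Longrightarrow> N (\<lambda>_. 0) C"
  by (rule const) simp

lemma add_max: "N u C \<Longrightarrow> N v D \<Longrightarrow> N (\<lambda>s. u s + v s) (max C D)"
  by (rule add; erule mono) simp_all

lemma cmult: "N u C \<Longrightarrow> N (\<lambda>s. k * u s) (vnorm k * C)"
  by (rule mult[OF const]) simp_all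

lemma cmult_le: "N u C \<Longrightarrow> vnorm k \<le> 1 \<Longrightarrow> N (\<lambda>s. k * u s) C"
  using mult[OF const[of k 1], of u C] by simp

lemma uminus: "N u C \<Longrightarrow> N (\<lambda>s. - u s) C"
  using cmult_le[of u C "- 1"] by simp

lemma diff: "N u C \<Longrightarrow> N v C \<Longrightarrow> N (\<lambda>s. u s - v s) C"
  using add[OF _ uminus, of u C v] by simp

lemma mult_le: "N u C \<Longrightarrow> N v D \<Longrightarrow> C * D \<le> E \<Longrightarrow> N (\<lambda>s. u s * v s) E"
  by (rule mono[OF mult])

lemma sum: "0 \<le> C \<Longrightarrow> (\<And>i. i \<in> A \<Longrightarrow> N (f i) C) \<Longrightarrow> N (\<lambda>s. \<Sum>i\<in>A. f i s) C"
  by (induction A rule: infinite_finite_induct) (simp_all add: zero add)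

lemma power: "N u C \<Longrightarrow> N (\<lambda>s. u s ^ k) (C ^ k)"
  by (induction k) (simp_all add: const mult)

lemma diff_triangle: "N (\<lambda>s. u s - v s) C \<Longrightarrow> N (\<lambda>s. v s - w s) C \<Longrightarrow> N (\<lambda>s. u s - w s) C"
  using add[of "\<lambda>s. u s - v s" C "\<lambda>s. v s - w s"] by (simp add: algebra_simps)

lemma diff_commute: "N (\<lambda>s. u s - v s) C \<Longrightarrow> N (\<lambda>s. v s - u s) C"
  using uminus[of "\<lambda>s. u s - v s" C] by simp

end

lemma ultra_bound_sup: "ultra_bound (\<lambda>u C. \<forall>s. vnorm (u s) \<le> C)"
proof
  show "0 \<le> C" if "\<forall>s. vnorm (u s) \<le> C" for u :: "'a \<Rightarrow> 'b" and C
    using order_trans[OF vnorm_ge_0[of "u undefined"]] that by blast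
  show "\<forall>s. vnorm (u s * v s) \<le> C * D" if "\<forall>s. vnorm (u s) \<le> C" "\<forall>s. vnorm (v s) \<le> D" for u v :: "'a \<Rightarrow> 'b" and C D
  proof
    fix s
    have "0 \<le> C" using order_trans[OF vnorm_ge_0[of "u s"]] that by blast
    then show "vnorm (u s * v s) \<le> C * D"
      unfolding vnorm_mult using that by (intro mult_mono) auto
  qed
qed (auto intro: vnorm_add_le order_trans)

context isometric_embedding
begin

lemma ultra_bound_gauss: "0 < r \<Longrightarrow> T \<subseteq> polydisc d c r \<Longrightarrow> ultra_bound (gauss_bounded \<iota> d c r T)"
  by standard (simp_all add: gauss_bounded_nonneg gauss_bounded_const gauss_bounded_add
      gauss_bounded_mult gauss_bounded_mono)

end

subsection \<open>Completeness of the Gauss norm\<close>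

lemma has_sum_sum:
  fixes f :: "'k \<Rightarrow> 'i \<Rightarrow> 'a::topological_comm_monoid_add"
  assumes "\<And>k. k \<in> K \<Longrightarrow> (f k has_sum s k) A"
  shows "((\<lambda>i. \<Sum>k\<in>K. f k i) has_sum (\<Sum>k\<in>K. s k)) A"
  using assms by (induction K rule: infinite_finite_induct) (auto intro: has_sum_add)

lemma has_sum_diff:
  fixes f g :: "'i \<Rightarrow> 'a::topological_ab_group_add"
  assumes "(f has_sum s) A" "(g has_sum t) A"
  shows "((\<lambda>i. f i - g i) has_sum (s - t)) A"
  using has_sum_add[of f A s "\<lambda>i. - g i" "- t"] assms by (simp add: has_sum_uminus)

text \<open>For each \<alpha> the coefficients of the partial sums are Cauchy, and their limits
  define \<open>U\<close>. The conclusion bounds every remainder, so that later the distance to each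
  Newton iterate is known.\<close>

lemma gauss_bounded_complete:
  fixes u :: "nat \<Rightarrow> (nat \<Rightarrow> 'q::{nonarch_field, complete_space}) \<Rightarrow> 'q"
  assumes r: "0 < r" and T: "T \<subseteq> polydisc d c r"
    and u: "\<And>k. gauss_bounded (\<lambda>t. t) d c r T (u k) (B k)"
    and B: "decseq B" "B \<longlonglongrightarrow> 0"
  shows "\<exists>U. \<forall>m. gauss_bounded (\<lambda>t. t) d c r T (\<lambda>x. U x - (\<Sum>k<m. u k x)) (B m)"
proof -
  let ?M = "multi_indices d"
  obtain a where a: "\<And>k. power_series_on (\<lambda>t. t) d c r (a k) (u k) T"
    "\<And>k \<alpha>. vnorm (a k \<alpha>) * r ^ multi_degree \<alpha> \<le> B k"
    using u unfolding gauss_bounded_def by metis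
  have B0: "0 \<le> B k" for k using gauss_bounded_nonneg[OF u] .
  define S where "S m \<alpha> = (\<Sum>k<m. a k \<alpha>)" for m \<alpha>
  have S_diff: "vnorm (S n \<alpha> - S m \<alpha>) * r ^ multi_degree \<alpha> \<le> B m" if "m \<le> n" for m n \<alpha>
  proof -
    have "S n \<alpha> - S m \<alpha> = (\<Sum>k\<in>{m..<n}. a k \<alpha>)"
      unfolding S_def using that sum_diff_nat_ivl[of 0 m n "\<lambda>k. a k \<alpha>"] by (simp add: lessThan_atLeast0)
    also have "vnorm \<dots> \<le> B m / r ^ multi_degree \<alpha>"
    proof (rule vnorm_sum_le)
      fix k assume "k \<in> {m..<n}"
      then show "vnorm (a k \<alpha>) \<le> B m / r ^ multi_degree \<alpha>"
        using order_trans[OF a(2)[of k \<alpha>] decseqD[OF B(1), of m k]] r by (simp add: field_simps)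
    qed (use B0 r in simp)
    finally show ?thesis using r by (simp add: field_simps)
  qed
  have "\<exists>A. (\<lambda>n. S n \<alpha>) \<longlonglongrightarrow> A" for \<alpha>
  proof -
    have "Cauchy (\<lambda>n. S n \<alpha>)"
    proof (rule metric_CauchyI)
      fix e :: real assume "0 < e"
      then have "0 < e * r ^ multi_degree \<alpha>" using r by simp
      then obtain M where M: "B M < e * r ^ multi_degree \<alpha>"
        using order_tendstoD(2)[OF B(2)] by (meson eventually_sequentially order_refl)
      have 1: "vnorm (S n \<alpha> - S M \<alpha>) < e" if "M \<le> n" for n
        using le_less_trans[OF S_diff[OF that, of \<alpha>] M] r by simp
      have "dist (S m \<alpha>) (S n \<alpha>) < e" if "M \<le> m" "M \<le> n" for m n
        using vnorm_diff_le_less[OF 1[OF that(1)] 1[OF that(2)]] by (simp add: dist_vnorm)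
      then show "\<exists>M. \<forall>m\<ge>M. \<forall>n\<ge>M. dist (S m \<alpha>) (S n \<alpha>) < e" by blast
    qed
    then show ?thesis using Cauchy_convergent convergent_def by blast
  qed
  then obtain A where A: "\<And>\<alpha>. (\<lambda>n. S n \<alpha>) \<longlonglongrightarrow> A \<alpha>" by metis
  have D: "vnorm (A \<alpha> - S m \<alpha>) * r ^ multi_degree \<alpha> \<le> B m" for m \<alpha>
  proof -
    have "vnorm (A \<alpha> - S m \<alpha>) \<le> B m / r ^ multi_degree \<alpha>"
    proof (rule field_le_epsilon)
      fix e :: real assume e: "0 < e"
      obtain n0 where n0: "\<And>n. n0 \<le> n \<Longrightarrow> vnorm (S n \<alpha> - A \<alpha>) < e"
        using A[of \<alpha>] e unfolding lim_sequentially dist_vnorm by blast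
      define n where "n = max m n0"
      have 0: "0 \<le> B m / r ^ multi_degree \<alpha>" using B0 r by simp
      have "vnorm (A \<alpha> - S n \<alpha>) \<le> B m / r ^ multi_degree \<alpha> + e"
        using n0[of n] 0 unfolding vnorm_minus_commute[of "A \<alpha>"] n_def by linarith
      moreover have "vnorm (S n \<alpha> - S m \<alpha>) \<le> B m / r ^ multi_degree \<alpha>"
        using S_diff[of m n \<alpha>] r by (simp add: n_def pos_le_divide_eq)
      then have "vnorm (S n \<alpha> - S m \<alpha>) \<le> B m / r ^ multi_degree \<alpha> + e"
        using e by linarith
      ultimately show "vnorm (A \<alpha> - S m \<alpha>) \<le> B m / r ^ multi_degree \<alpha> + e"
        by (rule vnorm_diff_triangle)
    qed
    then show ?thesis using r by (simp add: field_simps)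
  qed
  \<comment> \<open>Decay of the limit coefficients: if \<open>B n < \<epsilon>\<close>, the tail
    from \<open>n\<close> on contributes less than \<epsilon>, so a coefficient of weighted norm at
    least \<epsilon> is already visible in one of the finitely many series \<open>a k\<close> with k
    < n.\<close>
  have null: "null_family ?M (\<lambda>\<alpha>. vnorm (A \<alpha> - S m \<alpha>) * r ^ multi_degree \<alpha>)" for m
    unfolding null_family_def
  proof (intro allI impI)
    fix \<epsilon> :: real assume \<epsilon>: "0 < \<epsilon>"
    obtain n0 where "\<And>n. n0 \<le> n \<Longrightarrow> B n < \<epsilon>"
      using order_tendstoD(2)[OF B(2) \<epsilon>] by (meson eventually_sequentially)
    then have n: "B (max m n0) < \<epsilon>" "m \<le> max m n0" by auto
    let ?n = "max m n0"
    have "{\<alpha>\<in>?M. \<epsilon> \<le> vnorm (A \<alpha> - S m \<alpha>) * r ^ multi_degree \<alpha>}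
        \<subseteq> (\<Union>k<?n. {\<alpha>\<in>?M. \<epsilon> \<le> vnorm (a k \<alpha>) * r ^ multi_degree \<alpha>})"
    proof (rule subsetI, rule ccontr)
      fix \<alpha> assume \<alpha>: "\<alpha> \<in> {\<alpha>\<in>?M. \<epsilon> \<le> vnorm (A \<alpha> - S m \<alpha>) * r ^ multi_degree \<alpha>}"
        and "\<alpha> \<notin> (\<Union>k<?n. {\<alpha>\<in>?M. \<epsilon> \<le> vnorm (a k \<alpha>) * r ^ multi_degree \<alpha>})"
      then have nk: "\<not> \<epsilon> \<le> vnorm (a k \<alpha>) * r ^ multi_degree \<alpha>" if "k < ?n" for k
        using that by auto
      have 1: "vnorm (a k \<alpha>) < \<epsilon> / r ^ multi_degree \<alpha>" if "k < ?n" for k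
        using nk[OF that] r by (simp add: pos_less_divide_eq)
      have pos: "0 < \<epsilon> / r ^ multi_degree \<alpha>" using \<epsilon> r by simp
      have "vnorm (S m \<alpha>) < \<epsilon> / r ^ multi_degree \<alpha>" "vnorm (S ?n \<alpha>) < \<epsilon> / r ^ multi_degree \<alpha>"
        unfolding S_def using 1 by (auto intro!: vnorm_sum_less[OF pos])
      then have "vnorm (S ?n \<alpha> - S m \<alpha>) < \<epsilon> / r ^ multi_degree \<alpha>"
        using vnorm_diff_le_less by blast
      moreover have "vnorm (A \<alpha> - S ?n \<alpha>) < \<epsilon> / r ^ multi_degree \<alpha>"
        using le_less_trans[OF D n(1)] r by (simp add: pos_less_divide_eq)
      ultimately have "vnorm (A \<alpha> - S m \<alpha>) < \<epsilon> / r ^ multi_degree \<alpha>"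
        using vnorm_add_less[of "A \<alpha> - S ?n \<alpha>" _ "S ?n \<alpha> - S m \<alpha>"] by simp
      then show False using \<alpha> r by (simp add: field_simps)
    qed
    then show "finite {\<alpha>\<in>?M. \<epsilon> \<le> vnorm (A \<alpha> - S m \<alpha>) * r ^ multi_degree \<alpha>}"
      by (rule finite_subset) (use null_familyD[OF power_series_on_null[OF a(1)] \<epsilon>] in blast)
  qed
  have off: "A \<alpha> = 0" "S m \<alpha> = 0" if "\<alpha> \<notin> ?M" for \<alpha> m
  proof -
    have S0: "S m \<alpha> = 0" for m using a(1) that by (simp add: S_def power_series_on_def)
    then show "S m \<alpha> = 0" .
    show "A \<alpha> = 0" using A[of \<alpha>] unfolding S0 by (simp add: LIMSEQ_const_iff)
  qed
  let ?m = "\<lambda>x \<alpha>. monom_value \<alpha> (\<lambda>i. x i - c i)"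
  have "\<exists>U. ((\<lambda>\<alpha>. A \<alpha> * ?m x \<alpha>) has_sum U) ?M" if "x \<in> T" for x
  proof (rule has_sum_vnorm_exists, rule null_family_mono)
    show "null_family ?M (\<lambda>\<alpha>. vnorm (A \<alpha>) * r ^ multi_degree \<alpha>)"
      using null[of 0] by (simp add: S_def)
    show "vnorm (A \<alpha> * ?m x \<alpha>) \<le> vnorm (A \<alpha>) * r ^ multi_degree \<alpha>" if "\<alpha> \<in> ?M" for \<alpha>
      using id_emb.vnorm_term_le[OF _ that] \<open>x \<in> T\<close> T by blast
  qed
  then obtain U where U: "\<And>x. x \<in> T \<Longrightarrow> ((\<lambda>\<alpha>. A \<alpha> * ?m x \<alpha>) has_sum U x) ?M" by metis
  have "gauss_bounded (\<lambda>t. t) d c r T (\<lambda>x. U x - (\<Sum>k<m. u k x)) (B m)" for m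
  proof (rule gauss_boundedI[OF power_series_onI])
    show "A \<alpha> - S m \<alpha> = 0" if "\<alpha> \<notin> ?M" for \<alpha> using off[OF that] by simp
    show "((\<lambda>\<alpha>. (A \<alpha> - S m \<alpha>) * ?m x \<alpha>) has_sum (U x - (\<Sum>k<m. u k x))) ?M" if x: "x \<in> T" for x
    proof -
      have "((\<lambda>\<alpha>. S m \<alpha> * ?m x \<alpha>) has_sum (\<Sum>k<m. u k x)) ?M"
        unfolding S_def sum_distrib_right
        by (rule has_sum_sum) (use a(1) x in \<open>auto simp: power_series_on_def\<close>)
      then show ?thesis
        unfolding left_diff_distrib using U[OF x] by (intro has_sum_diff)
    qed
  qed (use null D in auto)
  then show ?thesis by blast
qed

subsection \<open>Uniqueness of power series expansions\<close>

text \<open>A lexicographically least element, with the last coordinate compared first; the weights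
  grow fast enough to reproduce this order in comparisons with the minimum. That they are at least 2
  leaves the spare factor exploited in \<open>power_series_zero\<close>.\<close>

lemma unique_minimal_weight:
  fixes S :: "(nat \<Rightarrow> nat) set"
  assumes "S \<noteq> {}"
  shows "\<exists>w. \<exists>\<alpha>0\<in>S. (\<forall>i. 2 \<le> w i) \<and>
    (\<forall>\<alpha>\<in>S. (\<forall>i<d. \<alpha> i = \<alpha>0 i) \<or> (\<Sum>i<d. w i * \<alpha>0 i) < (\<Sum>i<d. w i * \<alpha> i))"
  using assms
proof (induction d arbitrary: S)
  case 0
  then show ?case by (intro exI[of _ "\<lambda>_. 2"]) auto
next
  case (Suc d)
  define m where "m = (LEAST k. k \<in> (\<lambda>\<alpha>. \<alpha> d) ` S)"
  have m: "m \<in> (\<lambda>\<alpha>. \<alpha> d) ` S" unfolding m_def by (rule LeastI_ex) (use Suc.prems in auto)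
  have m_le: "m \<le> \<alpha> d" if "\<alpha> \<in> S" for \<alpha>
    unfolding m_def by (rule Least_le) (use that in auto)
  define S' where "S' = {\<alpha>\<in>S. \<alpha> d = m}"
  have "S' \<noteq> {}" using m by (auto simp: S'_def)
  from Suc.IH[OF this] obtain w \<alpha>0 where w: "\<alpha>0 \<in> S'" "\<forall>i. 2 \<le> w i"
    "\<And>\<alpha>. \<alpha> \<in> S' \<Longrightarrow> (\<forall>i<d. \<alpha> i = \<alpha>0 i) \<or> (\<Sum>i<d. w i * \<alpha>0 i) < (\<Sum>i<d. w i * \<alpha> i)"
    by blast
  \<comment> \<open>One extra unit in coordinate \<open>d\<close> now outweighs everything that the
    earlier coordinates of the minimum contribute. The summand 2 makes this strict and keeps the
    lower bound on weights.\<close>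
  define W where "W = 2 + (\<Sum>i<d. w i * \<alpha>0 i)"
  define w' where "w' = w(d := W)"
  have w'_sum: "(\<Sum>i<Suc d. w' i * \<alpha> i) = (\<Sum>i<d. w i * \<alpha> i) + W * \<alpha> d" for \<alpha>
    by (simp add: w'_def)
  have "(\<forall>i<Suc d. \<alpha> i = \<alpha>0 i) \<or> (\<Sum>i<Suc d. w' i * \<alpha>0 i) < (\<Sum>i<Suc d. w' i * \<alpha> i)" if \<alpha>: "\<alpha> \<in> S" for \<alpha>
  proof (cases "\<alpha> d = m")
    case True
    then have "\<alpha> \<in> S'" using \<alpha> by (simp add: S'_def)
    then show ?thesis
      unfolding w'_sum using w(3)[of \<alpha>] w(1) True by (auto simp: S'_def less_Suc_eq)
  next
    case False
    then have "Suc m \<le> \<alpha> d" using m_le[OF \<alpha>] by simp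
    then have "W * Suc m \<le> W * \<alpha> d" by (rule mult_le_mono2)
    moreover have "(\<Sum>i<d. w i * \<alpha>0 i) < W" by (simp add: W_def)
    ultimately have "(\<Sum>i<d. w i * \<alpha>0 i) + W * m < (\<Sum>i<d. w i * \<alpha> i) + W * \<alpha> d" by simp
    then show ?thesis
      unfolding w'_sum using w(1) by (simp add: S'_def)
  qed
  moreover have "\<forall>i. 2 \<le> w' i" using w(2) by (simp add: w'_def W_def)
  ultimately show ?case using w(1) unfolding S'_def by blast
qed

definition nontrivially_valued :: "'a::nonarch_field itself \<Rightarrow> bool" where
  "nontrivially_valued _ \<longleftrightarrow> (\<exists>t::'a. 0 < vnorm t \<and> vnorm t < 1)"

context isometric_embedding
begin

text \<open>
  Substituting \<open>z\<^bsup>w i\<^esup>\<close> for the \<open>i\<close>-th variable makes the term of least weight dominate for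
  small \<open>z\<close>.
\<close>

lemma power_series_zero:
  assumes nt: "nontrivially_valued TYPE('q)" and r: "0 < r" and c: "c \<in> affine_points d"
    and a: "power_series_on \<iota> d c r a (\<lambda>_. 0) (polydisc d c r)"
  shows "a \<alpha> = 0"
proof (rule ccontr)
  let ?M = "multi_indices d"
  assume "a \<alpha> \<noteq> 0"
  then have "Poly_Mapping.lookup ` {\<alpha>. a \<alpha> \<noteq> 0} \<noteq> {}" by auto
  from unique_minimal_weight[OF this, of d] obtain w \<beta> where w: "\<forall>i. 2 \<le> w i" and \<beta>: "a \<beta> \<noteq> 0"
    and min: "\<And>\<alpha>. a \<alpha> \<noteq> 0 \<Longrightarrow> (\<forall>i<d. Poly_Mapping.lookup \<alpha> i = Poly_Mapping.lookup \<beta> i) \<or>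
      (\<Sum>i<d. w i * Poly_Mapping.lookup \<beta> i) < (\<Sum>i<d. w i * Poly_Mapping.lookup \<alpha> i)"
    by auto
  have supp: "\<alpha> \<in> ?M" if "a \<alpha> \<noteq> 0" for \<alpha> using a that by (auto simp: power_series_on_def)
  define e where "e \<alpha> = (\<Sum>i<d. w i * Poly_Mapping.lookup \<alpha> i)" for \<alpha> :: "nat \<Rightarrow>\<^sub>0 nat"
  have e_less: "e \<beta> < e \<alpha>" if "a \<alpha> \<noteq> 0" "\<alpha> \<noteq> \<beta>" for \<alpha>
  proof -
    have "\<not> (\<forall>i<d. Poly_Mapping.lookup \<alpha> i = Poly_Mapping.lookup \<beta> i)"
    proof
      assume eq: "\<forall>i<d. Poly_Mapping.lookup \<alpha> i = Poly_Mapping.lookup \<beta> i"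
      have "Poly_Mapping.lookup \<alpha> i = Poly_Mapping.lookup \<beta> i" for i
        using eq lookup_notin_multi_indices[OF supp[OF that(1)], of i]
          lookup_notin_multi_indices[OF supp[OF \<beta>], of i] by (cases "i < d") auto
      then show False using that(2) poly_mapping_eqI by blast
    qed
    then show ?thesis using min[OF that(1)] unfolding e_def by blast
  qed
  have e_ge: "2 * multi_degree \<alpha> \<le> e \<alpha>" if "\<alpha> \<in> ?M" for \<alpha>
    unfolding e_def multi_degree_eq[OF that] sum_distrib_left using w by (intro sum_mono mult_le_mono1) auto
  define \<rho> where "\<rho> = min r 1"
  have \<rho>: "0 < \<rho>" "\<rho> \<le> r" "\<rho> \<le> 1" using r by (auto simp: \<rho>_def)
  define \<epsilon> where "\<epsilon> = vnorm (a \<beta>) / 2"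
  have \<epsilon>: "0 < \<epsilon>" using \<beta> by (simp add: \<epsilon>_def less_le)
  \<comment> \<open>Outside \<open>Z\<close> the coefficient is small for the radius \<rho> and the
    degree exceeds \<open>e \<beta>\<close>. As the weights are at least 2,
    \<open>e \<alpha>\<close> is then at least \<open>multi_degree \<alpha> + e \<beta>\<close>,
    which bounds the term by \<epsilon> times \<open>vnorm z ^ e \<beta>\<close>. The finitely many
    indices in \<open>Z\<close> are left to the choice of \<open>z\<close>.\<close>
  define Z where "Z = {\<alpha>\<in>?M. \<epsilon> \<le> vnorm (a \<alpha>) * \<rho> ^ multi_degree \<alpha>} \<union> {\<alpha>\<in>?M. multi_degree \<alpha> \<le> e \<beta>}"
  have "finite Z"
    unfolding Z_def
    using null_familyD[OF power_series_on_null[OF power_series_on_shrink[OF a, of \<rho>]] \<epsilon>] \<rho>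
    by (simp add: finite_multi_indices_degree)
  then have "\<exists>K. \<forall>\<alpha>\<in>Z. vnorm (a \<alpha>) \<le> K"
    using bdd_above_finite[of "(\<lambda>\<alpha>. vnorm (a \<alpha>)) ` Z"] by (auto simp: bdd_above_def)
  then obtain K where "\<forall>\<alpha>\<in>Z. vnorm (a \<alpha>) \<le> K" ..
  then have K: "\<And>\<alpha>. \<alpha> \<in> Z \<Longrightarrow> vnorm (a \<alpha>) \<le> max K 1" and "0 < max K 1" by (auto simp: max.coboundedI1)
  obtain t :: 'q where t: "0 < vnorm t" "vnorm t < 1" using nt by (auto simp: nontrivially_valued_def)
  \<comment> \<open>The first entry places the point in the polydisc. The second absorbs the
    coefficients on \<open>Z\<close>, because a strictly larger weight supplies at least one more
    factor \<open>z\<close>.\<close>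
  have "0 < min \<rho> (\<epsilon> / max K 1)" using \<rho> \<epsilon> by simp
  then obtain k where k: "vnorm t ^ k < min \<rho> (\<epsilon> / max K 1)" using real_arch_pow_inv t(2) by blast
  define z where "z = t ^ k"
  have z: "0 < vnorm z" "vnorm z \<le> \<rho>" "vnorm z * max K 1 \<le> \<epsilon>"
    using t(1) k \<open>0 < max K 1\<close> by (auto simp: z_def vnorm_power field_simps)
  have z1: "vnorm z \<le> 1" using z \<rho> by simp
  define x where "x i = (if i < d then c i + z ^ w i else 0)" for i
  have "vnorm (z ^ w i) \<le> r" for i
  proof -
    have "1 \<le> w i" using w[rule_format, of i] by simp
    then have "vnorm z ^ w i \<le> vnorm z ^ 1" using z1 z(1) by (intro power_decreasing) auto
    then show ?thesis using z \<rho> by (simp add: vnorm_power)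
  qed
  then have x: "x \<in> polydisc d c r" by (auto simp: polydisc_def x_def affine_points_def)
  have monom: "monom_value \<alpha> (\<lambda>i. x i - c i) = z ^ e \<alpha>" if "\<alpha> \<in> ?M" for \<alpha>
  proof -
    have "monom_value \<alpha> (\<lambda>i. x i - c i) = (\<Prod>i<d. (x i - c i) ^ Poly_Mapping.lookup \<alpha> i)"
      by (rule monom_value_superset) (use that in \<open>auto simp: multi_indices_def\<close>)
    then show ?thesis by (simp add: x_def e_def power_sum power_mult)
  qed
  define f where "f \<alpha> = a \<alpha> * \<iota> (monom_value \<alpha> (\<lambda>i. x i - c i))" for \<alpha>
  have f_norm: "vnorm (f \<alpha>) = vnorm (a \<alpha>) * vnorm z ^ e \<alpha>" if "\<alpha> \<in> ?M" for \<alpha>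
    by (simp add: f_def vnorm_mult vnorm_emb monom[OF that] vnorm_power)
  have "(f has_sum 0) ?M"
    using a x unfolding f_def power_series_on_def by blast
  moreover have "((\<lambda>\<alpha>. if \<alpha> = \<beta> then f \<beta> else 0) has_sum f \<beta>) ?M"
    by (rule has_sum_single_support[of \<beta>]) (use supp[OF \<beta>] in auto)
  ultimately have "((\<lambda>\<alpha>. f \<alpha> - (if \<alpha> = \<beta> then f \<beta> else 0)) has_sum (0 - f \<beta>)) ?M"
    by (rule has_sum_diff)
  then have "vnorm (0 - f \<beta>) \<le> \<epsilon> * vnorm z ^ e \<beta>"
  proof (rule has_sum_vnorm_le)
    fix \<alpha> assume \<alpha>: "\<alpha> \<in> ?M"
    have "vnorm (f \<alpha>) \<le> \<epsilon> * vnorm z ^ e \<beta>" if "\<alpha> \<noteq> \<beta>" "a \<alpha> \<noteq> 0"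
    proof (cases "\<alpha> \<in> Z")
      case True
      have "vnorm z ^ e \<alpha> \<le> vnorm z ^ Suc (e \<beta>)"
        using e_less[OF that(2,1)] z1 z(1) by (intro power_decreasing) auto
      then have "vnorm (f \<alpha>) \<le> max K 1 * (vnorm z * vnorm z ^ e \<beta>)"
        unfolding f_norm[OF \<alpha>] using K[OF True] z(1) by (intro mult_mono) auto
      also have "\<dots> = (vnorm z * max K 1) * vnorm z ^ e \<beta>" by (simp only: mult_ac)
      also have "\<dots> \<le> \<epsilon> * vnorm z ^ e \<beta>" using z by (intro mult_right_mono) auto
      finally show ?thesis .
    next
      case False
      have "e \<beta> + multi_degree \<alpha> \<le> e \<alpha>" using False \<alpha> e_ge[OF \<alpha>] by (auto simp: Z_def)
      then have "vnorm z ^ e \<alpha> \<le> vnorm z ^ (multi_degree \<alpha> + e \<beta>)"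
        using z1 z(1) by (intro power_decreasing) auto
      also have "\<dots> \<le> \<rho> ^ multi_degree \<alpha> * vnorm z ^ e \<beta>"
        unfolding power_add using z by (intro mult_right_mono power_mono) auto
      finally have "vnorm (f \<alpha>) \<le> vnorm (a \<alpha>) * (\<rho> ^ multi_degree \<alpha> * vnorm z ^ e \<beta>)"
        unfolding f_norm[OF \<alpha>] by (intro mult_left_mono) auto
      also have "\<dots> \<le> \<epsilon> * vnorm z ^ e \<beta>"
        unfolding mult.assoc[symmetric] using False \<alpha> by (intro mult_right_mono) (auto simp: Z_def)
      finally show ?thesis .
    qed
    moreover have "0 \<le> \<epsilon> * vnorm z ^ e \<beta>" using \<epsilon> by simp
    ultimately show "vnorm (f \<alpha> - (if \<alpha> = \<beta> then f \<beta> else 0)) \<le> \<epsilon> * vnorm z ^ e \<beta>"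
      by (cases "\<alpha> = \<beta>"; cases "a \<alpha> = 0") (auto simp: f_def)
  qed (use \<epsilon> in simp)
  then have "vnorm (a \<beta>) * vnorm z ^ e \<beta> \<le> \<epsilon> * vnorm z ^ e \<beta>"
    by (simp add: f_norm[OF supp[OF \<beta>]])
  moreover have "0 < vnorm z ^ e \<beta>" using z(1) by simp
  ultimately have "vnorm (a \<beta>) \<le> \<epsilon>" by (rule mult_right_le_imp_le)
  then show False using \<epsilon> by (simp add: \<epsilon>_def)
qed

lemma power_series_unique:
  assumes "nontrivially_valued TYPE('q)" "0 < r" "c \<in> affine_points d"
    and a: "power_series_on \<iota> d c r a f (polydisc d c r)"
    and b: "power_series_on \<iota> d c r b f (polydisc d c r)"
  shows "a = b"
proof -
  have "power_series_on \<iota> d c r (\<lambda>\<alpha>. a \<alpha> - b \<alpha>) (\<lambda>_. 0) (polydisc d c r)"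
  proof (rule power_series_onI)
    show "null_family (multi_indices d) (\<lambda>\<alpha>. vnorm (a \<alpha> - b \<alpha>) * r ^ multi_degree \<alpha>)"
    proof (rule null_family_mono[OF null_family_max[OF power_series_on_null[OF a] power_series_on_null[OF b]]])
      show "vnorm (a \<alpha> - b \<alpha>) * r ^ multi_degree \<alpha>
          \<le> max (vnorm (a \<alpha>) * r ^ multi_degree \<alpha>) (vnorm (b \<alpha>) * r ^ multi_degree \<alpha>)" for \<alpha>
        using mult_right_mono[OF vnorm_diff_le_max[of "a \<alpha>" "b \<alpha>"], of "r ^ multi_degree \<alpha>"] assms(2)
        by (simp add: max_mult_distrib_right)
    qed
    show "((\<lambda>\<alpha>. (a \<alpha> - b \<alpha>) * \<iota> (monom_value \<alpha> (\<lambda>i. x i - c i))) has_sum 0) (multi_indices d)"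
      if "x \<in> polydisc d c r" for x
    proof -
      let ?m = "\<lambda>\<alpha>. \<iota> (monom_value \<alpha> (\<lambda>i. x i - c i))"
      have "((\<lambda>\<alpha>. a \<alpha> * ?m \<alpha>) has_sum f x) (multi_indices d)"
        "((\<lambda>\<alpha>. b \<alpha> * ?m \<alpha>) has_sum f x) (multi_indices d)"
        using a b that unfolding power_series_on_def by blast+
      from has_sum_diff[OF this] show ?thesis by (simp add: left_diff_distrib)
    qed
  qed (use a b in \<open>auto simp: power_series_on_def\<close>)
  from power_series_zero[OF assms(1-3) this] show ?thesis by (auto simp: fun_eq_iff)
qed

text \<open>\<open>chart_norm\<close> is a supremum over coefficients selected by
  \<open>THE\<close>. Uniqueness identifies them with those of the expansion at hand, and the bound
  makes it a genuine supremum, which the index 0 shows to be nonnegative.\<close>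

lemma chart_norm_bounds:
  assumes nt: "nontrivially_valued TYPE('q)" and D: "is_ball_chart n M D"
    and f: "gauss_bounded \<iota> (chart_dim D) (chart_centre D) (chart_radius D)
      (polydisc (chart_dim D) (chart_centre D) (chart_radius D))
      (f \<circ> inv_into (chart_dom D) (chart_map D)) C"
  shows "0 \<le> chart_norm \<iota> D f" "chart_norm \<iota> D f \<le> C"
proof -
  have D: "0 < chart_radius D" "chart_centre D \<in> affine_points (chart_dim D)"
    using D by (auto simp: is_ball_chart_def)
  obtain a where a: "chart_expansion \<iota> D f a" "\<And>\<alpha>. vnorm (a \<alpha>) * chart_radius D ^ multi_degree \<alpha> \<le> C"
    using f by (auto simp: gauss_bounded_def chart_expansion_def)
  have "(THE a. chart_expansion \<iota> D f a) = a"
    using a(1) power_series_unique[OF nt D] by (intro the_equality) (auto simp: chart_expansion_def)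
  then have norm: "chart_norm \<iota> D f = (SUP \<alpha>\<in>multi_indices (chart_dim D). vnorm (a \<alpha>) * chart_radius D ^ multi_degree \<alpha>)"
    by (simp add: chart_norm_def)
  show "chart_norm \<iota> D f \<le> C"
    unfolding norm by (rule cSUP_least) (use a(2) zero_in_multi_indices in blast)+
  have "bdd_above ((\<lambda>\<alpha>. vnorm (a \<alpha>) * chart_radius D ^ multi_degree \<alpha>) ` multi_indices (chart_dim D))"
    using a(2) by (auto simp: bdd_above_def)
  then show "0 \<le> chart_norm \<iota> D f"
    unfolding norm by (rule cSUP_upper2[of _ _ 0]) simp_all
qed

end

section \<open>Polynomial functions\<close>

lemma mpoly_value_superset:
  "finite A \<Longrightarrow> Poly_Mapping.keys f \<subseteq> A \<Longrightarrow>
    mpoly_value f x = (\<Sum>\<alpha>\<in>A. Poly_Mapping.lookup f \<alpha> * monom_value \<alpha> x)"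
  unfolding mpoly_value_def by (rule sum.mono_neutral_left) (auto simp: in_keys_iff)

lemma mpoly_value_zero [simp]: "mpoly_value 0 x = 0"
  by (simp add: mpoly_value_def)

lemma mpoly_value_single [simp]: "mpoly_value (Poly_Mapping.single \<alpha> k) x = k * monom_value \<alpha> x"
  by (simp add: mpoly_value_def)

lemma mpoly_value_one [simp]: "mpoly_value 1 x = 1"
  using mpoly_value_single[of 0 1 x] by simp

lemma mpoly_value_add: "mpoly_value (f + g) x = mpoly_value f x + mpoly_value g x"
proof -
  let ?A = "Poly_Mapping.keys f \<union> Poly_Mapping.keys g"
  have "mpoly_value (f + g) x = (\<Sum>\<alpha>\<in>?A. Poly_Mapping.lookup (f + g) \<alpha> * monom_value \<alpha> x)"
    by (rule mpoly_value_superset) (use keys_add[of f g] in auto)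
  then show ?thesis
    by (simp add: lookup_add distrib_right sum.distrib mpoly_value_superset[of ?A])
qed

lemma mpoly_value_sum: "mpoly_value (sum f A) x = (\<Sum>i\<in>A. mpoly_value (f i) x)"
  by (induction A rule: infinite_finite_induct) (auto simp: mpoly_value_add)

lemma poly_mapping_sum_single: "(\<Sum>\<alpha>\<in>Poly_Mapping.keys f. Poly_Mapping.single \<alpha> (Poly_Mapping.lookup f \<alpha>)) = f"
proof (rule poly_mapping_eqI)
  fix k
  have "(\<Sum>\<alpha>\<in>Poly_Mapping.keys f. Poly_Mapping.lookup (Poly_Mapping.single \<alpha> (Poly_Mapping.lookup f \<alpha>)) k)
      = (\<Sum>\<alpha>\<in>Poly_Mapping.keys f. if \<alpha> = k then Poly_Mapping.lookup f \<alpha> else 0)"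
    by (rule sum.cong) (auto simp: lookup_single when_def)
  also have "\<dots> = Poly_Mapping.lookup f k"
    by (simp add: in_keys_iff)
  finally show "Poly_Mapping.lookup (\<Sum>\<alpha>\<in>Poly_Mapping.keys f. Poly_Mapping.single \<alpha> (Poly_Mapping.lookup f \<alpha>)) k
      = Poly_Mapping.lookup f k"
    by (simp add: lookup_sum)
qed

lemma mpoly_value_mult: "mpoly_value (f * g) x = mpoly_value f x * mpoly_value g x"
proof -
  let ?s = "\<lambda>f \<alpha>. Poly_Mapping.single \<alpha> (Poly_Mapping.lookup f \<alpha>)"
  have "f * g = (\<Sum>\<alpha>\<in>Poly_Mapping.keys f. ?s f \<alpha>) * (\<Sum>\<beta>\<in>Poly_Mapping.keys g. ?s g \<beta>)"
    by (simp only: poly_mapping_sum_single)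
  also have "\<dots> = (\<Sum>\<alpha>\<in>Poly_Mapping.keys f. \<Sum>\<beta>\<in>Poly_Mapping.keys g.
      Poly_Mapping.single (\<alpha> + \<beta>) (Poly_Mapping.lookup f \<alpha> * Poly_Mapping.lookup g \<beta>))"
    by (simp add: sum_product mult_single)
  also have "mpoly_value \<dots> x = (\<Sum>\<alpha>\<in>Poly_Mapping.keys f. \<Sum>\<beta>\<in>Poly_Mapping.keys g.
      (Poly_Mapping.lookup f \<alpha> * monom_value \<alpha> x) * (Poly_Mapping.lookup g \<beta> * monom_value \<beta> x))"
    by (simp add: mpoly_value_sum monom_value_add mult_ac)
  also have "\<dots> = mpoly_value f x * mpoly_value g x"
    by (simp add: mpoly_value_def sum_product)
  finally show ?thesis .
qed

lemma mpoly_value_power: "mpoly_value (f ^ k) x = mpoly_value f x ^ k"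
  by (induction k) (simp_all add: mpoly_value_mult)

lemma mpoly_value_uminus: "mpoly_value (- f) x = - mpoly_value f x"
  using mpoly_value_add[of f "- f" x] by (simp add: eq_neg_iff_add_eq_0 add.commute)

lemma poly_ring_simps:
  "f \<in> carrier (poly_ring n) \<longleftrightarrow> Poly_Mapping.keys f \<subseteq> multi_indices n"
  "f \<otimes>\<^bsub>poly_ring n\<^esub> g = f * g" "f \<oplus>\<^bsub>poly_ring n\<^esub> g = f + g"
  "\<one>\<^bsub>poly_ring n\<^esub> = 1" "\<zero>\<^bsub>poly_ring n\<^esub> = 0"
  by (simp_all add: poly_ring_def)

lemma poly_ring_mult_closed:
  "f \<in> carrier (poly_ring n) \<Longrightarrow> g \<in> carrier (poly_ring n) \<Longrightarrow> f * g \<in> carrier (poly_ring n)"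
  using cring.cring_simprules(5)[OF cring_poly_ring] by (simp add: poly_ring_simps(2))

text \<open>Makes a rational point a point of the scheme, where the smoothness condition can be
  evaluated. The ideal is the pullback of the zero ideal of a domain under evaluation.\<close>

lemma primeideal_point_ideal:
  fixes x :: "nat \<Rightarrow> 'a::idom"
  shows "primeideal (point_ideal n x) (poly_ring n)"
proof (rule primeidealI)
  interpret cring "poly_ring n :: 'a mpoly ring" by (rule cring_poly_ring)
  show "cring (poly_ring n :: 'a mpoly ring)" by (rule cring_poly_ring)
  show "ideal (point_ideal n x) (poly_ring n)"
  proof (rule idealI)
    show "subgroup (point_ideal n x) (add_monoid (poly_ring n))"
    proof (rule add.subgroupI)
      show "\<ominus>\<^bsub>poly_ring n\<^esub> f \<in> point_ideal n x" if "f \<in> point_ideal n x" for f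
      proof -
        have f: "f \<in> carrier (poly_ring n)" "mpoly_value f x = 0" using that by (auto simp: point_ideal_def)
        have "f + (\<ominus>\<^bsub>poly_ring n\<^esub> f) = 0" using r_neg[OF f(1)] by (simp add: poly_ring_simps)
        then have "\<ominus>\<^bsub>poly_ring n\<^esub> f = - f" by (simp add: eq_neg_iff_add_eq_0 add.commute)
        then show ?thesis
          using a_inv_closed[OF f(1)] f(2)
          by (simp add: point_ideal_def mpoly_value_uminus)
      qed
      show "f \<oplus>\<^bsub>poly_ring n\<^esub> g \<in> point_ideal n x" if "f \<in> point_ideal n x" "g \<in> point_ideal n x" for f g
        using that add.m_closed[of f g] by (auto simp: point_ideal_def poly_ring_simps(3) mpoly_value_add)
    qed (use zero_closed in \<open>auto simp: point_ideal_def poly_ring_simps(5)\<close>)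
  qed (use m_closed ring_axioms in \<open>auto simp: point_ideal_def poly_ring_simps(2) mpoly_value_mult\<close>)
  show "carrier (poly_ring n) \<noteq> point_ideal n x"
  proof
    assume eq: "carrier (poly_ring n) = point_ideal n x"
    show False using one_closed unfolding eq by (simp add: point_ideal_def poly_ring_simps(4))
  qed
  show "f \<in> point_ideal n x \<or> g \<in> point_ideal n x"
    if "f \<in> carrier (poly_ring n)" "g \<in> carrier (poly_ring n)" "f \<otimes>\<^bsub>poly_ring n\<^esub> g \<in> point_ideal n x" for f g
    using that by (auto simp: point_ideal_def poly_ring_simps(2) mpoly_value_mult)
qed

lemma mpoly_value_genideal:
  fixes x :: "nat \<Rightarrow> 'a::idom"
  assumes "h \<in> genideal (poly_ring n) S" "S \<subseteq> carrier (poly_ring n)" "\<And>f. f \<in> S \<Longrightarrow> mpoly_value f x = 0"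
  shows "mpoly_value h x = 0"
proof -
  have "ideal (point_ideal n x) (poly_ring n)" "S \<subseteq> point_ideal n x"
    by (rule primeideal.axioms(1)[OF primeideal_point_ideal]) (use assms in \<open>auto simp: point_ideal_def\<close>)
  then show ?thesis using assms(1) unfolding genideal_def point_ideal_def by blast
qed

subsection \<open>Strict differentiability\<close>

text \<open>
  Uniformity in the bound \<open>N\<close> allows the increments to be points as well as power series.
\<close>

definition bounded_increments ::
    "nat \<Rightarrow> (((nat \<Rightarrow> 'q) \<Rightarrow> 'q::nonarch_field) \<Rightarrow> real \<Rightarrow> bool) \<Rightarrow> real \<Rightarrow> real \<Rightarrow>
      ((nat \<Rightarrow> 'q) \<Rightarrow> nat \<Rightarrow> 'q) \<Rightarrow> ((nat \<Rightarrow> 'q) \<Rightarrow> nat \<Rightarrow> 'q) \<Rightarrow> bool" where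
  "bounded_increments n N \<rho> \<delta> h h' \<longleftrightarrow> ultra_bound N \<and> 0 \<le> \<rho> \<and> \<rho> \<le> 1 \<and> 0 \<le> \<delta> \<and>
     (\<forall>i<n. N (\<lambda>s. h s i) \<rho> \<and> N (\<lambda>s. h' s i) \<rho> \<and> N (\<lambda>s. h s i - h' s i) \<delta>)"

text \<open>A Lipschitz bound and a strict derivative with remainder of order \<rho>\<delta>; the
  factor \<rho> makes Newton's map contract once \<open>C * \<rho>\<close> is at most 1/2. One
  constant has to serve all \<open>N\<close>, because uniqueness of solutions uses points and
  existence uses power series.\<close>

definition taylor_constant ::
    "nat \<Rightarrow> (nat \<Rightarrow> 'q::nonarch_field) \<Rightarrow> ((nat \<Rightarrow> 'q) \<Rightarrow> 'q) \<Rightarrow> (nat \<Rightarrow> 'q) \<Rightarrow> real \<Rightarrow> bool" where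
  "taylor_constant n x F D C \<longleftrightarrow> 0 \<le> C \<and>
     (\<forall>N \<rho> \<delta> h h'. bounded_increments n N \<rho> \<delta> h h' \<longrightarrow>
        N (\<lambda>s. F (\<lambda>i. x i + h s i) - F (\<lambda>i. x i + h' s i)) (C * \<delta>) \<and>
        N (\<lambda>s. F (\<lambda>i. x i + h s i) - F (\<lambda>i. x i + h' s i) - (\<Sum>j<n. D j * (h s j - h' s j))) (C * \<rho> * \<delta>))"

definition strictly_diff ::
    "nat \<Rightarrow> (nat \<Rightarrow> 'q::nonarch_field) \<Rightarrow> ((nat \<Rightarrow> 'q) \<Rightarrow> 'q) \<Rightarrow> (nat \<Rightarrow> 'q) \<Rightarrow> bool" where
  "strictly_diff n x F D \<longleftrightarrow> (\<exists>C. taylor_constant n x F D C)"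

lemma taylor_constantD:
  assumes "taylor_constant n x F D C" "bounded_increments n N \<rho> \<delta> h h'"
  shows "N (\<lambda>s. F (\<lambda>i. x i + h s i) - F (\<lambda>i. x i + h' s i)) (C * \<delta>)"
    "N (\<lambda>s. F (\<lambda>i. x i + h s i) - F (\<lambda>i. x i + h' s i) - (\<Sum>j<n. D j * (h s j - h' s j))) (C * \<rho> * \<delta>)"
  using assms unfolding taylor_constant_def by blast+

lemma strictly_diffI:
  assumes "0 \<le> C"
    and "\<And>N \<rho> \<delta> h h'. bounded_increments n N \<rho> \<delta> h h' \<Longrightarrow>
      N (\<lambda>s. F (\<lambda>i. x i + h s i) - F (\<lambda>i. x i + h' s i)) (C * \<delta>)"
    and "\<And>N \<rho> \<delta> h h'. bounded_increments n N \<rho> \<delta> h h' \<Longrightarrow>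
      N (\<lambda>s. F (\<lambda>i. x i + h s i) - F (\<lambda>i. x i + h' s i) - (\<Sum>j<n. D j * (h s j - h' s j))) (C * \<rho> * \<delta>)"
  shows "strictly_diff n x F D"
  unfolding strictly_diff_def taylor_constant_def using assms by blast

lemma strictly_diff_const: "strictly_diff n x (\<lambda>_. k) (\<lambda>_. 0)"
  by (rule strictly_diffI[of 0]) (auto simp: bounded_increments_def intro: ultra_bound.zero)

lemma strictly_diff_coord: "i < n \<Longrightarrow> strictly_diff n x (\<lambda>y. y i) (\<lambda>j. if j = i then 1 else 0)"
  by (rule strictly_diffI[of 1])
    (auto simp: bounded_increments_def if_distrib[of "\<lambda>c. c * _"] intro: ultra_bound.zero cong: if_cong)

lemma strictly_diff_cong:
  assumes "strictly_diff n x F D" "\<And>j. j < n \<Longrightarrow> D j = E j"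
  shows "strictly_diff n x F E"
proof -
  have "(\<Sum>j<n. D j * v j) = (\<Sum>j<n. E j * v j)" for v :: "nat \<Rightarrow> 'a"
    using assms(2) by (intro sum.cong) auto
  then show ?thesis using assms(1) unfolding strictly_diff_def taylor_constant_def by (simp only:)
qed

lemma strictly_diff_add:
  assumes "strictly_diff n x F D" "strictly_diff n x G E"
  shows "strictly_diff n x (\<lambda>y. F y + G y) (\<lambda>j. D j + E j)"
proof -
  obtain A where A: "0 \<le> A" and FA: "taylor_constant n x F D A"
    using assms(1) by (auto simp: strictly_diff_def taylor_constant_def)
  obtain B where B: "0 \<le> B" and GB: "taylor_constant n x G E B"
    using assms(2) by (auto simp: strictly_diff_def taylor_constant_def)
  show ?thesis
  proof (rule strictly_diffI[of "A + B"])
    fix N :: "((nat \<Rightarrow> 'a) \<Rightarrow> 'a) \<Rightarrow> real \<Rightarrow> bool" and \<rho> \<delta> and h h' :: "(nat \<Rightarrow> 'a) \<Rightarrow> nat \<Rightarrow> 'a"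
    assume inc: "bounded_increments n N \<rho> \<delta> h h'"
    then have \<rho>: "0 \<le> \<rho>" "\<rho> \<le> 1" "0 \<le> \<delta>" and "ultra_bound N" by (auto simp: bounded_increments_def)
    then interpret ultra_bound N by simp
    note F = taylor_constantD[OF FA inc] and G = taylor_constantD[OF GB inc]
    have le: "A * \<delta> \<le> (A + B) * \<delta>" "B * \<delta> \<le> (A + B) * \<delta>"
      "A * \<rho> * \<delta> \<le> (A + B) * \<rho> * \<delta>" "B * \<rho> * \<delta> \<le> (A + B) * \<rho> * \<delta>"
      using A B \<rho> by (auto intro!: mult_right_mono)
    have eq: "(\<Sum>j<n. (D j + E j) * (h s j - h' s j)) = (\<Sum>j<n. D j * (h s j - h' s j)) + (\<Sum>j<n. E j * (h s j - h' s j))" for s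
      by (simp add: distrib_right sum.distrib)
    from add[OF mono[OF F(1) le(1)] mono[OF G(1) le(2)]]
      add[OF mono[OF F(2) le(3)] mono[OF G(2) le(4)]]
    show "N (\<lambda>s. F (\<lambda>i. x i + h s i) + G (\<lambda>i. x i + h s i) - (F (\<lambda>i. x i + h' s i) + G (\<lambda>i. x i + h' s i))) ((A + B) * \<delta>)"
      "N (\<lambda>s. F (\<lambda>i. x i + h s i) + G (\<lambda>i. x i + h s i) - (F (\<lambda>i. x i + h' s i) + G (\<lambda>i. x i + h' s i)) -
          (\<Sum>j<n. (D j + E j) * (h s j - h' s j))) ((A + B) * \<rho> * \<delta>)"
      unfolding eq by (simp_all only: add_diff_add)
  qed (use A B in simp)
qed

text \<open>With F, G taken at h and F', G' at h', the difference FG - F'G' equals G(x)(F - F') +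
  F(x)(G - G') plus (F - F')(G - G(x)) + (F' - F(x))(G - G'). The first two terms give the Leibniz
  rule, the last two have order \<rho>\<delta>.\<close>

lemma strictly_diff_mult:
  assumes "strictly_diff n x F D" "strictly_diff n x G E"
  shows "strictly_diff n x (\<lambda>y. F y * G y) (\<lambda>j. F x * E j + D j * G x)"
proof -
  obtain A where A: "0 \<le> A" and FA: "taylor_constant n x F D A"
    using assms(1) by (auto simp: strictly_diff_def taylor_constant_def)
  obtain B where B: "0 \<le> B" and GB: "taylor_constant n x G E B"
    using assms(2) by (auto simp: strictly_diff_def taylor_constant_def)
  define C where "C = vnorm (G x) * A + vnorm (F x) * B + A * B"
  have C: "vnorm (G x) * A \<le> C" "vnorm (F x) * B \<le> C" "A * B \<le> C" "0 \<le> C"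
    using A B by (auto simp: C_def)
  show ?thesis
  proof (rule strictly_diffI[OF C(4)])
    fix N :: "((nat \<Rightarrow> 'a) \<Rightarrow> 'a) \<Rightarrow> real \<Rightarrow> bool" and \<rho> \<delta> and h h' :: "(nat \<Rightarrow> 'a) \<Rightarrow> nat \<Rightarrow> 'a"
    assume inc: "bounded_increments n N \<rho> \<delta> h h'"
    then have \<rho>: "0 \<le> \<rho>" "\<rho> \<le> 1" "0 \<le> \<delta>" and "ultra_bound N" by (auto simp: bounded_increments_def)
    then interpret ultra_bound N by simp
    note F = taylor_constantD[OF FA inc] and G = taylor_constantD[OF GB inc]
    let ?F = "\<lambda>s. F (\<lambda>i. x i + h s i)" and ?F' = "\<lambda>s. F (\<lambda>i. x i + h' s i)"
    let ?G = "\<lambda>s. G (\<lambda>i. x i + h s i)" and ?G' = "\<lambda>s. G (\<lambda>i. x i + h' s i)"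
    let ?dF = "\<lambda>s. \<Sum>j<n. D j * (h s j - h' s j)" and ?dG = "\<lambda>s. \<Sum>j<n. E j * (h s j - h' s j)"
    \<comment> \<open>Comparison with the zero increment turns the Lipschitz bound in \<delta> into
      a bound in \<rho> for the distance from the value at \<open>x\<close>.\<close>
    have 0: "N (\<lambda>s. ?G s - G x) (B * \<rho>)" "N (\<lambda>s. ?F' s - F x) (A * \<rho>)"
    proof -
      have "bounded_increments n N \<rho> \<rho> h (\<lambda>_ _. 0)" "bounded_increments n N \<rho> \<rho> h' (\<lambda>_ _. 0)"
        using inc zero[OF \<rho>(1)] by (auto simp: bounded_increments_def)
      from taylor_constantD(1)[OF GB this(1)] taylor_constantD(1)[OF FA this(2)]
      show "N (\<lambda>s. ?G s - G x) (B * \<rho>)" "N (\<lambda>s. ?F' s - F x) (A * \<rho>)" by simp_all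
    qed
    have le1: "vnorm (G x) * (A * \<delta>) \<le> C * \<delta>" "vnorm (F x) * (B * \<delta>) \<le> C * \<delta>"
      "vnorm (G x) * (A * \<rho> * \<delta>) \<le> C * \<rho> * \<delta>" "vnorm (F x) * (B * \<rho> * \<delta>) \<le> C * \<rho> * \<delta>"
      "A * \<delta> * (B * \<rho>) \<le> C * \<rho> * \<delta>" "A * \<rho> * (B * \<delta>) \<le> C * \<rho> * \<delta>"
      using mult_right_mono[OF C(1) \<rho>(3)] mult_right_mono[OF C(2) \<rho>(3)]
        mult_right_mono[OF C(1), of "\<rho> * \<delta>"] mult_right_mono[OF C(2), of "\<rho> * \<delta>"]
        mult_right_mono[OF C(3), of "\<rho> * \<delta>"] \<rho>
      by (simp_all add: mult_ac)
    have C\<rho>: "C * \<rho> * \<delta> \<le> C * \<delta>"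
      using mult_left_mono[OF \<rho>(2), of "C * \<delta>"] C(4) \<rho> by (simp add: mult_ac)
    have P1: "N (\<lambda>s. (?F s - ?F' s) * (?G s - G x)) (C * \<rho> * \<delta>)"
      by (rule mult_le[OF F(1) 0(1) le1(5)])
    have P2: "N (\<lambda>s. (?F' s - F x) * (?G s - ?G' s)) (C * \<rho> * \<delta>)"
      by (rule mult_le[OF 0(2) G(1) le1(6)])
    note P = add[OF P1 P2]
    have "N (\<lambda>s. G x * (?F s - ?F' s) + F x * (?G s - ?G' s)) (C * \<delta>)"
      by (rule add[OF mono[OF cmult[OF F(1)] le1(1)] mono[OF cmult[OF G(1)] le1(2)]])
    from add[OF this mono[OF P C\<rho>]]
    have "N (\<lambda>s. ?F s * ?G s - ?F' s * ?G' s) (C * \<delta>)"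
      by (simp add: algebra_simps)
    moreover have "N (\<lambda>s. G x * (?F s - ?F' s - ?dF s) + F x * (?G s - ?G' s - ?dG s)) (C * \<rho> * \<delta>)"
      by (rule add[OF mono[OF cmult[OF F(2)] le1(3)] mono[OF cmult[OF G(2)] le1(4)]])
    from add[OF this P]
    have "N (\<lambda>s. ?F s * ?G s - ?F' s * ?G' s - (G x * ?dF s + F x * ?dG s)) (C * \<rho> * \<delta>)"
      by (simp add: algebra_simps)
    moreover have "(\<Sum>j<n. (F x * E j + D j * G x) * (h s j - h' s j)) = G x * ?dF s + F x * ?dG s" for s
      by (simp add: sum_distrib_left sum.distrib[symmetric] algebra_simps)
    ultimately show "N (\<lambda>s. ?F s * ?G s - ?F' s * ?G' s) (C * \<delta>)"
      "N (\<lambda>s. ?F s * ?G s - ?F' s * ?G' s - (\<Sum>j<n. (F x * E j + D j * G x) * (h s j - h' s j))) (C * \<rho> * \<delta>)"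
      by simp_all
  qed
qed

lemma strictly_diff_cmult:
  assumes "strictly_diff n x F D"
  shows "strictly_diff n x (\<lambda>y. k * F y) (\<lambda>j. k * D j)"
  using strictly_diff_mult[OF strictly_diff_const assms, of k] by simp

lemma strictly_diff_sum:
  assumes "\<And>a. a \<in> A \<Longrightarrow> strictly_diff n x (F a) (D a)"
  shows "strictly_diff n x (\<lambda>y. \<Sum>a\<in>A. F a y) (\<lambda>j. \<Sum>a\<in>A. D a j)"
  using assms
  by (induction A rule: infinite_finite_induct) (auto intro: strictly_diff_const strictly_diff_add)

lemma strictly_diff_monom:
  assumes "\<alpha> \<in> multi_indices n"
  shows "strictly_diff n x (monom_value \<alpha>)
    (\<lambda>j. of_nat (Poly_Mapping.lookup \<alpha> j) * monom_value (\<alpha> - Poly_Mapping.single j 1) x)"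
  using assms
proof (induction "multi_degree \<alpha>" arbitrary: \<alpha>)
  case 0
  have "Poly_Mapping.lookup \<alpha> i = 0" for i using lookup_le_multi_degree[of \<alpha> i] 0 by simp
  then have "\<alpha> = 0" by (intro poly_mapping_eqI) simp
  then show ?case using strictly_diff_const[of n x 1] by (simp add: fun_eq_iff)
next
  case (Suc k)
  then have "Poly_Mapping.keys \<alpha> \<noteq> {}" unfolding multi_degree_def by fastforce
  then obtain i where "i \<in> Poly_Mapping.keys \<alpha>" by blast
  then have i: "Poly_Mapping.lookup \<alpha> i \<noteq> 0" by (simp add: in_keys_iff)
  define \<beta> where "\<beta> = \<alpha> - Poly_Mapping.single i 1"
  have \<alpha>: "\<alpha> = \<beta> + Poly_Mapping.single i 1"
    by (rule poly_mapping_eqI) (use i in \<open>auto simp: \<beta>_def lookup_add lookup_minus lookup_single when_def\<close>)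
  have \<beta>: "\<beta> \<in> multi_indices n" "k = multi_degree \<beta>"
    using Suc by (auto simp: \<alpha> multi_indices_add_iff multi_degree_add)
  have "i < n" by (rule ccontr) (use i lookup_notin_multi_indices[OF Suc.prems] in auto)
  let ?D = "\<lambda>\<alpha> j. of_nat (Poly_Mapping.lookup \<alpha> j) * monom_value (\<alpha> - Poly_Mapping.single j 1) x"
  have "strictly_diff n x (\<lambda>y. monom_value \<beta> y * y i)
      (\<lambda>j. monom_value \<beta> x * (if j = i then 1 else 0) + ?D \<beta> j * x i)"
    by (rule strictly_diff_mult[OF Suc.hyps(1)[OF \<beta>(2,1)] strictly_diff_coord[OF \<open>i < n\<close>]])
  moreover have monom: "monom_value \<alpha> = (\<lambda>y. monom_value \<beta> y * y i)"
    by (simp add: \<alpha> monom_value_add fun_eq_iff)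
  \<comment> \<open>Subtraction of exponents is truncated: for exponent 0 the lowered monomial is
    meaningless and only the vanishing coefficient makes the formula right, hence the case
    distinction.\<close>
  moreover have "monom_value \<beta> x * (if j = i then 1 else 0) + ?D \<beta> j * x i = ?D \<alpha> j" for j
  proof (cases "Poly_Mapping.lookup \<beta> j = 0")
    case True
    then show ?thesis by (auto simp: \<alpha> lookup_add lookup_single when_def)
  next
    case False
    then have "\<alpha> - Poly_Mapping.single j 1 = (\<beta> - Poly_Mapping.single j 1) + Poly_Mapping.single i 1"
      by (intro poly_mapping_eqI) (auto simp: \<alpha> lookup_add lookup_minus lookup_single when_def)
    moreover have "\<beta> = (\<beta> - Poly_Mapping.single j 1) + Poly_Mapping.single j 1"
      using False by (intro poly_mapping_eqI) (auto simp: lookup_add lookup_minus lookup_single when_def)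
    then have "monom_value \<beta> x = monom_value (\<beta> - Poly_Mapping.single j 1) x * x j"
      by (metis monom_value_add monom_value_single power_one_right)
    ultimately show ?thesis
      by (auto simp: monom_value_add lookup_add \<alpha> lookup_single when_def algebra_simps)
  qed
  ultimately show ?case by (simp only: monom)
qed

lemma strictly_diff_mpoly:
  assumes "f \<in> carrier (poly_ring n)"
  shows "strictly_diff n x (mpoly_value f) (\<lambda>j. mpoly_value (mpoly_deriv j f) x)"
proof -
  let ?D = "\<lambda>\<alpha> j. of_nat (Poly_Mapping.lookup \<alpha> j) * monom_value (\<alpha> - Poly_Mapping.single j 1) x"
  have "strictly_diff n x (\<lambda>y. \<Sum>\<alpha>\<in>Poly_Mapping.keys f. Poly_Mapping.lookup f \<alpha> * monom_value \<alpha> y)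
      (\<lambda>j. \<Sum>\<alpha>\<in>Poly_Mapping.keys f. Poly_Mapping.lookup f \<alpha> * ?D \<alpha> j)"
    using assms by (intro strictly_diff_sum strictly_diff_cmult strictly_diff_monom) (auto simp: poly_ring_simps)
  then show ?thesis
    unfolding mpoly_value_def[of f, abs_def]
    by (rule strictly_diff_cong) (simp add: mpoly_deriv_def mpoly_value_sum mult.assoc)
qed

section \<open>Simultaneous polynomial approximation\<close>

text \<open>Polynomial functions with coefficients in the extension, on the whole ambient space.
  Restriction to the rational points is postponed, since norms are taken after composition with
  inverse charts; the inductive form makes closure properties and norm bounds inductions.\<close>

inductive_set algebraic_functions ::
    "('q::nonarch_field \<Rightarrow> 'l::nonarch_field) \<Rightarrow> nat \<Rightarrow> ((nat \<Rightarrow> 'q) \<Rightarrow> 'l) set"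
  for \<iota> n where
  zero: "(\<lambda>_. 0) \<in> algebraic_functions \<iota> n"
| step: "G \<in> algebraic_functions \<iota> n \<Longrightarrow> h \<in> carrier (poly_ring n) \<Longrightarrow>
    (\<lambda>x. G x + \<iota> (mpoly_value h x) * l) \<in> algebraic_functions \<iota> n"

lemma C_alg_eq:
  "C_alg \<iota> n I = (\<lambda>G x. if x \<in> rational_points n I then G x else 0) ` algebraic_functions \<iota> n"
  (is "_ = ?R ` _")
proof (intro equalityI subsetI)
  have sum_alg: "(\<lambda>x. \<Sum>k<m. \<iota> (mpoly_value (h k) x) * l k) \<in> algebraic_functions \<iota> n"
    if "h ` {..<m} \<subseteq> carrier (poly_ring n)" for m and h :: "nat \<Rightarrow> 'a mpoly" and l :: "nat \<Rightarrow> 'b"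
    using that
  proof (induction m)
    case (Suc m)
    then have "h ` {..<m} \<subseteq> carrier (poly_ring n)" "h m \<in> carrier (poly_ring n)"
      by (auto simp: lessThan_Suc)
    with Suc.IH have "(\<lambda>x. (\<Sum>k<m. \<iota> (mpoly_value (h k) x) * l k) + \<iota> (mpoly_value (h m) x) * l m) \<in> algebraic_functions \<iota> n"
      by (intro algebraic_functions.step)
    then show ?case by simp
  qed (simp add: algebraic_functions.zero)
  fix f assume "f \<in> C_alg \<iota> n I"
  then obtain m and h :: "nat \<Rightarrow> 'a mpoly" and l where "h ` {..<m} \<subseteq> carrier (poly_ring n)"
    "f = ?R (\<lambda>x. \<Sum>k<m. \<iota> (mpoly_value (h k) x) * l k)"
    unfolding C_alg_def mem_Collect_eq by (elim exE conjE)
  then show "f \<in> ?R ` algebraic_functions \<iota> n"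
    using sum_alg by (simp only: image_eqI)
next
  fix f assume "f \<in> ?R ` algebraic_functions \<iota> n"
  then obtain G where G: "G \<in> algebraic_functions \<iota> n" "f = ?R G" by (elim imageE)
  have "\<exists>(m :: nat) h l. h ` {..<m} \<subseteq> carrier (poly_ring n) \<and> G = (\<lambda>x. \<Sum>k<m. \<iota> (mpoly_value (h k) x) * l k)"
    using G(1)
  proof induction
    case zero
    show ?case by (rule exI[of _ "0 :: nat"], rule exI[of _ "\<lambda>_. 0"], rule exI[of _ "\<lambda>_. 0"]) simp
  next
    case (step G h l)
    then obtain m :: nat and h' l' where IH: "h' ` {..<m} \<subseteq> carrier (poly_ring n)"
      "G = (\<lambda>x. \<Sum>k<m. \<iota> (mpoly_value (h' k) x) * l' k)" by blast
    have "(\<Sum>k<Suc m. \<iota> (mpoly_value ((h'(m := h)) k) x) * (l'(m := l)) k) = G x + \<iota> (mpoly_value h x) * l" for x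
      unfolding IH(2) by simp
    moreover have "h'(m := h) ` {..<Suc m} \<subseteq> carrier (poly_ring n)"
      using IH(1) step.hyps(2) by (auto simp: lessThan_Suc)
    ultimately show ?case
      by (intro exI[of _ "Suc m"] exI[of _ "h'(m := h)"] exI[of _ "l'(m := l)"]) (simp only: simp_thms)
  qed
  then show "f \<in> C_alg \<iota> n I"
    unfolding C_alg_def G(2) by (elim exE conjE) (simp only:, blast)
qed

lemma (in ultra_bound) ex_sum:
  assumes "\<And>a. a \<in> A \<Longrightarrow> \<exists>C. N (F a) C"
  shows "\<exists>C. N (\<lambda>s. \<Sum>a\<in>A. F a s) C"
  using assms
proof (induction A rule: infinite_finite_induct)
  case (insert a A)
  then have "\<exists>C. N (F a) C" "\<exists>C. N (\<lambda>s. \<Sum>a\<in>A. F a s) C" by blast+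
  then show ?case using insert.hyps add_max by fastforce
qed (use zero[of 0] in auto)

lemma (in ultra_bound) ex_prod:
  assumes "\<And>a. a \<in> A \<Longrightarrow> \<exists>C. N (F a) C"
  shows "\<exists>C. N (\<lambda>s. \<Prod>a\<in>A. F a s) C"
  using assms
proof (induction A rule: infinite_finite_induct)
  case (insert a A)
  then have "\<exists>C. N (F a) C" "\<exists>C. N (\<lambda>s. \<Prod>a\<in>A. F a s) C" by blast+
  then show ?case using insert.hyps mult by fastforce
qed (use const[of 1 1] in auto)

section \<open>The algebra of polynomial functions\<close>

context isometric_embedding
begin

lemma algebraic_add:
  assumes "F \<in> algebraic_functions \<iota> n" "G \<in> algebraic_functions \<iota> n"
  shows "(\<lambda>x. F x + G x) \<in> algebraic_functions \<iota> n"
  using assms(2)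
proof induction
  case (step G h l)
  from algebraic_functions.step[OF step.IH step.hyps(2), of l] show ?case
    by (simp add: add.assoc)
qed (use assms(1) in simp)

lemma algebraic_mult_poly:
  assumes "F \<in> algebraic_functions \<iota> n" "h \<in> carrier (poly_ring n)"
  shows "(\<lambda>x. F x * (\<iota> (mpoly_value h x) * l)) \<in> algebraic_functions \<iota> n"
  using assms(1)
proof induction
  case (step G h' l')
  from algebraic_functions.step[OF step.IH poly_ring_mult_closed[OF step.hyps(2) assms(2)], of "l' * l"]
  show ?case by (simp add: mpoly_value_mult emb_mult distrib_right distrib_left mult_ac)
qed (simp add: algebraic_functions.zero)

lemma algebraic_mult:
  assumes "F \<in> algebraic_functions \<iota> n" "G \<in> algebraic_functions \<iota> n"
  shows "(\<lambda>x. F x * G x) \<in> algebraic_functions \<iota> n"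
  using assms(2)
proof induction
  case (step G h l)
  from algebraic_add[OF step.IH algebraic_mult_poly[OF assms(1) step.hyps(2), of l]] show ?case
    by (simp add: distrib_left)
qed (simp add: algebraic_functions.zero)

lemma algebraic_const: "(\<lambda>_. k) \<in> algebraic_functions \<iota> n"
proof -
  have "(1 :: 'q mpoly) \<in> carrier (poly_ring n)" by (simp add: poly_ring_simps(1))
  from algebraic_functions.step[OF algebraic_functions.zero this, of \<iota> k] show ?thesis by (simp add: emb_one)
qed

lemma algebraic_coord:
  assumes "i < n"
  shows "(\<lambda>x. \<iota> (x i)) \<in> algebraic_functions \<iota> n"
proof -
  have "Poly_Mapping.single (Poly_Mapping.single i 1) (1 :: 'q) \<in> carrier (poly_ring n)"
    using assms by (simp add: poly_ring_simps(1) single_in_multi_indices)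
  from algebraic_functions.step[OF algebraic_functions.zero this, of \<iota> 1] show ?thesis by simp
qed

lemma algebraic_cmult: "F \<in> algebraic_functions \<iota> n \<Longrightarrow> (\<lambda>x. k * F x) \<in> algebraic_functions \<iota> n"
  by (rule algebraic_mult[OF algebraic_const])

lemma algebraic_diff:
  assumes "F \<in> algebraic_functions \<iota> n" "G \<in> algebraic_functions \<iota> n"
  shows "(\<lambda>x. F x - G x) \<in> algebraic_functions \<iota> n"
  using algebraic_add[OF assms(1) algebraic_cmult[OF assms(2), of "- 1"]] by simp

lemma algebraic_power: "F \<in> algebraic_functions \<iota> n \<Longrightarrow> (\<lambda>x. F x ^ k) \<in> algebraic_functions \<iota> n"
  by (induction k) (auto intro: algebraic_const algebraic_mult)

lemma algebraic_prod:
  "(\<And>i. i \<in> A \<Longrightarrow> F i \<in> algebraic_functions \<iota> n) \<Longrightarrow> (\<lambda>x. \<Prod>i\<in>A. F i x) \<in> algebraic_functions \<iota> n"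
  by (induction A rule: infinite_finite_induct) (auto intro: algebraic_const algebraic_mult)

lemma algebraic_sum:
  "(\<And>i. i \<in> A \<Longrightarrow> F i \<in> algebraic_functions \<iota> n) \<Longrightarrow> (\<lambda>x. \<Sum>i\<in>A. F i x) \<in> algebraic_functions \<iota> n"
  by (induction A rule: infinite_finite_induct) (auto intro: algebraic_const algebraic_add)

lemma emb_power: "\<iota> (x ^ k) = \<iota> x ^ k"
  by (induction k) (simp_all add: emb_one emb_mult)

lemma emb_prod: "\<iota> (prod f A) = (\<Prod>i\<in>A. \<iota> (f i))"
  by (induction A rule: infinite_finite_induct) (auto simp: emb_one emb_mult)

text \<open>Polynomials are finite expressions in the coordinates, so finite norms of the
  coordinates suffice. The substitution \<open>y\<close> will be an inverse chart or the
  identity.\<close>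

lemma algebraic_bounded:
  assumes N: "ultra_bound N" and y: "\<And>i. i < n \<Longrightarrow> \<exists>C. N (\<lambda>s. \<iota> (y s i)) C"
    and G: "G \<in> algebraic_functions \<iota> n"
  shows "\<exists>C. N (\<lambda>s. G (y s)) C"
proof -
  interpret ultra_bound N by (rule N)
  from G show ?thesis
  proof induction
    case zero
    show ?case using ultra_bound.zero[OF N, of 0] by auto
  next
    case (step G h l)
    have "\<exists>C. N (\<lambda>s. \<Sum>\<alpha>\<in>Poly_Mapping.keys h. \<iota> (Poly_Mapping.lookup h \<alpha>) *
        (\<Prod>i\<in>Poly_Mapping.keys \<alpha>. \<iota> (y s i) ^ Poly_Mapping.lookup \<alpha> i)) C"
    proof (rule ex_sum)
      fix \<alpha> assume "\<alpha> \<in> Poly_Mapping.keys h"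
      then have "\<alpha> \<in> multi_indices n" using step.hyps(2) by (auto simp: poly_ring_simps(1))
      then have "\<exists>C. N (\<lambda>s. \<Prod>i\<in>Poly_Mapping.keys \<alpha>. \<iota> (y s i) ^ Poly_Mapping.lookup \<alpha> i) C"
      proof (intro ex_prod)
        fix i assume "i \<in> Poly_Mapping.keys \<alpha>"
        with \<open>\<alpha> \<in> multi_indices n\<close> have "i < n" by (auto simp: multi_indices_def)
        then obtain C where "N (\<lambda>s. \<iota> (y s i)) C" using y by blast
        then show "\<exists>C. N (\<lambda>s. \<iota> (y s i) ^ Poly_Mapping.lookup \<alpha> i) C" by (intro exI) (rule power)
      qed
      then show "\<exists>C. N (\<lambda>s. \<iota> (Poly_Mapping.lookup h \<alpha>) * (\<Prod>i\<in>Poly_Mapping.keys \<alpha>. \<iota> (y s i) ^ Poly_Mapping.lookup \<alpha> i)) C"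
        using cmult by blast
    qed
    then obtain C where "N (\<lambda>s. \<iota> (mpoly_value h (y s))) C"
      unfolding mpoly_value_def monom_value_def emb_sum emb_mult emb_prod emb_power by blast
    then have "N (\<lambda>s. \<iota> (mpoly_value h (y s)) * l) (vnorm l * C)"
      using cmult[of "\<lambda>s. \<iota> (mpoly_value h (y s))" C l] by (simp add: mult.commute)
    moreover obtain D where "N (\<lambda>s. G (y s)) D" using step.IH by blast
    ultimately show ?case using add_max by blast
  qed
qed

end

section \<open>Separation of disjoint polydiscs and gluing\<close>

lemma (in ultra_bound) near_one_mult:
  assumes "N (\<lambda>s. f s - 1) \<theta>" "N (\<lambda>s. g s - 1) \<theta>" "\<theta> \<le> 1"
  shows "N (\<lambda>s. f s * g s - 1) \<theta>"
proof -
  \<comment> \<open>For use with fg - 1 = (f - 1)(g - 1) + (f - 1) + (g - 1).\<close>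
  have "\<theta> * \<theta> \<le> \<theta>" using nonneg[OF assms(1)] assms(3) by (simp add: mult_left_le)
  from add[OF mult_le[OF assms(1,2) this] add[OF assms(1,2)]] show ?thesis
    by (simp add: algebra_simps)
qed

lemma (in ultra_bound) near_one_power:
  assumes "N (\<lambda>s. f s - 1) \<theta>" "\<theta> \<le> 1"
  shows "N (\<lambda>s. f s ^ k - 1) \<theta>"
  by (induction k) (use assms nonneg[OF assms(1)] in \<open>auto intro: zero near_one_mult\<close>)

text \<open>
  \<open>Q D\<close> bounds a norm of ambient functions near the polydisc with centre \<open>X D\<close> and radius \<open>R D\<close>,
  such as the Gauss norm of their restrictions to a chart.
\<close>

locale polydisc_bounds = isometric_embedding \<iota>
  for \<iota> :: "'q::nonarch_field \<Rightarrow> 'l::nonarch_field" +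
  fixes n :: nat and J :: "'j set" and Q :: "'j \<Rightarrow> ((nat \<Rightarrow> 'q) \<Rightarrow> 'l) \<Rightarrow> real \<Rightarrow> bool"
    and X :: "'j \<Rightarrow> nat \<Rightarrow> 'q" and R :: "'j \<Rightarrow> real"
  assumes Q: "\<And>D. D \<in> J \<Longrightarrow> ultra_bound (Q D)"
    and R_pos: "\<And>D. D \<in> J \<Longrightarrow> 0 < R D"
    and coord: "\<And>D i. D \<in> J \<Longrightarrow> i < n \<Longrightarrow> Q D (\<lambda>y. \<iota> (y i - X D i)) (R D)"
begin

lemma algebraic_Q_bounded:
  assumes "D \<in> J" "G \<in> algebraic_functions \<iota> n"
  shows "\<exists>C. Q D G C"
proof (rule algebraic_bounded[OF Q[OF assms(1)] _ assms(2)])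
  fix i assume "i < n"
  interpret ultra_bound "Q D" by (rule Q[OF assms(1)])
  show "\<exists>C. Q D (\<lambda>y. \<iota> (y i)) C"
  proof
    show "Q D (\<lambda>y. \<iota> (y i)) (max (R D) (vnorm (\<iota> (X D i))))"
      using add_max[OF coord[OF assms(1) \<open>i < n\<close>] const[OF order_refl, of "\<iota> (X D i)"]]
      by (simp add: emb_diff)
  qed
qed

text \<open>
  \<open>t\<close> is a product of powers of the factors \<open>(y\<^sub>i - b\<^sub>i) / (a\<^sub>i - b\<^sub>i)\<close>, one for each centre \<open>b\<close> to be
  avoided, with \<open>i\<close> maximising \<open>|a\<^sub>i - b\<^sub>i|\<close>. Such a factor is bounded by \<open>1\<close> near all centres that are
  at most as far from \<open>a\<close> as \<open>b\<close> is; hence the farthest centre is treated last, and its exponent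
  is chosen to beat the norms of the other factors.
\<close>

lemma separating_function:
  assumes F: "F \<in> J" and "finite S" "S \<subseteq> J" and "0 < \<epsilon>"
    and RS: "\<And>E. E \<in> S \<Longrightarrow> R E \<le> R F"
    and sep: "\<And>E. E \<in> S \<Longrightarrow> \<exists>i<n. R F < vnorm (X E i - X F i)"
  shows "\<exists>t\<in>algebraic_functions \<iota> n. \<exists>\<theta><1. Q F (\<lambda>y. t y - 1) \<theta> \<and> (\<forall>E\<in>S. Q E t \<epsilon>)"
  using assms(2,3) RS sep
proof (induction S rule: finite_ranking_induct[where f = "\<lambda>E. Max ((\<lambda>i. vnorm (X E i - X F i)) ` {..<n})"])
  case empty
  interpret ultra_bound "Q F" by (rule Q[OF F])
  show ?case
    using algebraic_const[of 1 n] zero[of 0] by (intro bexI[of _ "\<lambda>_. 1"] exI[of _ 0]) auto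
next
  case (insert E S)
  let ?d = "\<lambda>E. Max ((\<lambda>i. vnorm (X E i - X F i)) ` {..<n})"
  interpret F: ultra_bound "Q F" by (rule Q[OF F])
  have E: "E \<in> J" using insert.prems by simp
  interpret E: ultra_bound "Q E" by (rule Q[OF E])
  obtain t where t: "t \<in> algebraic_functions \<iota> n" "\<forall>E\<in>S. Q E t \<epsilon>"
    and "\<exists>\<theta><1. Q F (\<lambda>y. t y - 1) \<theta>"
    using insert by auto
  then obtain \<theta>0 where \<theta>0: "\<theta>0 < 1" "Q F (\<lambda>y. t y - 1) \<theta>0" by blast
  obtain i0 where i0: "i0 < n" "R F < vnorm (X E i0 - X F i0)" using insert.prems(3) by auto
  have le_d: "vnorm (X E' i - X F i) \<le> ?d E'" if "i < n" for E' i using that by auto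
  have "?d E \<in> (\<lambda>i. vnorm (X E i - X F i)) ` {..<n}" using i0 by (intro Max_in) auto
  then obtain i where i: "i < n" "vnorm (X E i - X F i) = ?d E" by auto
  have d: "R F < ?d E" using i0 le_d[OF i0(1), of E] by linarith
  have d_pos: "0 < ?d E" using d R_pos[OF F] by linarith
  define b where "b = inverse (\<iota> (X F i - X E i))"
  have b: "vnorm b = inverse (?d E)"
    using i(2) by (simp add: b_def vnorm_inverse vnorm_emb vnorm_minus_commute)
  define u where "u y = b * \<iota> (y i - X E i)" for y :: "nat \<Rightarrow> 'q"
  \<comment> \<open>Below 1 because the centre of \<open>E\<close> lies outside the disc of
    \<open>F\<close> already in coordinate \<open>i\<close>. Since \<open>R E \<le> R F\<close>, the
    same number bounds \<open>u - 1\<close> on \<open>F\<close> and \<open>u\<close> on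
    \<open>E\<close>.\<close>
  define \<theta>1 where "\<theta>1 = R F / ?d E"
  have \<theta>1: "0 \<le> \<theta>1" "\<theta>1 < 1" using d R_pos[OF F] by (auto simp: \<theta>1_def)
  have u_alg: "u \<in> algebraic_functions \<iota> n"
    unfolding u_def emb_diff using i(1)
    by (intro algebraic_cmult algebraic_diff algebraic_coord algebraic_const)
  have "u y - 1 = b * \<iota> (y i - X F i)" for y
  proof -
    have "X F i - X E i \<noteq> 0" using i(2) d_pos vnorm_minus_commute[of "X F i"] by auto
    then have "vnorm (\<iota> (X F i - X E i)) \<noteq> 0" by (simp add: vnorm_emb)
    then have "b * \<iota> (X F i - X E i) = 1" by (simp add: b_def)
    then show ?thesis by (simp add: u_def emb_diff algebra_simps)
  qed
  then have uF: "Q F (\<lambda>y. u y - 1) \<theta>1"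
    using F.cmult[OF coord[OF F i(1)], of b] by (simp add: b \<theta>1_def field_simps)
  have uE: "Q E u \<theta>1"
  proof (rule E.mono)
    show "Q E u (vnorm b * R E)" unfolding u_def by (rule E.cmult[OF coord[OF E i(1)]])
    show "vnorm b * R E \<le> \<theta>1"
      using insert.prems(2)[of E] d_pos by (simp add: b \<theta>1_def field_simps)
  qed
  have uS: "Q E' u 1" if E': "E' \<in> S" for E'
  proof -
    have "E' \<in> J" using E' insert.prems by auto
    then interpret E': ultra_bound "Q E'" by (rule Q)
    have E'_d: "?d E' \<le> ?d E" by (rule insert.hyps(2)[OF E'])
    have "vnorm (X E' i - X E i) \<le> ?d E"
    proof (rule vnorm_diff_triangle[of _ "X F i"])
      show "vnorm (X E' i - X F i) \<le> ?d E" by (rule order_trans[OF le_d[OF i(1)] E'_d])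
      show "vnorm (X F i - X E i) \<le> ?d E"
        unfolding vnorm_minus_commute[of "X F i" "X E i"] by (rule le_d[OF i(1)])
    qed
    moreover have "R E' \<le> ?d E" using insert.prems(2)[of E'] E' d by simp
    ultimately have "Q E' (\<lambda>y. \<iota> (y i - X E' i) + \<iota> (X E' i - X E i)) (?d E)"
      by (intro E'.add E'.mono[OF coord[OF \<open>E' \<in> J\<close> i(1)]] E'.const) (simp_all add: vnorm_emb)
    from E'.cmult[OF this, of b] show ?thesis
      unfolding u_def using d_pos by (simp add: b emb_diff)
  qed
  obtain K where K: "Q E t K" using algebraic_Q_bounded[OF E t(1)] by blast
  have K0: "0 \<le> K" by (rule E.nonneg[OF K])
  obtain m where m: "\<theta>1 ^ m < \<epsilon> / (K + 1)"
    using real_arch_pow_inv[of "\<epsilon> / (K + 1)" \<theta>1] \<theta>1 K0 \<open>0 < \<epsilon>\<close> by auto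
  have "K * \<theta>1 ^ m \<le> (K + 1) * \<theta>1 ^ m" using \<theta>1 by (intro mult_right_mono) auto
  also have "\<dots> \<le> \<epsilon>" using m K0 by (simp add: field_simps)
  finally have m': "K * \<theta>1 ^ m \<le> \<epsilon>" .
  define t' where "t' y = t y * u y ^ m" for y
  have "t' \<in> algebraic_functions \<iota> n"
    unfolding t'_def by (intro algebraic_mult algebraic_power t u_alg)
  moreover have "Q F (\<lambda>y. t' y - 1) (max \<theta>0 \<theta>1)"
    unfolding t'_def using \<theta>0 \<theta>1
    by (intro F.near_one_mult F.near_one_power F.mono[OF \<theta>0(2)] F.mono[OF uF]) auto
  moreover have "Q E t' \<epsilon>"
    unfolding t'_def by (rule E.mult_le[OF K E.power[OF uE] m'])
  moreover have "Q E' t' \<epsilon>" if E': "E' \<in> S" for E'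
  proof -
    interpret E': ultra_bound "Q E'" using E' insert.prems by (intro Q) auto
    show ?thesis unfolding t'_def
      by (rule E'.mult_le[OF t(2)[rule_format, OF E'] E'.power[OF uS[OF E']]]) simp
  qed
  ultimately show ?case using \<theta>0 \<theta>1 by (intro bexI[of _ t'] exI[of _ "max \<theta>0 \<theta>1"]) auto
qed

text \<open>On \<open>F\<close> the powers of 1 - t become small; on the other discs 1 - t is within
  \<delta> of 1, and so are all its powers, whatever the exponent. Hence \<open>k\<close> can be
  chosen after \<open>t\<close> without spoiling the second estimate.\<close>

lemma approximate_indicator:
  assumes F: "F \<in> J" and S: "finite S" "S \<subseteq> J" and \<epsilon>: "0 < \<epsilon>"
    and RS: "\<And>E. E \<in> S \<Longrightarrow> R E \<le> R F"
    and sep: "\<And>E. E \<in> S \<Longrightarrow> \<exists>i<n. R F < vnorm (X E i - X F i)"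
  shows "\<exists>e\<in>algebraic_functions \<iota> n. Q F (\<lambda>y. e y - 1) \<epsilon> \<and> (\<forall>E\<in>S. Q E e \<epsilon>)"
proof -
  interpret F: ultra_bound "Q F" by (rule Q[OF F])
  define \<delta> where "\<delta> = min \<epsilon> 1"
  have \<delta>: "0 < \<delta>" "\<delta> \<le> 1" "\<delta> \<le> \<epsilon>" using \<epsilon> by (auto simp: \<delta>_def)
  obtain t \<theta> where t: "t \<in> algebraic_functions \<iota> n" "\<theta> < 1" "Q F (\<lambda>y. t y - 1) \<theta>" "\<And>E. E \<in> S \<Longrightarrow> Q E t \<delta>"
    using separating_function[OF F S \<delta>(1) RS sep] by blast
  obtain k where k: "\<theta> ^ k < \<epsilon>" using real_arch_pow_inv[OF \<epsilon> t(2)] by blast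
  define e where "e y = 1 - (1 - t y) ^ k" for y
  have "e \<in> algebraic_functions \<iota> n"
    unfolding e_def by (intro algebraic_diff algebraic_power algebraic_const t)
  moreover have "Q F (\<lambda>y. e y - 1) \<epsilon>"
    using F.mono[OF F.uminus[OF F.power[OF F.diff_commute[OF t(3)], of k]]] k by (simp add: e_def)
  moreover have "Q E e \<epsilon>" if E: "E \<in> S" for E
  proof -
    interpret E: ultra_bound "Q E" using E S by (intro Q) auto
    have "Q E (\<lambda>y. (1 - t y) - 1) \<delta>" using E.uminus[OF t(4)[OF E]] by simp
    from E.mono[OF E.diff_commute[OF E.near_one_power[OF this \<delta>(2), of k]] \<delta>(3)]
    show ?thesis unfolding e_def .
  qed
  ultimately show ?thesis by blast
qed

text \<open>
  The polydiscs are glued in order of increasing radius, because an approximate indicator is only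
  available for a polydisc that is at least as large as the ones it is separated from.
\<close>

lemma simultaneous_approximation:
  assumes "finite S" "S \<subseteq> J" and P: "\<And>D. D \<in> J \<Longrightarrow> P D \<in> algebraic_functions \<iota> n"
    and sep: "\<And>D E. D \<in> J \<Longrightarrow> E \<in> J \<Longrightarrow> D \<noteq> E \<Longrightarrow> R E \<le> R D \<Longrightarrow> \<exists>i<n. R D < vnorm (X E i - X D i)"
    and \<epsilon>: "0 < \<epsilon>"
  shows "\<exists>g\<in>algebraic_functions \<iota> n. \<forall>D\<in>S. Q D (\<lambda>y. g y - P D y) \<epsilon>"
  using assms(1,2)
proof (induction S rule: finite_ranking_induct[where f = R])
  case empty
  then show ?case using algebraic_const by blast
next
  case (insert F S)
  obtain g where g: "g \<in> algebraic_functions \<iota> n" "\<And>D. D \<in> S \<Longrightarrow> Q D (\<lambda>y. g y - P D y) \<epsilon>"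
    using insert by auto
  have F: "F \<in> J" and S: "S \<subseteq> J" using insert.prems by auto
  interpret F: ultra_bound "Q F" by (rule Q[OF F])
  \<comment> \<open>The ranking induction does not guarantee a new element: \<open>F\<close> may
    already lie in \<open>S\<close>, and it cannot be separated from itself.\<close>
  show ?case
  proof (cases "F \<in> S")
    case True
    then show ?thesis using g by (intro bexI[of _ g]) auto
  next
    case False
    have "\<exists>K. Q D (\<lambda>y. g y - P F y) K" if "D \<in> J" for D
      by (rule algebraic_Q_bounded[OF that algebraic_diff[OF g(1) P[OF F]]])
    then obtain K where K: "\<And>D. D \<in> J \<Longrightarrow> Q D (\<lambda>y. g y - P F y) (K D)" by metis
    \<comment> \<open>The correction of \<open>g\<close> contains the factor \<open>g - P F\<close>,
      so the indicator must be accurate up to \<epsilon> divided by a common bound for this factor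
      on all discs involved.\<close>
    define L where "L = Max (insert 1 (K ` insert F S))"
    have L: "1 \<le> L" "\<And>D. D \<in> insert F S \<Longrightarrow> K D \<le> L"
      unfolding L_def using insert.hyps(1) by (intro Max_ge; auto)+
    define \<delta> where "\<delta> = \<epsilon> / L"
    have \<delta>: "0 < \<delta>" "L * \<delta> = \<epsilon>" using \<epsilon> L(1) by (auto simp: \<delta>_def)
    obtain e where e: "e \<in> algebraic_functions \<iota> n" "Q F (\<lambda>y. e y - 1) \<delta>" "\<And>E. E \<in> S \<Longrightarrow> Q E e \<delta>"
    proof -
      have "\<exists>i<n. R F < vnorm (X E i - X F i)" if "E \<in> S" for E
        by (rule sep[OF F subsetD[OF S that]]) (use that False insert.hyps(2) in auto)
      from approximate_indicator[OF F insert.hyps(1) S \<delta>(1) insert.hyps(2) this]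
      show ?thesis using that by auto
    qed
    \<comment> \<open>On \<open>F\<close>, where e is near 1, this moves \<open>g\<close> to
      \<open>P F\<close>, since g' - P F = (g - P F)(1 - e); where e is near 0 it hardly changes
      \<open>g\<close>.\<close>
    define g' where "g' y = g y + (g y - P F y) * (0 - e y)" for y
    have "g' \<in> algebraic_functions \<iota> n"
      unfolding g'_def using g(1) P[OF F] e(1)
      by (intro algebraic_add algebraic_mult algebraic_diff algebraic_const)
    moreover have "Q F (\<lambda>y. g' y - P F y) \<epsilon>"
      using F.mult_le[OF F.mono[OF K[OF F] L(2)] F.diff_commute[OF e(2)], of \<epsilon>] \<delta>
      by (simp add: g'_def algebra_simps)
    moreover have "Q D (\<lambda>y. g' y - P D y) \<epsilon>" if D: "D \<in> S" for D
    proof -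
      have "D \<in> J" using D S by auto
      then interpret D: ultra_bound "Q D" by (rule Q)
      have "Q D (\<lambda>y. (g y - P F y) * (0 - e y)) \<epsilon>"
        by (rule D.mult_le[OF D.mono[OF K[OF \<open>D \<in> J\<close>] L(2)] D.diff[OF D.zero e(3)[OF D]]])
          (use D \<delta> in auto)
      from D.add[OF g(2)[OF D] this] show ?thesis by (simp add: g'_def algebra_simps)
    qed
    ultimately show ?thesis by auto
  qed
qed

end

section \<open>Analytic solution of polynomial equations\<close>

lemma taylor_constant_mono:
  assumes "taylor_constant n x F D C" "C \<le> C'"
  shows "taylor_constant n x F D C'"
  unfolding taylor_constant_def
proof (intro conjI allI impI)
  show "0 \<le> C'" using assms by (auto simp: taylor_constant_def)
  fix N and \<rho> \<delta> :: real and h h' :: "(nat \<Rightarrow> 'a) \<Rightarrow> nat \<Rightarrow> 'a" assume inc: "bounded_increments n N \<rho> \<delta> h h'"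
  then have \<rho>: "0 \<le> \<rho>" "0 \<le> \<delta>" and "ultra_bound N" by (auto simp: bounded_increments_def)
  then interpret ultra_bound N by simp
  show "N (\<lambda>s. F (\<lambda>i. x i + h s i) - F (\<lambda>i. x i + h' s i)) (C' * \<delta>)"
    by (rule mono[OF taylor_constantD(1)[OF assms(1) inc]]) (use assms(2) \<rho> in \<open>intro mult_right_mono\<close>)
  show "N (\<lambda>s. F (\<lambda>i. x i + h s i) - F (\<lambda>i. x i + h' s i) - (\<Sum>j<n. D j * (h s j - h' s j))) (C' * \<rho> * \<delta>)"
    by (rule mono[OF taylor_constantD(2)[OF assms(1) inc]]) (use assms(2) \<rho> in \<open>intro mult_right_mono\<close>)
qed

lemma common_taylor_constant:
  assumes "finite K" "\<And>j. j \<in> K \<Longrightarrow> strictly_diff n x (F j) (D j)"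
  shows "\<exists>C\<ge>0. \<forall>j\<in>K. taylor_constant n x (F j) (D j) C"
proof -
  obtain C where C: "\<And>j. j \<in> K \<Longrightarrow> taylor_constant n x (F j) (D j) (C j)"
    using assms(2) unfolding strictly_diff_def by metis
  have "C j \<le> Max (insert 0 (C ` K))" if "j \<in> K" for j
    using assms(1) that by (intro Max_ge) auto
  moreover have "0 \<le> Max (insert 0 (C ` K))" using assms(1) by (intro Max_ge) auto
  ultimately show ?thesis using C taylor_constant_mono by blast
qed

lemma polydisc_recentre:
  assumes "u \<in> polydisc d c r"
  shows "polydisc d u r = polydisc d c r"
proof -
  have "vnorm (x i - c i) \<le> r \<longleftrightarrow> vnorm (x i - u i) \<le> r" if "i < d" for x i
  proof -
    have u: "vnorm (u i - c i) \<le> r" "vnorm (c i - u i) \<le> r"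
      using assms that by (auto simp: polydisc_def vnorm_minus_commute[of "c i"])
    show ?thesis using vnorm_diff_triangle u by metis
  qed
  then show ?thesis by (auto simp: polydisc_def)
qed

text \<open>
  The equations \<open>F\<^sub>j = 0\<close> for \<open>j \<in> K\<close> near a solution \<open>x\<close>, normalised such that the Jacobian is
  the identity in the columns \<open>K\<close> and has entries of norm at most \<open>1\<close>. They are solved for the
  coordinates in \<open>K\<close> by Newton's iteration \<open>h\<^sub>j \<mapsto> h\<^sub>j - F\<^sub>j (x + h)\<close>, carried out in the algebra of power
  series in the remaining coordinates.
\<close>

locale newton_system =
  fixes n d :: nat and K :: "nat set" and \<sigma> :: "nat \<Rightarrow> nat"
    and x :: "nat \<Rightarrow> 'q::{nonarch_field, complete_space}"
    and F :: "nat \<Rightarrow> (nat \<Rightarrow> 'q) \<Rightarrow> 'q" and D :: "nat \<Rightarrow> nat \<Rightarrow> 'q" and C r :: real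
  assumes K: "K \<subseteq> {..<n}" and \<sigma>: "bij_betw \<sigma> {..<d} ({..<n} - K)"
    and x: "x \<in> affine_points n"
    and taylor: "\<And>j. j \<in> K \<Longrightarrow> taylor_constant n x (F j) (D j) C" and C0: "0 \<le> C"
    and F_x: "\<And>j. j \<in> K \<Longrightarrow> F j x = 0"
    and D_K: "\<And>j l. j \<in> K \<Longrightarrow> l \<in> K \<Longrightarrow> D j l = (if l = j then 1 else 0)"
    and D_le: "\<And>j l. j \<in> K \<Longrightarrow> l < n \<Longrightarrow> vnorm (D j l) \<le> 1"
    and r: "0 < r" "r \<le> 1" "C * r \<le> 1 / 2"
begin

text \<open>The increments agree off \<open>K\<close> and the Jacobian is the identity in the
  columns \<open>K\<close>, so the linear term is exactly the difference of the j-th components.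
  Newton's map cancels it and leaves the Taylor remainder, of norm at most
  \<open>C * r * \<delta>\<close>.\<close>

lemma newton_contraction:
  assumes inc: "bounded_increments n N r \<delta> h h'" and j: "j \<in> K"
    and eq: "\<And>i s. i < n \<Longrightarrow> i \<notin> K \<Longrightarrow> h s i = h' s i"
  shows "N (\<lambda>s. (h s j - F j (\<lambda>i. x i + h s i)) - (h' s j - F j (\<lambda>i. x i + h' s i))) (\<delta> / 2)"
proof -
  have \<delta>: "0 \<le> \<delta>" and "ultra_bound N" using inc by (auto simp: bounded_increments_def)
  then interpret ultra_bound N by simp
  have "D j l * (h s l - h' s l) = (if l = j then h s l - h' s l else 0)" if "l < n" for l s
    using eq[OF that, of s] D_K[OF j, of l] j by (cases "l \<in> K") auto
  then have "(\<Sum>l<n. D j l * (h s l - h' s l)) = (\<Sum>l<n. if l = j then h s l - h' s l else 0)" for s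
    by (intro sum.cong) auto
  then have sum: "(\<Sum>l<n. D j l * (h s l - h' s l)) = h s j - h' s j" for s
    using j K by (auto simp: subset_iff)
  have "C * r * \<delta> \<le> \<delta> / 2" using mult_right_mono[OF r(3) \<delta>] by simp
  from uminus[OF mono[OF taylor_constantD(2)[OF taylor[OF j] inc] this]]
  have "N (\<lambda>s. - (F j (\<lambda>i. x i + h s i) - F j (\<lambda>i. x i + h' s i) - (h s j - h' s j))) (\<delta> / 2)"
    by (simp only: sum)
  then show ?thesis by (simp add: algebra_simps)
qed

text \<open>A solution is a fixed point of Newton's map. Points are regarded as constant increments
  under the supremum norm, and the contraction can be applied to a pair of solutions indefinitely,
  halving the bound on their distance each time.\<close>

lemma newton_unique:
  assumes y: "y \<in> polydisc n x r" "\<And>j. j \<in> K \<Longrightarrow> F j y = 0"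
    and y': "y' \<in> polydisc n x r" "\<And>j. j \<in> K \<Longrightarrow> F j y' = 0"
    and eq: "\<And>k. k < d \<Longrightarrow> y (\<sigma> k) = y' (\<sigma> k)"
  shows "y = y'"
proof -
  let ?N = "\<lambda>(u :: (nat \<Rightarrow> 'q) \<Rightarrow> 'q) C. \<forall>s. vnorm (u s) \<le> C"
  have off: "y i = y' i" if i: "i < n" "i \<notin> K" for i
  proof -
    have "i \<in> \<sigma> ` {..<d}" using i \<sigma> by (simp add: bij_betw_def)
    then show ?thesis using eq by auto
  qed
  have yx: "vnorm (y i - x i) \<le> r" "vnorm (y' i - x i) \<le> r" if "i < n" for i
    using y(1) y'(1) that by (auto simp: polydisc_def)
  have bound: "\<forall>i<n. vnorm (y i - y' i) \<le> r * (1 / 2) ^ k" for k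
  proof (induction k)
    case 0
    then show ?case using yx vnorm_diff_triangle vnorm_minus_commute by (metis mult.right_neutral power_0)
  next
    case (Suc k)
    show ?case
    proof (intro allI impI)
      fix i assume i: "i < n"
      show "vnorm (y i - y' i) \<le> r * (1 / 2) ^ Suc k"
      proof (cases "i \<in> K")
        case True
        have inc: "bounded_increments n ?N r (r * (1 / 2) ^ k) (\<lambda>_ i. y i - x i) (\<lambda>_ i. y' i - x i)"
          using yx Suc.IH r ultra_bound_sup by (simp add: bounded_increments_def)
        from newton_contraction[OF inc True] off show ?thesis
          using y(2)[OF True] y'(2)[OF True] by (simp add: algebra_simps)
      qed (use off[OF i] r in simp)
    qed
  qed
  show "y = y'"
  proof
    fix i
    show "y i = y' i"
    proof (cases "i < n")
      case True
      have "(\<lambda>k. r * (1 / 2) ^ k) \<longlonglongrightarrow> 0" by real_asymp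
      then have "vnorm (y i - y' i) \<le> 0"
        by (rule LIMSEQ_le_const) (use bound True in blast)
      then show ?thesis using vnorm_ge_0[of "y i - y' i"] by (simp del: vnorm_ge_0)
    next
      case False
      then show ?thesis using y(1) y'(1) by (auto simp: polydisc_def affine_points_def)
    qed
  qed
qed

definition start :: "(nat \<Rightarrow> 'q) \<Rightarrow> nat \<Rightarrow> 'q" where
  "start s i = (if i < n \<and> i \<notin> K then s (inv_into {..<d} \<sigma> i) - x i else 0)"

primrec iterate :: "nat \<Rightarrow> (nat \<Rightarrow> 'q) \<Rightarrow> nat \<Rightarrow> 'q" where
  "iterate 0 = start"
| "iterate (Suc m) = (\<lambda>s i. if i \<in> K then iterate m s i - F i (\<lambda>i. x i + iterate m s i) else iterate m s i)"

lemma iterate_off: "i \<notin> K \<Longrightarrow> iterate m s i = start s i"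
  by (induction m) auto

lemma start_\<sigma>: "k < d \<Longrightarrow> start s (\<sigma> k) = s k - x (\<sigma> k)"
  using \<sigma> bij_betw_apply[OF \<sigma>, of k] by (simp add: start_def bij_betw_def)

text \<open>The series are centred at an arbitrary \<open>u\<close> of the disc, since analyticity
  of the inverse chart has to be shown at every point and not only at the projection of
  \<open>x\<close>.\<close>

lemma newton_solution:
  assumes u: "u \<in> polydisc d (\<lambda>k. if k < d then x (\<sigma> k) else 0) r" (is "u \<in> polydisc d ?c r")
  shows "\<exists>H. (\<forall>i<n. gauss_bounded (\<lambda>t. t) d u r (polydisc d u r) (\<lambda>s. H s i) r) \<and>
    (\<forall>s\<in>polydisc d u r. (\<lambda>i. x i + H s i) \<in> affine_points n \<and> (\<forall>j\<in>K. F j (\<lambda>i. x i + H s i) = 0) \<and>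
      (\<forall>k<d. x (\<sigma> k) + H s (\<sigma> k) = s k))"
proof -
  define N where "N = gauss_bounded (\<lambda>t. t :: 'q) d u r (polydisc d u r)"
  have N: "ultra_bound N" unfolding N_def by (rule id_emb.ultra_bound_gauss[OF r(1)]) simp
  interpret ultra_bound N by (rule N)
  let ?h = "iterate"
  have N_start: "N (\<lambda>s. start s i) r" if "i < n" for i
  proof (cases "i \<in> K")
    case True
    then show ?thesis using zero[of r] r by (simp add: start_def)
  next
    case False
    then have "i \<in> \<sigma> ` {..<d}" using that \<sigma> by (simp add: bij_betw_def)
    then obtain k where k: "k < d" "i = \<sigma> k" by auto
    have "vnorm (u k - x (\<sigma> k)) \<le> r" using u k by (auto simp: polydisc_def)
    from add[OF id_emb.gauss_bounded_coord[OF r(1) k(1), of u "polydisc d u r", folded N_def] const[OF this]]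
    show ?thesis by (simp add: k start_\<sigma>)
  qed
  \<comment> \<open>Why the iterates keep norm at most \<open>r\<close>: the value of
    \<open>F i\<close> at \<open>x + h\<close> is a linear part, of norm at most \<open>r\<close>
    because the entries of the Jacobian have norm at most 1, plus a remainder of norm at most
    \<open>C * r * r\<close>. The halving of the steps is the contraction.\<close>
  have iter: "(\<forall>i<n. N (\<lambda>s. ?h m s i) r) \<and> (\<forall>i<n. N (\<lambda>s. ?h (Suc m) s i - ?h m s i) (r * (1 / 2) ^ m))" for m
  proof (induction m)
    have bounded_Suc: "\<forall>i<n. N (\<lambda>s. ?h (Suc m) s i) r" if IH: "\<forall>i<n. N (\<lambda>s. ?h m s i) r" for m
    proof (intro allI impI)
      fix i assume i: "i < n"
      show "N (\<lambda>s. ?h (Suc m) s i) r"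
      proof (cases "i \<in> K")
        case True
        have "bounded_increments n N r r (?h m) (\<lambda>_ _. 0)"
          using IH N r zero[of r] by (simp add: bounded_increments_def)
        from taylor_constantD(2)[OF taylor[OF True] this]
        have "N (\<lambda>s. F i (\<lambda>i. x i + ?h m s i) - (\<Sum>l<n. D i l * ?h m s l)) (C * r * r)"
          using F_x[OF True] by simp
        moreover have "C * r * r \<le> r" using mult_right_mono[OF r(3), of r] r by simp
        ultimately have "N (\<lambda>s. F i (\<lambda>i. x i + ?h m s i) - (\<Sum>l<n. D i l * ?h m s l)) r"
          by (rule mono)
        moreover have "N (\<lambda>s. \<Sum>l<n. D i l * ?h m s l) r"
          using IH r D_le[OF True] by (intro sum cmult_le) auto
        ultimately have "N (\<lambda>s. F i (\<lambda>i. x i + ?h m s i)) r"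
          using add[of _ r "\<lambda>s. \<Sum>l<n. D i l * ?h m s l"] by fastforce
        from diff[OF IH[rule_format, OF i] this] show ?thesis using True by simp
      qed (use IH i in simp)
    qed
    {
      case 0
      show ?case using bounded_Suc[of 0] N_start diff by auto
    next
      case (Suc m)
      have 1: "\<forall>i<n. N (\<lambda>s. ?h (Suc m) s i) r" using bounded_Suc Suc by blast
      have inc: "bounded_increments n N r (r * (1 / 2) ^ m) (?h (Suc m)) (?h m)"
        using Suc 1 N r by (simp add: bounded_increments_def)
      have "N (\<lambda>s. ?h (Suc (Suc m)) s i - ?h (Suc m) s i) (r * (1 / 2) ^ Suc m)" if i: "i < n" for i
      proof (cases "i \<in> K")
        case True
        from newton_contraction[OF inc True] show ?thesis
          using True by (simp add: iterate_off)
      qed (use zero r in simp)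
      then show ?case using 1 by blast
    }
  qed
  have "\<exists>U. \<forall>m. N (\<lambda>s. U s - (\<Sum>k<m. ?h (Suc k) s i - ?h k s i)) (r * (1 / 2) ^ m)" if i: "i < n" for i
    unfolding N_def
  proof (rule gauss_bounded_complete[OF r(1) order_refl])
    show "gauss_bounded (\<lambda>t. t) d u r (polydisc d u r) (\<lambda>s. ?h (Suc k) s i - ?h k s i) (r * (1 / 2) ^ k)" for k
      using iter[of k] i unfolding N_def by blast
    show "decseq (\<lambda>m. r * (1 / 2) ^ m)"
      using r by (intro decseq_SucI) (simp add: field_simps)
    show "(\<lambda>m. r * (1 / 2) ^ m) \<longlonglongrightarrow> 0" by real_asymp
  qed
  then have "\<forall>i\<in>{..<n}. \<exists>U. \<forall>m. N (\<lambda>s. U s - (\<Sum>k<m. ?h (Suc k) s i - ?h k s i)) (r * (1 / 2) ^ m)"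
    by (simp only: lessThan_iff Ball_def) (rule allI, rule impI)
  from bchoice[OF this] obtain U
    where U': "\<forall>i\<in>{..<n}. \<forall>m. N (\<lambda>s. U i s - (\<Sum>k<m. ?h (Suc k) s i - ?h k s i)) (r * (1 / 2) ^ m)" ..
  have U: "N (\<lambda>s. U i s - (\<Sum>k<m. ?h (Suc k) s i - ?h k s i)) (r * (1 / 2) ^ m)" if "i < n" for i m
    by (rule U'[rule_format]) (use that in simp)
  \<comment> \<open>\<open>U\<close> is the limit of the telescoping series of steps, so the start
    has to be added back. Off \<open>K\<close> the iteration is stationary; taking the start itself
    there keeps the free coordinates exact and those from \<open>n\<close> on equal to 0.\<close>
  define H where "H s i = (if i \<in> K then U i s + start s i else start s i)" for s i
  have HN: "N (\<lambda>s. H s i - ?h m s i) (r * (1 / 2) ^ m)" if i: "i < n" for i m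
  proof (cases "i \<in> K")
    case True
    have tele: "(\<Sum>k<m. ?h (Suc k) s i - ?h k s i) = ?h m s i - start s i" for s
      by (induction m) auto
    show ?thesis using U[OF i, of m, unfolded tele] True by (simp add: H_def algebra_simps)
  qed (use r zero in \<open>simp add: H_def iterate_off\<close>)
  have HN0: "N (\<lambda>s. H s i) r" if i: "i < n" for i
    using add[OF HN[OF i, of 0, simplified] N_start[OF i]] by simp
  have zero: "F j (\<lambda>i. x i + H s i) = 0" if j: "j \<in> K" and s: "s \<in> polydisc d u r" for j s
  proof -
    have jn: "j < n" using j K by auto
    \<comment> \<open>The value of \<open>F j\<close> at the m-th iterate is minus the m-th Newton
      step, hence small. \<open>C + 1\<close> covers both the Lipschitz constant and the factor 1 of
      that step.\<close>
    have "vnorm (F j (\<lambda>i. x i + H s i)) \<le> (C + 1) * (r * (1 / 2) ^ m)" for m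
    proof -
      define \<delta> where "\<delta> = r * (1 / 2) ^ m"
      have \<delta>: "0 \<le> \<delta>" using r by (simp add: \<delta>_def)
      have inc: "bounded_increments n N r \<delta> H (?h m)"
        using HN HN0 iter[of m] N r \<delta> by (simp add: bounded_increments_def \<delta>_def)
      have "N (\<lambda>s. F j (\<lambda>i. x i + H s i) - F j (\<lambda>i. x i + ?h m s i)) ((C + 1) * \<delta>)"
        by (rule mono[OF taylor_constantD(1)[OF taylor[OF j] inc]]) (use \<delta> in \<open>simp add: distrib_right\<close>)
      moreover have "N (\<lambda>s. - (?h (Suc m) s j - ?h m s j)) ((C + 1) * \<delta>)"
        by (rule mono[OF uminus[OF conjunct2[OF iter[of m], rule_format, OF jn, folded \<delta>_def]]])
          (use \<delta> C0 in \<open>simp add: distrib_right\<close>)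
      then have "N (\<lambda>s. F j (\<lambda>i. x i + ?h m s i)) ((C + 1) * \<delta>)" using j by simp
      ultimately have "N (\<lambda>s. F j (\<lambda>i. x i + H s i)) ((C + 1) * \<delta>)"
        using add by fastforce
      then show ?thesis unfolding N_def \<delta>_def by (rule id_emb.gauss_bounded_vnorm_le) (rule s)+
    qed
    moreover have "(\<lambda>m. (C + 1) * (r * (1 / 2) ^ m)) \<longlonglongrightarrow> 0" by real_asymp
    ultimately have "vnorm (F j (\<lambda>i. x i + H s i)) \<le> 0"
      using LIMSEQ_le_const by blast
    then show ?thesis using vnorm_ge_0[of "F j (\<lambda>i. x i + H s i)"] by (simp del: vnorm_ge_0)
  qed
  have "(\<lambda>i. x i + H s i) \<in> affine_points n" for s
    using x K by (auto simp: affine_points_def H_def start_def)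
  moreover have "x (\<sigma> k) + H s (\<sigma> k) = s k" if "k < d" for k s
    using bij_betw_apply[OF \<sigma>, of k] that by (simp add: H_def start_\<sigma>)
  ultimately show ?thesis
    using HN0 zero unfolding N_def by (intro exI[of _ H]) blast
qed

end

subsection \<open>Normalised local equations\<close>

lemma carrier_poly_ring_sum:
  "(\<And>a. a \<in> A \<Longrightarrow> f a \<in> carrier (poly_ring n)) \<Longrightarrow> sum f A \<in> carrier (poly_ring n)"
proof (induction A rule: infinite_finite_induct)
  case (insert a A)
  then show ?case using keys_add[of "f a" "sum f A"] by (auto simp: poly_ring_simps(1))
qed (simp_all add: poly_ring_simps(1))

lemma carrier_poly_ring_prod:
  "(\<And>a. a \<in> A \<Longrightarrow> f a \<in> carrier (poly_ring n)) \<Longrightarrow> prod f A \<in> carrier (poly_ring n)"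
proof (induction A rule: infinite_finite_induct)
  case (insert a A)
  then show ?case by (simp add: poly_ring_mult_closed)
qed (simp_all add: poly_ring_simps(1))

lemma carrier_poly_ring_deriv:
  assumes "f \<in> carrier (poly_ring n)"
  shows "mpoly_deriv i f \<in> carrier (poly_ring n)"
  unfolding mpoly_deriv_def
proof (rule carrier_poly_ring_sum)
  fix \<alpha> assume "\<alpha> \<in> Poly_Mapping.keys f"
  then have "\<alpha> \<in> multi_indices n" using assms by (auto simp: poly_ring_simps(1))
  then have "\<alpha> - Poly_Mapping.single i 1 \<in> multi_indices n"
    by (intro multi_indicesI) (simp add: lookup_minus lookup_notin_multi_indices)
  then show "Poly_Mapping.single (\<alpha> - Poly_Mapping.single i 1) (Poly_Mapping.lookup f \<alpha> * of_nat (Poly_Mapping.lookup \<alpha> i))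
      \<in> carrier (poly_ring n)"
    by (simp add: poly_ring_simps(1))
qed

lemma carrier_poly_ring_det:
  assumes "\<And>i j. i < c \<Longrightarrow> j < c \<Longrightarrow> m i j \<in> carrier (poly_ring n)"
  shows "Determinant.det (Matrix.mat c c (\<lambda>(i, j). m i j)) \<in> carrier (poly_ring n)"
proof -
  have "signof p * (\<Prod>i = 0..<c. Matrix.mat c c (\<lambda>(i, j). m i j) $$ (i, p i)) \<in> carrier (poly_ring n)"
    if p: "p permutes {0..<c}" for p
  proof (rule poly_ring_mult_closed)
    show "signof p \<in> carrier (poly_ring n)" by (simp add: sign_def poly_ring_simps(1))
    show "(\<Prod>i = 0..<c. Matrix.mat c c (\<lambda>(i, j). m i j) $$ (i, p i)) \<in> carrier (poly_ring n)"
      by (rule carrier_poly_ring_prod) (use assms permutes_in_image[OF p] in auto)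
  qed
  then show ?thesis
    unfolding det_def'[OF mat_carrier] by (intro carrier_poly_ring_sum) simp
qed

lemma mpoly_value_det:
  "mpoly_value (Determinant.det (Matrix.mat c c (\<lambda>(i, j). m i j))) x
    = Determinant.det (Matrix.mat c c (\<lambda>(i, j). mpoly_value (m i j) x))"
proof -
  interpret comm_ring_hom "\<lambda>f. mpoly_value f x"
    by standard (simp_all add: mpoly_value_add mpoly_value_mult)
  have "map_mat (\<lambda>f. mpoly_value f x) (Matrix.mat c c (\<lambda>(i, j). m i j)) = Matrix.mat c c (\<lambda>(i, j). mpoly_value (m i j) x)"
    by (rule eq_matI) auto
  then show ?thesis by (metis hom_det)
qed

text \<open>
  Choosing the minor of largest norm makes all entries of the row-reduced matrix have norm at
  most \<open>1\<close>, by Cramer's rule.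
\<close>

lemma maximal_minor:
  fixes J :: "nat \<Rightarrow> nat \<Rightarrow> 'q::nonarch_field"
  assumes "\<sigma> ` {..<c} \<subseteq> {..<n}" "Determinant.det (Matrix.mat c c (\<lambda>(i, j). J i (\<sigma> j))) \<noteq> 0"
  obtains \<tau> B where "\<tau> ` {..<c} \<subseteq> {..<n}" "inj_on \<tau> {..<c}"
    "\<And>k m. k < c \<Longrightarrow> m < c \<Longrightarrow> (\<Sum>i<c. B k i * J i (\<tau> m)) = (if k = m then 1 else 0)"
    "\<And>k m. k < c \<Longrightarrow> m < c \<Longrightarrow> (\<Sum>i<c. J k (\<tau> i) * B i m) = (if k = m then 1 else 0)"
    "\<And>k l. k < c \<Longrightarrow> l < n \<Longrightarrow> vnorm (\<Sum>i<c. B k i * J i l) \<le> 1"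
proof -
  define A where "A \<tau> = Matrix.mat c c (\<lambda>(i, j). J i (\<tau> j))" for \<tau>
  have A_carr: "A \<tau> \<in> carrier_mat c c" for \<tau> by (simp add: A_def)
  have A_cong: "A \<tau> = A \<tau>'" if "\<And>j. j < c \<Longrightarrow> \<tau> j = \<tau>' j" for \<tau> \<tau>'
    unfolding A_def by (rule eq_matI) (auto simp: that)
  define T where "T = {..<c} \<rightarrow>\<^sub>E {..<n}"
  define S where "S = (\<lambda>\<tau>. vnorm (Determinant.det (A \<tau>))) ` T"
  have "finite T" unfolding T_def by (intro finite_PiE) auto
  then have S: "finite S" by (simp add: S_def)
  have \<sigma>S: "vnorm (Determinant.det (A \<tau>)) \<in> S" if "\<tau> ` {..<c} \<subseteq> {..<n}" for \<tau>
  proof -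
    have "restrict \<tau> {..<c} \<in> T" using that by (auto simp: T_def)
    moreover have "A (restrict \<tau> {..<c}) = A \<tau>" by (rule A_cong) simp
    ultimately show ?thesis unfolding S_def by (metis image_eqI)
  qed
  then have "S \<noteq> {}" using assms(1) by auto
  from Max_in[OF S this] obtain \<tau> where \<tau>: "\<tau> \<in> T" "vnorm (Determinant.det (A \<tau>)) = Max S"
    by (auto simp: S_def)
  have \<tau>_n: "\<tau> ` {..<c} \<subseteq> {..<n}" using \<tau>(1) by (auto simp: T_def PiE_iff)
  have "0 < vnorm (Determinant.det (A \<sigma>))" using assms(2) by (simp add: A_def less_le)
  also have "\<dots> \<le> Max S" using \<sigma>S[OF assms(1)] S by simp
  finally have det_pos: "0 < vnorm (Determinant.det (A \<tau>))" using \<tau>(2) by simp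
  then have det: "Determinant.det (A \<tau>) \<noteq> 0" by auto
  define Bm where "Bm = inverse (Determinant.det (A \<tau>)) \<cdot>\<^sub>m adj_mat (A \<tau>)"
  have adj: "adj_mat (A \<tau>) \<in> carrier_mat c c" by (rule adj_mat(1)[OF A_carr])
  have Bm: "Bm \<in> carrier_mat c c" unfolding Bm_def using adj by simp
  have AB: "A \<tau> * Bm = 1\<^sub>m c"
    unfolding Bm_def mult_smult_distrib[OF A_carr adj] adj_mat(2)[OF A_carr] using det
    by (intro eq_matI) auto
  have BA: "Bm * A \<tau> = 1\<^sub>m c"
    unfolding Bm_def mult_smult_assoc_mat[OF adj A_carr] adj_mat(3)[OF A_carr] using det
    by (intro eq_matI) auto
  define B where "B k i = Bm $$ (k, i)" for k i
  have sums: "(\<Sum>i<c. B k i * J i (\<tau> m)) = (if k = m then 1 else 0)"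
    "(\<Sum>i<c. J k (\<tau> i) * B i m) = (if k = m then 1 else 0)" if "k < c" "m < c" for k m
  proof -
    have "(Bm * A \<tau>) $$ (k, m) = (\<Sum>i<c. B k i * J i (\<tau> m))"
      using Bm that by (auto simp: A_def B_def scalar_prod_def lessThan_atLeast0 intro!: sum.cong)
    then show "(\<Sum>i<c. B k i * J i (\<tau> m)) = (if k = m then 1 else 0)"
      unfolding BA using that by simp
    have "(A \<tau> * Bm) $$ (k, m) = (\<Sum>i<c. J k (\<tau> i) * B i m)"
      using Bm that by (auto simp: A_def B_def scalar_prod_def lessThan_atLeast0 intro!: sum.cong)
    then show "(\<Sum>i<c. J k (\<tau> i) * B i m) = (if k = m then 1 else 0)"
      unfolding AB using that by simp
  qed
  show ?thesis
  proof (rule that[OF \<tau>_n _ sums])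
    show "inj_on \<tau> {..<c}"
    proof (rule inj_onI)
      fix k m assume km: "k \<in> {..<c}" "m \<in> {..<c}" "\<tau> k = \<tau> m"
      then have "(if k = k then 1 else 0) = (if k = m then 1 else (0 :: 'q))"
        using sums(1)[of k k] sums(1)[of k m] by simp
      then show "k = m" by (simp split: if_splits)
    qed
    fix k l assume k: "k < c" and l: "l < n"
    \<comment> \<open>By Cramer's rule entry \<open>k\<close> of \<open>Bm\<close> applied to column
      \<open>l\<close> is the quotient of the minor with columns \<open>\<tau>(k := l)\<close> by
      the maximal one.\<close>
    define v where "v = Matrix.vec c (\<lambda>i. J i l)"
    have v: "v \<in> carrier_vec c" by (simp add: v_def)
    have "A \<tau> *\<^sub>v (Bm *\<^sub>v v) = (A \<tau> * Bm) *\<^sub>v v"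
      by (rule assoc_mult_mat_vec[symmetric, OF A_carr Bm v])
    also have "\<dots> = v" unfolding AB using v by simp
    finally have Av: "A \<tau> *\<^sub>v (Bm *\<^sub>v v) = v" .
    have "Determinant.det (replace_col (A \<tau>) (A \<tau> *\<^sub>v (Bm *\<^sub>v v)) k) = (Bm *\<^sub>v v) $ k * Determinant.det (A \<tau>)"
      by (rule cramer_lemma_mat[OF A_carr _ k]) (use Bm v in simp)
    moreover have "replace_col (A \<tau>) v k = A (\<tau>(k := l))"
      by (rule eq_matI) (auto simp: replace_col_def A_def v_def)
    moreover have "(Bm *\<^sub>v v) $ k = (\<Sum>i<c. B k i * J i l)"
      using Bm k by (auto simp: B_def v_def scalar_prod_def lessThan_atLeast0 intro!: sum.cong)
    ultimately have "vnorm (\<Sum>i<c. B k i * J i l) * vnorm (Determinant.det (A \<tau>))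
        = vnorm (Determinant.det (A (\<tau>(k := l))))"
      by (simp add: Av vnorm_mult)
    also have "\<dots> \<le> 1 * vnorm (Determinant.det (A \<tau>))"
      unfolding \<tau>(2) mult_1 by (rule Max_ge[OF S \<sigma>S]) (use \<tau>_n l in auto)
    finally show "vnorm (\<Sum>i<c. B k i * J i l) \<le> 1"
      using det_pos by (rule mult_right_le_imp_le)
  qed auto
qed

text \<open>Near \<open>x\<close> the localising polynomial has no zeros, so vanishing of the ideal
  reduces to vanishing of the chosen generators. Multiplying these by the inverse of the matrix of
  the maximal minor normalises the Jacobian without changing the zero set.\<close>

lemma local_equations:
  fixes I :: "'q::nonarch_field mpoly set"
  assumes I: "ideal I (poly_ring n)" and smooth: "smooth_scheme n I" and x: "x \<in> rational_points n I"
  obtains K F D R where "K \<subseteq> {..<n}" "\<And>j. j \<in> K \<Longrightarrow> strictly_diff n x (F j) (D j)"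
    "\<And>j. j \<in> K \<Longrightarrow> F j x = 0"
    "\<And>j l. j \<in> K \<Longrightarrow> l \<in> K \<Longrightarrow> D j l = (if l = j then 1 else 0)"
    "\<And>j l. j \<in> K \<Longrightarrow> l < n \<Longrightarrow> vnorm (D j l) \<le> 1"
    "0 < R" "\<And>y. y \<in> polydisc n x R \<Longrightarrow> y \<in> rational_points n I \<longleftrightarrow> (\<forall>j\<in>K. F j y = 0)"
proof -
  have I_carr: "I \<subseteq> carrier (poly_ring n)"
    using additive_subgroup.a_subset[OF ideal.axioms(1)[OF I]] .
  have "point_ideal n x \<in> scheme_points n I"
    unfolding scheme_points_def using x I_carr primeideal_point_ideal
    by (auto simp: point_ideal_def rational_points_def)
  from bspec[OF smooth[unfolded smooth_scheme_def] this] obtain c f \<sigma> g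
    where "g \<in> carrier (poly_ring n) - point_ideal n x" and f: "f ` {..<c} \<subseteq> I"
      and "\<forall>h\<in>I. \<exists>k. g ^ k * h \<in> genideal (poly_ring n) (f ` {..<c})"
      and \<sigma>: "\<sigma> ` {..<c} \<subseteq> {..<n}"
      and det: "Determinant.det (Matrix.mat c c (\<lambda>(i, j). mpoly_deriv (\<sigma> j) (f i))) \<notin> point_ideal n x"
    by (elim exE bexE conjE)
  then have g: "g \<in> carrier (poly_ring n)" "g \<notin> point_ideal n x"
    and gen: "\<And>h. h \<in> I \<Longrightarrow> \<exists>k. g ^ k * h \<in> genideal (poly_ring n) (f ` {..<c})"
    by auto
  have f_carr: "f i \<in> carrier (poly_ring n)" if "i < c" for i using f I_carr that by auto
  define J where "J i l = mpoly_value (mpoly_deriv l (f i)) x" for i l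
  \<comment> \<open>\<open>point_ideal\<close> contains only elements of the carrier, so the
    determinant has to be in the carrier before its absence from the ideal means a nonzero
    value.\<close>
  have "Determinant.det (Matrix.mat c c (\<lambda>(i, j). mpoly_deriv (\<sigma> j) (f i))) \<in> carrier (poly_ring n)"
    by (intro carrier_poly_ring_det carrier_poly_ring_deriv f_carr)
  with det have det': "Determinant.det (Matrix.mat c c (\<lambda>(i, j). J i (\<sigma> j))) \<noteq> 0"
    by (simp add: point_ideal_def mpoly_value_det J_def)
  obtain \<tau> B where \<tau>: "\<tau> ` {..<c} \<subseteq> {..<n}" "inj_on \<tau> {..<c}"
    and BJ: "\<And>k m. k < c \<Longrightarrow> m < c \<Longrightarrow> (\<Sum>i<c. B k i * J i (\<tau> m)) = (if k = m then 1 else 0)"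
    and JB: "\<And>k m. k < c \<Longrightarrow> m < c \<Longrightarrow> (\<Sum>i<c. J k (\<tau> i) * B i m) = (if k = m then 1 else 0)"
    and B_le: "\<And>k l. k < c \<Longrightarrow> l < n \<Longrightarrow> vnorm (\<Sum>i<c. B k i * J i l) \<le> 1"
    by (rule maximal_minor[OF \<sigma> det']) (rule that)
  \<comment> \<open>The reduced equations are indexed by the pivot columns instead of by rows, so
    that an equation and the coordinate it determines share an index; \<kappa> recovers the
    row.\<close>
  define K where "K = \<tau> ` {..<c}"
  define \<kappa> where "\<kappa> = inv_into {..<c} \<tau>"
  have \<kappa>: "\<kappa> j < c" "\<tau> (\<kappa> j) = j" if "j \<in> K" for j
    using that inv_into_into[of j \<tau> "{..<c}"] f_inv_into_f[of j \<tau> "{..<c}"] by (auto simp: K_def \<kappa>_def)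
  have \<kappa>_\<tau>: "\<kappa> (\<tau> k) = k" "\<tau> k \<in> K" if "k < c" for k
    using that \<tau>(2) by (auto simp: \<kappa>_def K_def)
  define F where "F j y = (\<Sum>i<c. B (\<kappa> j) i * mpoly_value (f i) y)" for j y
  define D where "D j l = (\<Sum>i<c. B (\<kappa> j) i * J i l)" for j l
  \<comment> \<open>The reduction is reversible: \<open>JB\<close> expresses the original generators
    through the reduced ones.\<close>
  have zero_iff: "(\<forall>j\<in>K. F j y = 0) \<longleftrightarrow> (\<forall>i<c. mpoly_value (f i) y = 0)" for y
  proof
    assume F: "\<forall>j\<in>K. F j y = 0"
    show "\<forall>i<c. mpoly_value (f i) y = 0"
    proof (intro allI impI)
      fix i assume i: "i < c"
      have "mpoly_value (f i) y = (\<Sum>m<c. (if i = m then 1 else 0) * mpoly_value (f m) y)"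
        using i by (simp add: if_distrib[of "\<lambda>a. a * _"] cong: if_cong)
      also have "\<dots> = (\<Sum>m<c. (\<Sum>k<c. J i (\<tau> k) * B k m) * mpoly_value (f m) y)"
        using JB[OF i] by (intro sum.cong) auto
      also have "\<dots> = (\<Sum>k<c. J i (\<tau> k) * F (\<tau> k) y)"
        unfolding sum_distrib_right F_def sum_distrib_left
        by (subst sum.swap) (auto simp: \<kappa>_\<tau> mult.assoc intro!: sum.cong)
      also have "\<dots> = 0" using F \<kappa>_\<tau> by (intro sum.neutral) auto
      finally show "mpoly_value (f i) y = 0" .
    qed
  qed (simp add: F_def)
  have gx: "mpoly_value g x \<noteq> 0" using g by (auto simp: point_ideal_def)
  obtain C where C: "taylor_constant n x (mpoly_value g) (\<lambda>j. mpoly_value (mpoly_deriv j g) x) C"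
    using strictly_diff_mpoly[OF g(1), of x] unfolding strictly_diff_def ..
  then have C0: "0 \<le> C" by (simp add: taylor_constant_def)
  \<comment> \<open>On this polydisc \<open>g\<close> differs from its value at \<open>x\<close> by
    at most half the norm of that value, so it cannot vanish. Increments are required to be at most
    1, and \<open>C + 1\<close> keeps the divisor positive.\<close>
  define R where "R = min 1 (vnorm (mpoly_value g x) / (2 * (C + 1)))"
  have "0 < vnorm (mpoly_value g x)" using gx by (simp add: less_le)
  then have R: "0 < R" "R \<le> 1" using C0 by (auto simp: R_def)
  have g_nz: "mpoly_value g y \<noteq> 0" if y: "y \<in> polydisc n x R" for y
  proof
    assume gy: "mpoly_value g y = 0"
    have "bounded_increments n (\<lambda>u C. \<forall>s. vnorm (u s) \<le> C) R R (\<lambda>_ i. y i - x i) (\<lambda>_ _. 0)"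
      using y R ultra_bound_sup by (auto simp: bounded_increments_def polydisc_def)
    from taylor_constantD(1)[OF C this] have "vnorm (mpoly_value g x) \<le> C * R"
      by (simp add: gy)
    also have "\<dots> \<le> (C + 1) * (vnorm (mpoly_value g x) / (2 * (C + 1)))"
      using C0 R by (intro mult_mono) (auto simp: R_def)
    also have "\<dots> = vnorm (mpoly_value g x) / 2" using C0 by (simp add: field_simps)
    finally show False using gx vnorm_ge_0[of "mpoly_value g x"] by (simp add: less_le)
  qed
  have f_zero: "mpoly_value (f i) y = 0" if "i < c" "y \<in> rational_points n I" for i y
    using that f by (auto simp: rational_points_def)
  show ?thesis
  proof (rule that[of K F D R])
    show "K \<subseteq> {..<n}" using \<tau>(1) by (simp add: K_def)
    show "strictly_diff n x (F j) (D j)" if "j \<in> K" for j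
      unfolding F_def[abs_def] D_def[abs_def] J_def
      by (intro strictly_diff_sum strictly_diff_cmult strictly_diff_mpoly f_carr) auto
    show "F j x = 0" if "j \<in> K" for j using zero_iff[of x] f_zero x that by blast
    show "D j l = (if l = j then 1 else 0)" if "j \<in> K" "l \<in> K" for j l
    proof -
      have "\<kappa> j = \<kappa> l \<longleftrightarrow> l = j" using \<kappa>(2)[OF that(1)] \<kappa>(2)[OF that(2)] by metis
      then show ?thesis
        using BJ[OF \<kappa>(1)[OF that(1)] \<kappa>(1)[OF that(2)]] \<kappa>(2)[OF that(2)] by (simp add: D_def)
    qed
    show "vnorm (D j l) \<le> 1" if "j \<in> K" "l < n" for j l
      unfolding D_def by (rule B_le[OF \<kappa>(1)[OF that(1)] that(2)])
    show "y \<in> rational_points n I \<longleftrightarrow> (\<forall>j\<in>K. F j y = 0)" if y: "y \<in> polydisc n x R" for y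
    proof
      assume "\<forall>j\<in>K. F j y = 0"
      then have fy: "mpoly_value (f i) y = 0" if "i < c" for i using zero_iff that by blast
      have "mpoly_value h y = 0" if h: "h \<in> I" for h
      proof -
        obtain k where k: "g ^ k * h \<in> genideal (poly_ring n) (f ` {..<c})" using gen[OF h] by blast
        have "mpoly_value (g ^ k * h) y = 0"
          by (rule mpoly_value_genideal[OF k]) (use f_carr fy in auto)
        then show ?thesis using g_nz[OF y] by (simp add: mpoly_value_mult mpoly_value_power)
      qed
      then show "y \<in> rational_points n I" using y by (auto simp: rational_points_def polydisc_def)
    next
      assume "y \<in> rational_points n I"
      then show "\<forall>j\<in>K. F j y = 0" using zero_iff[of y] f_zero by blast
    qed
  qed (rule R)
qed

section \<open>Charts by coordinate projections\<close>

lemma polydisc_mono: "r \<le> r' \<Longrightarrow> polydisc d c r \<subseteq> polydisc d c r'"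
  by (auto simp: polydisc_def intro: order_trans)

definition coord_proj :: "nat \<Rightarrow> (nat \<Rightarrow> nat) \<Rightarrow> (nat \<Rightarrow> 'q::zero) \<Rightarrow> nat \<Rightarrow> 'q" where
  "coord_proj d \<sigma> y = (\<lambda>k. if k < d then y (\<sigma> k) else 0)"

text \<open>The same \<open>r\<close> for the ambient ball, the image and the Gauss norms of the
  centred inverse coordinates is what the separation of balls depends on. Expansions are demanded
  around every \<open>u\<close> because analyticity is a condition at every point.\<close>

definition projection_chart ::
    "nat \<Rightarrow> (nat \<Rightarrow> 'q::nonarch_field) set \<Rightarrow> (nat \<Rightarrow> 'q) \<Rightarrow> nat \<Rightarrow> (nat \<Rightarrow> nat) \<Rightarrow> real \<Rightarrow> bool" where
  "projection_chart n M x d \<sigma> r \<longleftrightarrow> (let V = M \<inter> polydisc n x r; \<phi> = coord_proj d \<sigma> in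
     inj_on \<phi> V \<and> \<phi> ` V = polydisc d (\<phi> x) r \<and>
     (\<forall>u\<in>polydisc d (\<phi> x) r. \<forall>i<n.
        gauss_bounded (\<lambda>t. t) d u r (polydisc d u r) (\<lambda>s. inv_into V \<phi> s i - x i) r))"

lemma local_graph:
  fixes I :: "'q::{nonarch_field, complete_space} mpoly set"
  assumes I: "ideal I (poly_ring n)" and smooth: "smooth_scheme n I" and xM: "x \<in> rational_points n I"
  obtains d \<sigma> R where "\<sigma> ` {..<d} \<subseteq> {..<n}" "0 < R"
    "\<And>r. 0 < r \<Longrightarrow> r \<le> R \<Longrightarrow> projection_chart n (rational_points n I) x d \<sigma> r"
proof -
  let ?M = "rational_points n I"
  obtain K F D R where K: "K \<subseteq> {..<n}" and sd: "\<And>j. j \<in> K \<Longrightarrow> strictly_diff n x (F j) (D j)"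
    and F: "\<And>j. j \<in> K \<Longrightarrow> F j x = 0"
    and D: "\<And>j l. j \<in> K \<Longrightarrow> l \<in> K \<Longrightarrow> D j l = (if l = j then 1 else 0)"
      "\<And>j l. j \<in> K \<Longrightarrow> l < n \<Longrightarrow> vnorm (D j l) \<le> 1"
    and R: "0 < R" and M_iff: "\<And>y. y \<in> polydisc n x R \<Longrightarrow> y \<in> ?M \<longleftrightarrow> (\<forall>j\<in>K. F j y = 0)"
    by (rule local_equations[OF I smooth xM]) (rule that)
  have "finite K" using K finite_subset by blast
  then have "\<exists>C\<ge>0. \<forall>j\<in>K. taylor_constant n x (F j) (D j) C"
    by (rule common_taylor_constant[OF _ sd])
  then obtain C where C: "0 \<le> C"
    "\<forall>j\<in>K. taylor_constant n x (F j) (D j) C" by (elim exE conjE)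
  define d where "d = card ({..<n} - K)"
  have "finite ({..<n} - K)" by simp
  from ex_bij_betw_nat_finite[OF this] obtain \<sigma> where \<sigma>: "bij_betw \<sigma> {..<d} ({..<n} - K)"
    unfolding d_def lessThan_atLeast0 ..
  have \<sigma>_n: "\<sigma> k < n" if "k < d" for k using bij_betw_apply[OF \<sigma>, of k] that by auto
  \<comment> \<open>The three bounds make the equations equivalent to membership, satisfy the
    restriction on increments, and give \<open>C * r \<le> 1 / 2\<close>.\<close>
  define R0 where "R0 = min R (min 1 (1 / (2 * (C + 1))))"
  have R0: "0 < R0" "R0 \<le> R" "R0 \<le> 1" "R0 \<le> 1 / (2 * (C + 1))" using R C(1) by (auto simp: R0_def min.coboundedI2)
  have x_aff: "x \<in> affine_points n" using xM by (simp add: rational_points_def)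
  let ?\<phi> = "coord_proj d \<sigma>"
  have main: "projection_chart n ?M x d \<sigma> r" if r': "0 < r" "r \<le> R0" for r
  proof -
    let ?V = "?M \<inter> polydisc n x r"
    have "C * r \<le> (C + 1) * (1 / (2 * (C + 1)))"
      using r' R0 C(1) by (intro mult_mono) auto
    also have "\<dots> = 1 / 2" using C(1) by (simp add: field_simps)
    finally have Cr: "C * r \<le> 1 / 2" .
    have F_taylor: "taylor_constant n x (F j) (D j) C" if "j \<in> K" for j using C(2) that ..
    have "r \<le> 1" using r' R0 by simp
    interpret newton_system n d K \<sigma> x F D C r
      by unfold_locales (fact K \<sigma> x_aff C(1) F D r' Cr F_taylor \<open>r \<le> 1\<close>)+
    have V_iff: "y \<in> ?V \<longleftrightarrow> y \<in> polydisc n x r \<and> (\<forall>j\<in>K. F j y = 0)" for y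
    proof -
      have "y \<in> polydisc n x R" if "y \<in> polydisc n x r"
        using that polydisc_mono[OF order_trans[OF r'(2) R0(2)]] by blast
      then show ?thesis using M_iff[of y] by auto
    qed
    have inj: "inj_on ?\<phi> ?V"
    proof (rule inj_onI)
      fix y y' assume y: "y \<in> ?V" "y' \<in> ?V" "?\<phi> y = ?\<phi> y'"
      show "y = y'"
      proof (rule newton_unique)
        show "y (\<sigma> k) = y' (\<sigma> k)" if "k < d" for k
          using fun_cong[OF y(3), of k] that by (simp add: coord_proj_def)
      qed (use y V_iff in auto)
    qed
    have sol: "\<exists>H. (\<forall>i<n. gauss_bounded (\<lambda>t. t) d u r (polydisc d u r) (\<lambda>s. H s i) r) \<and>
        (\<forall>s\<in>polydisc d u r. (\<lambda>i. x i + H s i) \<in> ?V \<and> ?\<phi> (\<lambda>i. x i + H s i) = s)"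
      if u: "u \<in> polydisc d (?\<phi> x) r" for u
    proof -
      from newton_solution[of u] u obtain H
        where H: "\<forall>i<n. gauss_bounded (\<lambda>t. t) d u r (polydisc d u r) (\<lambda>s. H s i) r"
          "\<forall>s\<in>polydisc d u r. (\<lambda>i. x i + H s i) \<in> affine_points n \<and> (\<forall>j\<in>K. F j (\<lambda>i. x i + H s i) = 0) \<and>
            (\<forall>k<d. x (\<sigma> k) + H s (\<sigma> k) = s k)"
        unfolding coord_proj_def by blast
      have "(\<lambda>i. x i + H s i) \<in> ?V \<and> ?\<phi> (\<lambda>i. x i + H s i) = s" if s: "s \<in> polydisc d u r" for s
      proof
        have "vnorm (H s i) \<le> r" if "i < n" for i
          using id_emb.gauss_bounded_vnorm_le[OF H(1)[rule_format, OF that] s s] .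
        then have "(\<lambda>i. x i + H s i) \<in> polydisc n x r"
          using H(2) s by (auto simp: polydisc_def)
        then show "(\<lambda>i. x i + H s i) \<in> ?V" using H(2) s V_iff by blast
        show "?\<phi> (\<lambda>i. x i + H s i) = s"
          using H(2) s by (auto simp: coord_proj_def fun_eq_iff polydisc_def affine_points_def)
      qed
      then show ?thesis using H(1) by blast
    qed
    have \<phi>x: "?\<phi> x \<in> polydisc d (?\<phi> x) r"
      using r by (auto simp: polydisc_def coord_proj_def affine_points_def)
    have "?\<phi> ` ?V = polydisc d (?\<phi> x) r"
    proof
      show "?\<phi> ` ?V \<subseteq> polydisc d (?\<phi> x) r"
        using \<sigma>_n by (auto simp: polydisc_def coord_proj_def affine_points_def)
      show "polydisc d (?\<phi> x) r \<subseteq> ?\<phi> ` ?V"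
      proof
        fix s assume s: "s \<in> polydisc d (?\<phi> x) r"
        obtain H where "\<forall>s\<in>polydisc d (?\<phi> x) r. (\<lambda>i. x i + H s i) \<in> ?V \<and> ?\<phi> (\<lambda>i. x i + H s i) = s"
          using sol[OF \<phi>x] by (elim exE conjE)
        from bspec[OF this s] have H: "(\<lambda>i. x i + H s i) \<in> ?V" "?\<phi> (\<lambda>i. x i + H s i) = s" by blast+
        from imageI[OF H(1), of ?\<phi>] show "s \<in> ?\<phi> ` ?V" unfolding H(2) .
      qed
    qed
    moreover have "gauss_bounded (\<lambda>t. t) d u r (polydisc d u r) (\<lambda>s. inv_into ?V ?\<phi> s i - x i) r"
      if u: "u \<in> polydisc d (?\<phi> x) r" and i: "i < n" for u i
    proof -
      obtain H where H: "\<forall>i<n. gauss_bounded (\<lambda>t. t) d u r (polydisc d u r) (\<lambda>s. H s i) r"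
        "\<forall>s\<in>polydisc d u r. (\<lambda>i. x i + H s i) \<in> ?V \<and> ?\<phi> (\<lambda>i. x i + H s i) = s"
        using sol[OF u] by (elim exE conjE)
      show ?thesis
      proof (rule gauss_bounded_cong[OF H(1)[rule_format, OF i]])
        fix s assume "s \<in> polydisc d u r"
        from bspec[OF H(2) this] have "(\<lambda>i. x i + H s i) \<in> ?V" "?\<phi> (\<lambda>i. x i + H s i) = s" by blast+
        then have "inv_into ?V ?\<phi> s = (\<lambda>i. x i + H s i)" by (rule inv_into_f_eq[OF inj])
        then show "H s i = inv_into ?V ?\<phi> s i - x i" by simp
      qed
    qed
    ultimately show ?thesis using inj by (simp add: projection_chart_def Let_def)
  qed
  show ?thesis
    by (rule that[of \<sigma> d R0]) (use \<sigma>_n R0 main in auto)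
qed

lemma open_vnorm_ball: "0 < r \<Longrightarrow> open {z :: 'q::nonarch_field. vnorm (z - a) \<le> r}"
  unfolding open_dist
proof (intro ballI)
  fix z :: 'q assume r: "0 < r" and z: "z \<in> {z. vnorm (z - a) \<le> r}"
  have "vnorm (y - a) \<le> r" if "vnorm (y - z) < r" for y
    by (rule vnorm_diff_triangle[of y z]) (use that z in auto)
  then show "\<exists>e>0. \<forall>y. dist y z < e \<longrightarrow> y \<in> {z. vnorm (z - a) \<le> r}"
    using r by (intro exI[of _ r]) (auto simp: dist_vnorm)
qed

lemma openin_polydisc:
  fixes c :: "nat \<Rightarrow> 'q::nonarch_field"
  assumes "S \<subseteq> affine_points d" "0 < r"
  shows "openin (top_of_set S) (S \<inter> polydisc d c r)"
proof -
  let ?B = "\<Inter>i\<in>{..<d}. (\<lambda>y :: nat \<Rightarrow> 'q. y i) -` {z. vnorm (z - c i) \<le> r}"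
  have "open ?B"
    by (intro open_INT ballI open_vimage open_vnorm_ball assms continuous_on_product_coordinates) simp
  moreover have "S \<inter> polydisc d c r = S \<inter> ?B" using assms(1) by (auto simp: polydisc_def)
  ultimately show ?thesis by (simp add: openin_open_Int)
qed

lemma gauss_bounded_imp_power_series: "gauss_bounded \<iota> d c r T u C \<Longrightarrow> \<exists>a. power_series_on \<iota> d c r a u T"
  by (auto simp: gauss_bounded_def)

lemma is_ball_chart_coord_proj:
  assumes M: "M \<subseteq> affine_points n" and \<sigma>: "\<sigma> ` {..<d} \<subseteq> {..<n}" and r: "0 < r"
    and V: "V = M \<inter> polydisc n x r"
    and chart: "projection_chart n M x d \<sigma> r"
  shows "is_ball_chart n M \<lparr>chart_dim = d, chart_dom = V, chart_map = coord_proj d \<sigma>,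
    chart_centre = coord_proj d \<sigma> x, chart_radius = r\<rparr>"
proof -
  let ?\<phi> = "coord_proj d \<sigma>"
  have inj: "inj_on ?\<phi> V" and img: "?\<phi> ` V = polydisc d (?\<phi> x) r"
    and inv: "\<And>u i. u \<in> polydisc d (?\<phi> x) r \<Longrightarrow> i < n \<Longrightarrow>
      gauss_bounded (\<lambda>t. t) d u r (polydisc d u r) (\<lambda>s. inv_into V ?\<phi> s i - x i) r"
    using chart by (simp_all add: projection_chart_def V Let_def)
  have "locally_analytic_on (\<lambda>t. t) n V (\<lambda>y. ?\<phi> y i)" if i: "i < d" for i
    unfolding locally_analytic_on_def
  proof
    fix y assume "y \<in> V"
    let ?T = "V \<inter> polydisc n y 1"
    interpret ultra_bound "gauss_bounded (\<lambda>t. t) n y 1 ?T"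
      by (rule id_emb.ultra_bound_gauss) auto
    have "\<sigma> i < n" using \<sigma> i by auto
    then have "gauss_bounded (\<lambda>t. t) n y 1 ?T (\<lambda>x. x (\<sigma> i) - y (\<sigma> i)) 1"
      by (intro id_emb.gauss_bounded_coord) simp_all
    from add_max[OF this const[OF order_refl, of "y (\<sigma> i)"]]
    have "gauss_bounded (\<lambda>t. t) n y 1 ?T (\<lambda>y. ?\<phi> y i) (max 1 (vnorm (y (\<sigma> i))))"
      using i by (simp add: coord_proj_def)
    from gauss_bounded_imp_power_series[OF this]
    show "\<exists>r>0. \<exists>a. power_series_on (\<lambda>t. t) n y r a (\<lambda>y. ?\<phi> y i) (V \<inter> polydisc n y r)"
      by (intro exI[of _ "1 :: real"] conjI) simp_all
  qed
  moreover have "locally_analytic_on (\<lambda>t. t) d (?\<phi> ` V) (\<lambda>u. inv_into V ?\<phi> u i)" if i: "i < n" for i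
    unfolding locally_analytic_on_def
  proof
    fix u assume u: "u \<in> ?\<phi> ` V"
    then have u: "u \<in> polydisc d (?\<phi> x) r" by (simp add: img)
    interpret ultra_bound "gauss_bounded (\<lambda>t. t) d u r (polydisc d u r)"
      by (rule id_emb.ultra_bound_gauss) (use r in auto)
    from add_max[OF inv[OF u i] const[OF order_refl, of "x i"]]
    obtain a where "power_series_on (\<lambda>t. t) d u r a (\<lambda>u. inv_into V ?\<phi> u i) (polydisc d u r)"
      using gauss_bounded_imp_power_series by fastforce
    then show "\<exists>r>0. \<exists>a. power_series_on (\<lambda>t. t) d u r a (\<lambda>u. inv_into V ?\<phi> u i) (?\<phi> ` V \<inter> polydisc d u r)"
      using r power_series_on_subset by (intro exI[of _ r]) blast
  qed
  moreover have "openin (top_of_set M) V"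
    unfolding V by (rule openin_polydisc[OF M r])
  moreover have "openin (top_of_set (affine_points d)) (?\<phi> ` V)"
  proof -
    have "affine_points d \<inter> polydisc d (?\<phi> x) r = polydisc d (?\<phi> x) r" by (auto simp: polydisc_def)
    then show ?thesis unfolding img using openin_polydisc[OF order_refl r, of d "?\<phi> x"] by simp
  qed
  moreover have "?\<phi> x \<in> affine_points d" by (simp add: coord_proj_def affine_points_def)
  ultimately show ?thesis
    unfolding is_ball_chart_def analytic_chart_def using inj img r by simp
qed

section \<open>Charts in which the given function is a limit of polynomials\<close>

abbreviation chart_inverse :: "'q ball_chart \<Rightarrow> (nat \<Rightarrow> 'q) \<Rightarrow> nat \<Rightarrow> 'q" where
  "chart_inverse D \<equiv> inv_into (chart_dom D) (chart_map D)"

abbreviation chart_disc :: "'q::nonarch_field ball_chart \<Rightarrow> (nat \<Rightarrow> 'q) set" where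
  "chart_disc D \<equiv> polydisc (chart_dim D) (chart_centre D) (chart_radius D)"

abbreviation chart_bounded ::
    "('q::nonarch_field \<Rightarrow> 'l::nonarch_field) \<Rightarrow> 'q ball_chart \<Rightarrow> ((nat \<Rightarrow> 'q) \<Rightarrow> 'l) \<Rightarrow> real \<Rightarrow> bool" where
  "chart_bounded \<iota> D \<equiv> gauss_bounded \<iota> (chart_dim D) (chart_centre D) (chart_radius D) (chart_disc D)"

text \<open>Approximability replaces an expansion of \<open>f\<close> because it speaks directly of
  ambient polynomials. As these have finite norm in the chart, it also implies that \<open>f\<close>
  is a single power series there.\<close>

definition adapted_chart ::
    "('q::nonarch_field \<Rightarrow> 'l::nonarch_field) \<Rightarrow> nat \<Rightarrow> (nat \<Rightarrow> 'q) set \<Rightarrow> ((nat \<Rightarrow> 'q) \<Rightarrow> 'l) \<Rightarrow>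
      (nat \<Rightarrow> 'q) \<Rightarrow> real \<Rightarrow> 'q ball_chart \<Rightarrow> bool" where
  "adapted_chart \<iota> n M f x r D \<longleftrightarrow>
     is_ball_chart n M D \<and> chart_dom D = M \<inter> polydisc n x r \<and> chart_radius D = r \<and>
     (\<forall>i<n. chart_bounded (\<lambda>t. t) D (\<lambda>s. chart_inverse D s i - x i) r) \<and>
     (\<forall>\<epsilon>>0. \<exists>P\<in>algebraic_functions \<iota> n.
        chart_bounded \<iota> D (\<lambda>s. f (chart_inverse D s) - P (chart_inverse D s)) \<epsilon>)"

context isometric_embedding
begin

lemma truncated_power_series:
  assumes a: "power_series_on \<iota> d c r a f T" and E: "finite E" "E \<subseteq> multi_indices d" and r: "0 < r" and \<epsilon>: "0 \<le> \<epsilon>"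
    and small: "\<And>\<alpha>. \<alpha> \<in> multi_indices d \<Longrightarrow> \<alpha> \<notin> E \<Longrightarrow> vnorm (a \<alpha>) * r ^ multi_degree \<alpha> \<le> \<epsilon>"
  shows "gauss_bounded \<iota> d c r T (\<lambda>s. f s - (\<Sum>\<alpha>\<in>E. a \<alpha> * \<iota> (monom_value \<alpha> (\<lambda>i. s i - c i)))) \<epsilon>"
proof (rule gauss_boundedI[OF power_series_onI])
  let ?b = "\<lambda>\<alpha>. if \<alpha> \<in> E then 0 else a \<alpha>"
  have a0: "a \<alpha> = 0" if "\<alpha> \<notin> multi_indices d" for \<alpha> using a that by (simp add: power_series_on_def)
  then show "?b \<alpha> = 0" if "\<alpha> \<notin> multi_indices d" for \<alpha> using that by simp
  show "null_family (multi_indices d) (\<lambda>\<alpha>. vnorm (?b \<alpha>) * r ^ multi_degree \<alpha>)"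
    by (rule null_family_mono[OF power_series_on_null[OF a]]) (use r in auto)
  show "vnorm (?b \<alpha>) * r ^ multi_degree \<alpha> \<le> \<epsilon>" for \<alpha>
    using small[of \<alpha>] a0[of \<alpha>] \<epsilon> by (cases "\<alpha> \<in> multi_indices d") auto
  fix s assume s: "s \<in> T"
  let ?m = "\<lambda>\<alpha>. \<iota> (monom_value \<alpha> (\<lambda>i. s i - c i))"
  have "((\<lambda>\<beta>. \<Sum>\<alpha>\<in>E. if \<beta> = \<alpha> then a \<alpha> * ?m \<alpha> else 0) has_sum (\<Sum>\<alpha>\<in>E. a \<alpha> * ?m \<alpha>)) (multi_indices d)"
  proof (rule has_sum_sum)
    fix \<alpha> assume "\<alpha> \<in> E"
    then show "((\<lambda>\<beta>. if \<beta> = \<alpha> then a \<alpha> * ?m \<alpha> else 0) has_sum a \<alpha> * ?m \<alpha>) (multi_indices d)"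
      using E(2) by (intro has_sum_single_support[of \<alpha>]) auto
  qed
  moreover have "((\<lambda>\<alpha>. a \<alpha> * ?m \<alpha>) has_sum f s) (multi_indices d)"
    using a s unfolding power_series_on_def by blast
  ultimately have "((\<lambda>\<beta>. a \<beta> * ?m \<beta> - (\<Sum>\<alpha>\<in>E. if \<beta> = \<alpha> then a \<alpha> * ?m \<alpha> else 0)) has_sum
      (f s - (\<Sum>\<alpha>\<in>E. a \<alpha> * ?m \<alpha>))) (multi_indices d)"
    by (intro has_sum_diff)
  moreover have "a \<beta> * ?m \<beta> - (\<Sum>\<alpha>\<in>E. if \<beta> = \<alpha> then a \<alpha> * ?m \<alpha> else 0) = ?b \<beta> * ?m \<beta>" for \<beta>
    using E(1) by simp
  ultimately show "((\<lambda>\<beta>. ?b \<beta> * ?m \<beta>) has_sum (f s - (\<Sum>\<alpha>\<in>E. a \<alpha> * ?m \<alpha>))) (multi_indices d)"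
    by (simp only:)
qed

lemma algebraic_monom:
  assumes "\<And>k. k < d \<Longrightarrow> g k \<in> algebraic_functions \<iota> n" "\<alpha> \<in> multi_indices d"
    and "\<And>k y. k < d \<Longrightarrow> \<iota> (h y k) = g k y"
  shows "(\<lambda>y. \<iota> (monom_value \<alpha> (h y))) \<in> algebraic_functions \<iota> n"
proof -
  have "(\<lambda>y. \<Prod>k\<in>Poly_Mapping.keys \<alpha>. g k y ^ Poly_Mapping.lookup \<alpha> k) \<in> algebraic_functions \<iota> n"
    by (intro algebraic_prod algebraic_power assms(1)) (use assms(2) in \<open>auto simp: multi_indices_def\<close>)
  moreover have "\<iota> (monom_value \<alpha> (h y)) = (\<Prod>k\<in>Poly_Mapping.keys \<alpha>. g k y ^ Poly_Mapping.lookup \<alpha> k)" for y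
    unfolding monom_value_def emb_prod emb_power
    by (rule prod.cong) (use assms(2,3) in \<open>auto simp: multi_indices_def\<close>)
  ultimately show ?thesis by simp
qed

end

text \<open>The chart coordinates are some of the ambient coordinates, so a truncation of the
  expansion of \<open>f\<close> in the chart is a polynomial in the ambient ones. Decay of the
  coefficients makes the truncation error small in Gauss norm.\<close>

lemma adapted_chart_exists:
  fixes I :: "'q::{nonarch_field, complete_space} mpoly set" and \<iota> :: "'q \<Rightarrow> 'l::nonarch_field"
  assumes \<iota>: "isometric_embedding \<iota>"
    and I: "ideal I (poly_ring n)" and smooth: "smooth_scheme n I" and xM: "x \<in> rational_points n I"
    and f: "f \<in> C_la \<iota> n (rational_points n I)"
  shows "\<exists>R>0. \<forall>r. 0 < r \<longrightarrow> r \<le> R \<longrightarrow> (\<exists>D. adapted_chart \<iota> n (rational_points n I) f x r D)"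
proof -
  interpret isometric_embedding \<iota> by (rule \<iota>)
  let ?M = "rational_points n I"
  have M: "?M \<subseteq> affine_points n" by (auto simp: rational_points_def)
  obtain d \<sigma> R where \<sigma>: "\<sigma> ` {..<d} \<subseteq> {..<n}" and R: "0 < R"
    and chart: "\<And>r. 0 < r \<Longrightarrow> r \<le> R \<Longrightarrow> projection_chart n ?M x d \<sigma> r"
    by (rule local_graph[OF I smooth xM]) (rule that)
  let ?\<phi> = "coord_proj d \<sigma>"
  let ?V = "\<lambda>r. ?M \<inter> polydisc n x r"
  have inj: "inj_on ?\<phi> (?V r)" and img: "?\<phi> ` ?V r = polydisc d (?\<phi> x) r"
    and inv: "\<And>u i. u \<in> polydisc d (?\<phi> x) r \<Longrightarrow> i < n \<Longrightarrow>
      gauss_bounded (\<lambda>t. t) d u r (polydisc d u r) (\<lambda>s. inv_into (?V r) ?\<phi> s i - x i) r"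
    if "0 < r" "r \<le> R" for r
    using chart[OF that] by (simp_all add: projection_chart_def Let_def)
  define B where "B r = \<lparr>chart_dim = d, chart_dom = ?V r, chart_map = ?\<phi>, chart_centre = ?\<phi> x, chart_radius = r\<rparr>" for r
  have ball: "is_ball_chart n ?M (B r)" if "0 < r" "r \<le> R" for r
    unfolding B_def by (rule is_ball_chart_coord_proj[OF M \<sigma> that(1) refl chart[OF that]])
  have centre: "?\<phi> x \<in> polydisc d (?\<phi> x) r" if "0 < r" for r
    using that by (auto simp: polydisc_def coord_proj_def affine_points_def)
  have "analytic_chart n ?M d (?V R) ?\<phi>"
    using ball[OF R order_refl] by (simp add: is_ball_chart_def B_def)
  then have "locally_analytic_on \<iota> d (?\<phi> ` ?V R) (f \<circ> inv_into (?V R) ?\<phi>)"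
    using f by (simp add: C_la_def)
  moreover have "?\<phi> x \<in> ?\<phi> ` ?V R" using img[OF R order_refl] centre[OF R] by simp
  ultimately obtain R1 a where R1: "0 < R1" and a: "power_series_on \<iota> d (?\<phi> x) R1 a
      (f \<circ> inv_into (?V R) ?\<phi>) (?\<phi> ` ?V R \<inter> polydisc d (?\<phi> x) R1)"
    unfolding locally_analytic_on_def by blast
  have "adapted_chart \<iota> n ?M f x r (B r)" if r: "0 < r" "r \<le> min R R1" for r
  proof -
    have rR: "r \<le> R" "r \<le> R1" using r by auto
    have inv_V: "inv_into (?V r) ?\<phi> s \<in> ?V r" "?\<phi> (inv_into (?V r) ?\<phi> s) = s" if "s \<in> polydisc d (?\<phi> x) r" for s
      using that inv_into_into[of s ?\<phi> "?V r"] f_inv_into_f[of s ?\<phi> "?V r"] unfolding img[OF r(1) rR(1)] by auto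
    \<comment> \<open>The expansion of \<open>f\<close> is obtained in the chart of radius
      \<open>R\<close>, whereas the norms for radius \<open>r\<close> involve the inverse on the
      smaller domain.\<close>
    have inv_eq: "inv_into (?V R) ?\<phi> s = inv_into (?V r) ?\<phi> s" if "s \<in> polydisc d (?\<phi> x) r" for s
    proof (rule inv_into_f_eq[OF inj[OF R order_refl]])
      show "inv_into (?V r) ?\<phi> s \<in> ?V R"
        using inv_V(1)[OF that] polydisc_mono[OF rR(1)] by auto
    qed (rule inv_V(2)[OF that])
    have a_r: "power_series_on \<iota> d (?\<phi> x) r a (\<lambda>s. f (inv_into (?V r) ?\<phi> s)) (polydisc d (?\<phi> x) r)"
    proof (rule power_series_on_cong[OF power_series_on_subset[OF power_series_on_shrink[OF a]]])
      show "polydisc d (?\<phi> x) r \<subseteq> ?\<phi> ` ?V R \<inter> polydisc d (?\<phi> x) R1"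
        unfolding img[OF R order_refl] using polydisc_mono rR by blast
    qed (use r rR inv_eq in auto)
    have "\<exists>P\<in>algebraic_functions \<iota> n. gauss_bounded \<iota> d (?\<phi> x) r (polydisc d (?\<phi> x) r)
        (\<lambda>s. f (inv_into (?V r) ?\<phi> s) - P (inv_into (?V r) ?\<phi> s)) \<epsilon>" if \<epsilon>: "0 < \<epsilon>" for \<epsilon>
    proof -
      define E where "E = {\<alpha>\<in>multi_indices d. \<epsilon> \<le> vnorm (a \<alpha>) * r ^ multi_degree \<alpha>}"
      have "finite E" unfolding E_def by (rule null_familyD[OF power_series_on_null[OF a_r] \<epsilon>])
      define P where "P y = (\<Sum>\<alpha>\<in>E. a \<alpha> * \<iota> (monom_value \<alpha> (\<lambda>k. ?\<phi> y k - ?\<phi> x k)))" for y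
      have "P \<in> algebraic_functions \<iota> n"
        unfolding P_def
      proof (intro algebraic_sum algebraic_cmult algebraic_monom[where d = d])
        show "(\<lambda>y. \<iota> (y (\<sigma> k)) - \<iota> (x (\<sigma> k))) \<in> algebraic_functions \<iota> n" if "k < d" for k
          using \<sigma> that by (intro algebraic_diff algebraic_coord algebraic_const) auto
      qed (auto simp: E_def coord_proj_def emb_diff)
      moreover have "gauss_bounded \<iota> d (?\<phi> x) r (polydisc d (?\<phi> x) r)
          (\<lambda>s. f (inv_into (?V r) ?\<phi> s) - (\<Sum>\<alpha>\<in>E. a \<alpha> * \<iota> (monom_value \<alpha> (\<lambda>k. s k - ?\<phi> x k)))) \<epsilon>"
        by (rule truncated_power_series[OF a_r \<open>finite E\<close>]) (use r \<epsilon> in \<open>auto simp: E_def\<close>)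
      then have "gauss_bounded \<iota> d (?\<phi> x) r (polydisc d (?\<phi> x) r)
          (\<lambda>s. f (inv_into (?V r) ?\<phi> s) - P (inv_into (?V r) ?\<phi> s)) \<epsilon>"
        by (rule gauss_bounded_cong) (simp add: P_def inv_V(2))
      ultimately show ?thesis by blast
    qed
    moreover have "gauss_bounded (\<lambda>t. t) d (?\<phi> x) r (polydisc d (?\<phi> x) r) (\<lambda>s. inv_into (?V r) ?\<phi> s i - x i) r"
      if "i < n" for i
      by (rule inv[OF r(1) rR(1) centre[OF r(1)] that])
    ultimately show ?thesis
      unfolding adapted_chart_def using ball[OF r(1) rR(1)] by (simp add: B_def)
  qed
  then show ?thesis using R R1 by (intro exI[of _ "min R R1"]) auto
qed

section \<open>Partition of the manifold into balls\<close>

lemma polydisc_nested: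
  assumes "z \<in> polydisc d c r" "z \<in> polydisc d c' r'" "r' \<le> r"
  shows "polydisc d c' r' \<subseteq> polydisc d c r"
proof -
  have "polydisc d z r' \<subseteq> polydisc d z r" by (rule polydisc_mono[OF assms(3)])
  then show ?thesis using polydisc_recentre[OF assms(1)] polydisc_recentre[OF assms(2)] by simp
qed

text \<open>
  Of the balls on which an adapted chart exists, the maximal ones among those of radius
  \<open>(1/2)\<^sup>k\<close> form a partition.
\<close>

lemma adapted_partition:
  assumes M: "M \<subseteq> affine_points n"
    and ex: "\<And>x. x \<in> M \<Longrightarrow> \<exists>R>0. \<forall>r. 0 < r \<longrightarrow> r \<le> R \<longrightarrow> (\<exists>D. adapted_chart \<iota> n M f x r D)"
  obtains \<D> where "la_index n M \<D>" "\<And>D. D \<in> \<D> \<Longrightarrow> \<exists>x\<in>M. adapted_chart \<iota> n M f x (chart_radius D) D"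
proof -
  let ?\<rho> = "\<lambda>k :: nat. (1 / 2 :: real) ^ k"
  let ?good = "\<lambda>D. \<exists>x\<in>M. adapted_chart \<iota> n M f x (chart_radius D) D"
  \<comment> \<open>The centre may be any point \<open>x\<close> of the manifold, not only
    \<open>y\<close>; therefore a ball that is good for one of its points is good for all of
    them.\<close>
  define G where "G k y \<longleftrightarrow> (\<exists>x\<in>M. y \<in> polydisc n x (?\<rho> k) \<and> (\<exists>D. adapted_chart \<iota> n M f x (?\<rho> k) D))" for k y
  have G_ex: "\<exists>k. G k y" if y: "y \<in> M" for y
  proof -
    obtain R where R: "0 < R" "\<And>r. 0 < r \<Longrightarrow> r \<le> R \<Longrightarrow> \<exists>D. adapted_chart \<iota> n M f y r D" using ex[OF y] by blast
    obtain k where "?\<rho> k < R" using real_arch_pow_inv[OF R(1), of "1 / 2"] by auto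
    then have "\<exists>D. adapted_chart \<iota> n M f y (?\<rho> k) D" by (intro R(2)) auto
    moreover have "y \<in> polydisc n y (?\<rho> k)" using y M by (auto simp: polydisc_def)
    ultimately show ?thesis using y unfolding G_def by blast
  qed
  \<comment> \<open>The least exponent gives the largest good ball; its existence is the reason for
    the discrete scale of radii.\<close>
  define k where "k y = (LEAST k. G k y)" for y
  have k: "G (k y) y" if "y \<in> M" for y unfolding k_def by (rule LeastI_ex[OF G_ex[OF that]])
  define W where "W y = M \<inter> polydisc n y (?\<rho> (k y))" for y
  have W_refl: "y \<in> W y" if "y \<in> M" for y using that M by (auto simp: W_def polydisc_def)
  have chart: "\<exists>D. ?good D \<and> chart_dom D = W y" if y: "y \<in> M" for y
  proof -
    obtain x D where x: "x \<in> M" "y \<in> polydisc n x (?\<rho> (k y))" and D: "adapted_chart \<iota> n M f x (?\<rho> (k y)) D"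
      using k[OF y] unfolding G_def by blast
    have rd: "chart_radius D = ?\<rho> (k y)" and dom: "chart_dom D = W y"
      using D polydisc_recentre[OF x(2)] by (simp_all add: adapted_chart_def W_def)
    have "adapted_chart \<iota> n M f x (chart_radius D) D" unfolding rd by (rule D)
    then show ?thesis using x(1) dom by blast
  qed
  \<comment> \<open>The chart is chosen for the set and not for the point: points with the same ball
    get the same chart, so that distinct charts in the family have distinct domains.\<close>
  define \<Delta> where "\<Delta> U = (SOME D. ?good D \<and> chart_dom D = U)" for U
  have \<Delta>: "?good (\<Delta> (W y))" "chart_dom (\<Delta> (W y)) = W y" if "y \<in> M" for y
    using someI_ex[OF chart[OF that]] unfolding \<Delta>_def by blast+
  \<comment> \<open>If two of these balls meet, the smaller lies in the larger. The larger is then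
    good for the centre of the smaller as well, and minimality of the exponent forces equal
    radii.\<close>
  have W_disjoint: "W y = W y'" if yM: "y \<in> M" "y' \<in> M" and z: "z \<in> W y" "z \<in> W y'" and le: "k y \<le> k y'" for y y' z
  proof -
    have "?\<rho> (k y') \<le> ?\<rho> (k y)" using le by (intro power_decreasing) auto
    with z have "polydisc n y' (?\<rho> (k y')) \<subseteq> polydisc n y (?\<rho> (k y))"
      unfolding W_def by (intro polydisc_nested[of z]) auto
    then have y': "y' \<in> polydisc n y (?\<rho> (k y))" using W_refl[OF yM(2)] by (auto simp: W_def)
    obtain x where x: "x \<in> M" "y \<in> polydisc n x (?\<rho> (k y))" "\<exists>D. adapted_chart \<iota> n M f x (?\<rho> (k y)) D"
      using k[OF yM(1)] unfolding G_def by blast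
    then have "G (k y) y'" unfolding G_def using y' polydisc_recentre[OF x(2)] by auto
    then have "k y' \<le> k y" unfolding k_def[of y'] by (rule Least_le)
    then have "k y' = k y" using le by simp
    then show ?thesis unfolding W_def using polydisc_recentre[OF y'] by simp
  qed
  have W_eq: "W y = W y'" if "y \<in> M" "y' \<in> M" "z \<in> W y" "z \<in> W y'" for y y' z
    using W_disjoint[of y y' z] W_disjoint[of y' y z] that by (cases "k y \<le> k y'") auto
  show ?thesis
  proof (rule that[of "(\<lambda>y. \<Delta> (W y)) ` M"])
    show "la_index n M ((\<lambda>y. \<Delta> (W y)) ` M)"
      unfolding la_index_def
    proof (intro conjI ballI impI)
      show "is_ball_chart n M D" if "D \<in> (\<lambda>y. \<Delta> (W y)) ` M" for D
        using \<Delta>(1) that by (auto simp: adapted_chart_def)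
      have "W y \<subseteq> M" for y by (auto simp: W_def)
      then show "(\<Union>D\<in>(\<lambda>y. \<Delta> (W y)) ` M. chart_dom D) = M"
        using W_refl \<Delta>(2) by fastforce
      fix D E assume D: "D \<in> (\<lambda>y. \<Delta> (W y)) ` M" and E: "E \<in> (\<lambda>y. \<Delta> (W y)) ` M" and "D \<noteq> E"
      then obtain y y' where y: "y \<in> M" "D = \<Delta> (W y)" "y' \<in> M" "E = \<Delta> (W y')" by blast
      then have "W y \<noteq> W y'" using \<open>D \<noteq> E\<close> by auto
      then have "W y \<inter> W y' = {}" using W_eq[OF y(1,3)] by blast
      then show "chart_dom D \<inter> chart_dom E = {}" using \<Delta>(2) y by simp
    qed
  qed (use \<Delta>(1) in blast)
qed

section \<open>Density\<close>

lemma nontrivially_valued_padic: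
  assumes p: "prime p" and Q: "is_padic_field p TYPE('q::{nonarch_field, field_char_0, complete_space})"
  shows "nontrivially_valued TYPE('q)"
proof -
  have "2 \<le> p" by (rule prime_ge_2_nat[OF p])
  have "multiplicity (int p) (int p) = 1"
    using \<open>2 \<le> p\<close> by (intro multiplicity_self) auto
  then have "padic_abs p (of_nat p) = inverse (real p)"
    using \<open>2 \<le> p\<close> by (simp add: padic_abs_def power_int_minus)
  moreover have "vnorm (of_rat (of_nat p) :: 'q) = padic_abs p (of_nat p)"
    using Q unfolding is_padic_field_def by blast
  ultimately have "vnorm (of_rat (of_nat p) :: 'q) = inverse (real p)" by (simp only:)
  moreover have "0 < inverse (real p)" "inverse (real p) < 1"
    using \<open>2 \<le> p\<close> by (auto simp: inverse_less_1_iff)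
  ultimately show ?thesis unfolding nontrivially_valued_def by metis
qed

lemma adapted_chart_approximable:
  "adapted_chart \<iota> n M f x r D \<Longrightarrow> 0 < \<epsilon> \<Longrightarrow> \<exists>P\<in>algebraic_functions \<iota> n.
    chart_bounded \<iota> D (\<lambda>s. f (chart_inverse D s) - P (chart_inverse D s)) \<epsilon>"
  unfolding adapted_chart_def by blast

lemma la_seminorm_bound:
  "la_seminorm \<iota> n M q \<Longrightarrow> la_index n M \<D> \<Longrightarrow> \<exists>J C. finite J \<and> J \<subseteq> \<D> \<and>
    (\<forall>f\<in>la_step \<iota> M \<D>. q f \<le> C * (\<Sum>D\<in>J. chart_norm \<iota> D f))"
  by (simp add: la_seminorm_def)

context isometric_embedding
begin

lemma algebraic_bounded_chart:
  assumes "0 < r" "T \<subseteq> polydisc d u r"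
    and "\<And>i. i < n \<Longrightarrow> \<exists>C. gauss_bounded (\<lambda>t. t) d u r T (\<lambda>s. y s i) C"
    and "G \<in> algebraic_functions \<iota> n"
  shows "\<exists>C. gauss_bounded \<iota> d u r T (\<lambda>s. G (y s)) C"
  by (rule algebraic_bounded[OF ultra_bound_gauss[OF assms(1,2)] _ assms(4)])
    (use assms(3) gauss_bounded_emb in blast)

lemma C_alg_subset_C_la: "C_alg \<iota> n I \<subseteq> C_la \<iota> n (rational_points n I)"
proof
  let ?M = "rational_points n I"
  fix f assume "f \<in> C_alg \<iota> n I"
  then obtain G where G: "G \<in> algebraic_functions \<iota> n" and f: "f = (\<lambda>x. if x \<in> ?M then G x else 0)"
    unfolding C_alg_eq by (elim imageE)
  have "locally_analytic_on \<iota> d (\<phi> ` V) (f \<circ> inv_into V \<phi>)" if chart: "analytic_chart n ?M d V \<phi>" for d V \<phi>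
    unfolding locally_analytic_on_def
  proof
    fix u assume u: "u \<in> \<phi> ` V"
    have "V \<subseteq> ?M" using chart openin_imp_subset by (auto simp: analytic_chart_def)
    let ?T = "\<lambda>r. \<phi> ` V \<inter> polydisc d u r"
    have "\<forall>i\<in>{..<n}. \<exists>r a. 0 < r \<and> power_series_on (\<lambda>t. t) d u r a (\<lambda>u. inv_into V \<phi> u i) (?T r)"
      using chart u unfolding analytic_chart_def locally_analytic_on_def by auto
    from bchoice[OF this] obtain r where r: "\<forall>i\<in>{..<n}. \<exists>a. 0 < r i \<and>
        power_series_on (\<lambda>t. t) d u (r i) a (\<lambda>u. inv_into V \<phi> u i) (?T (r i))" ..
    \<comment> \<open>The element 1 keeps the minimum defined when \<open>n\<close> is 0 and there
      are no coordinate radii.\<close>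
    define R where "R = Min (insert 1 (r ` {..<n}))"
    have R: "0 < R" "\<And>i. i < n \<Longrightarrow> R \<le> r i" unfolding R_def using r by auto
    have coord: "\<exists>C. gauss_bounded (\<lambda>t. t) d u R (?T R) (\<lambda>s. inv_into V \<phi> s i) C" if i: "i < n" for i
    proof -
      obtain a where "power_series_on (\<lambda>t. t) d u (r i) a (\<lambda>u. inv_into V \<phi> u i) (?T (r i))"
        using r i by auto
      then have "power_series_on (\<lambda>t. t) d u R a (\<lambda>u. inv_into V \<phi> u i) (?T R)"
        by (rule power_series_on_subset[OF power_series_on_shrink])
          (use R i polydisc_mono[OF R(2)[OF i], of d u] in auto)
      then show ?thesis by (rule power_series_on_imp_gauss_bounded)
    qed
    have "\<exists>C. gauss_bounded \<iota> d u R (?T R) (\<lambda>s. G (inv_into V \<phi> s)) C"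
      by (rule algebraic_bounded_chart[OF R(1) Int_lower2 coord G])
    then obtain C where "gauss_bounded \<iota> d u R (?T R) (\<lambda>s. G (inv_into V \<phi> s)) C" ..
    then have "gauss_bounded \<iota> d u R (?T R) (f \<circ> inv_into V \<phi>) C"
    proof (rule gauss_bounded_cong)
      fix s assume "s \<in> ?T R"
      then have "inv_into V \<phi> s \<in> ?M" using \<open>V \<subseteq> ?M\<close> inv_into_into[of s \<phi> V] by blast
      then show "G (inv_into V \<phi> s) = (f \<circ> inv_into V \<phi>) s" by (simp add: f)
    qed
    from gauss_bounded_imp_power_series[OF this] show "\<exists>r>0. \<exists>a. power_series_on \<iota> d u r a (f \<circ> inv_into V \<phi>) (?T r)"
      using R(1) by (intro exI[of _ R] conjI)
  qed
  then show "f \<in> C_la \<iota> n ?M" by (simp add: C_la_def f)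
qed

text \<open>Needed since the triangle inequality of a seminorm is available only for elements of
  \<open>C_la\<close>.\<close>

lemma C_la_diff:
  assumes f: "f \<in> C_la \<iota> n M" and g: "g \<in> C_la \<iota> n M"
  shows "(\<lambda>x. f x - g x) \<in> C_la \<iota> n M"
proof -
  have "locally_analytic_on \<iota> d (\<phi> ` V) ((\<lambda>x. f x - g x) \<circ> inv_into V \<phi>)" if chart: "analytic_chart n M d V \<phi>" for d V \<phi>
    unfolding locally_analytic_on_def
  proof
    fix u assume u: "u \<in> \<phi> ` V"
    let ?T = "\<lambda>r. \<phi> ` V \<inter> polydisc d u r"
    obtain r a where r: "0 < r" and a: "power_series_on \<iota> d u r a (f \<circ> inv_into V \<phi>) (?T r)"
      using f chart u unfolding C_la_def locally_analytic_on_def by blast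
    obtain r' b where r': "0 < r'" and b: "power_series_on \<iota> d u r' b (g \<circ> inv_into V \<phi>) (?T r')"
      using g chart u unfolding C_la_def locally_analytic_on_def by blast
    define R where "R = min r r'"
    have R: "0 < R" "R \<le> r" "R \<le> r'" using r r' by (auto simp: R_def)
    have T: "?T R \<subseteq> ?T r" "?T R \<subseteq> ?T r'" using polydisc_mono R by blast+
    interpret ultra_bound "gauss_bounded \<iota> d u R (?T R)"
      by (rule ultra_bound_gauss) (use R in auto)
    have "power_series_on \<iota> d u R a (f \<circ> inv_into V \<phi>) (?T R)"
      by (rule power_series_on_subset[OF power_series_on_shrink[OF a] T(1)]) (use R in auto)
    then obtain C where C: "gauss_bounded \<iota> d u R (?T R) (f \<circ> inv_into V \<phi>) C"
      using power_series_on_imp_gauss_bounded by blast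
    have "power_series_on \<iota> d u R b (g \<circ> inv_into V \<phi>) (?T R)"
      by (rule power_series_on_subset[OF power_series_on_shrink[OF b] T(2)]) (use R in auto)
    then obtain D where D: "gauss_bounded \<iota> d u R (?T R) (g \<circ> inv_into V \<phi>) D"
      using power_series_on_imp_gauss_bounded by blast
    from gauss_bounded_imp_power_series[OF diff[OF mono[OF C max.cobounded1] mono[OF D max.cobounded2]]]
    show "\<exists>r>0. \<exists>a. power_series_on \<iota> d u r a ((\<lambda>x. f x - g x) \<circ> inv_into V \<phi>) (?T r)"
      using R(1) by (auto simp: comp_def)
  qed
  then show ?thesis using f g by (simp add: C_la_def)
qed

lemma adapted_chart_algebraic_bounded:
  assumes D: "adapted_chart \<iota> n M f x r D" and G: "G \<in> algebraic_functions \<iota> n"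
  shows "\<exists>C. chart_bounded \<iota> D (\<lambda>s. G (chart_inverse D s)) C"
proof (rule algebraic_bounded_chart[OF _ order_refl _ G])
  show r: "0 < chart_radius D" using D by (auto simp: adapted_chart_def is_ball_chart_def)
  fix i assume "i < n"
  interpret ultra_bound "chart_bounded (\<lambda>t. t) D"
    by (rule id_emb.ultra_bound_gauss) (use r in auto)
  have "chart_bounded (\<lambda>t. t) D (\<lambda>s. chart_inverse D s i - x i) r"
    using D \<open>i < n\<close> by (auto simp: adapted_chart_def)
  from add_max[OF this const[OF order_refl, of "x i"]]
  show "\<exists>C. chart_bounded (\<lambda>t. t) D (\<lambda>s. chart_inverse D s i) C" by auto
qed

text \<open>The domains are known to be disjoint only inside \<open>M\<close>. But the centres are
  points of \<open>M\<close>, so the centre of one ball lies outside the ambient polydisc of any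
  other, which is the separation that gluing asks for.\<close>

lemma adapted_chart_approximation:
  assumes M: "M \<subseteq> affine_points n" and \<D>: "la_index n M \<D>"
    and good: "\<And>D. D \<in> \<D> \<Longrightarrow> \<exists>x\<in>M. adapted_chart \<iota> n M f x (chart_radius D) D"
    and J: "finite J" "J \<subseteq> \<D>" and \<epsilon>: "0 < \<epsilon>"
  shows "\<exists>g\<in>algebraic_functions \<iota> n. \<forall>D\<in>J. chart_bounded \<iota> D (\<lambda>s. g (chart_inverse D s) - f (chart_inverse D s)) \<epsilon>"
proof -
  have "\<forall>D\<in>\<D>. \<exists>x. x \<in> M \<and> adapted_chart \<iota> n M f x (chart_radius D) D" using good by blast
  from bchoice[OF this] obtain X
    where X: "\<forall>D\<in>\<D>. X D \<in> M \<and> adapted_chart \<iota> n M f (X D) (chart_radius D) D" ..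
  have XM: "X D \<in> M" and ad: "adapted_chart \<iota> n M f (X D) (chart_radius D) D" if "D \<in> \<D>" for D
    using X that by auto
  have pos: "0 < chart_radius D" if "D \<in> \<D>" for D
    using ad[OF that] by (auto simp: adapted_chart_def is_ball_chart_def)
  \<comment> \<open>Pulling back along the inverse chart turns Gauss norms on different discs into
    bounds for functions on one ambient space.\<close>
  define Q where "Q D G C \<longleftrightarrow> chart_bounded \<iota> D (\<lambda>s. G (chart_inverse D s)) C" for D G C
  have Q: "ultra_bound (Q D)" if "D \<in> \<D>" for D
  proof -
    interpret ultra_bound "chart_bounded \<iota> D" by (rule ultra_bound_gauss[OF pos[OF that] order_refl])
    show ?thesis
      by standard (simp_all add: Q_def nonneg const add mult mono)
  qed
  have coord: "Q D (\<lambda>y. \<iota> (y i - X D i)) (chart_radius D)" if "D \<in> \<D>" "i < n" for D i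
  proof -
    have "chart_bounded (\<lambda>t. t) D (\<lambda>s. chart_inverse D s i - X D i) (chart_radius D)"
      using ad[OF that(1)] that(2) unfolding adapted_chart_def by blast
    then show ?thesis unfolding Q_def by (rule gauss_bounded_emb)
  qed
  interpret polydisc_bounds \<iota> n \<D> Q X chart_radius
    by (intro polydisc_bounds.intro polydisc_bounds_axioms.intro isometric_embedding_axioms Q pos coord)
  have "\<forall>D\<in>\<D>. \<exists>P. P \<in> algebraic_functions \<iota> n \<and>
      chart_bounded \<iota> D (\<lambda>s. f (chart_inverse D s) - P (chart_inverse D s)) \<epsilon>"
    using adapted_chart_approximable[OF ad \<epsilon>] by (simp add: Bex_def)
  from bchoice[OF this] obtain P where P: "\<forall>D\<in>\<D>. P D \<in> algebraic_functions \<iota> n \<and>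
      chart_bounded \<iota> D (\<lambda>s. f (chart_inverse D s) - P D (chart_inverse D s)) \<epsilon>" ..
  have "\<exists>g\<in>algebraic_functions \<iota> n. \<forall>D\<in>J. Q D (\<lambda>y. g y - P D y) \<epsilon>"
  proof (rule simultaneous_approximation[OF J _ _ \<epsilon>])
    fix D E assume DE: "D \<in> \<D>" "E \<in> \<D>" "D \<noteq> E" "chart_radius E \<le> chart_radius D"
    have dom: "chart_dom D = M \<inter> polydisc n (X D) (chart_radius D)"
      "chart_dom E = M \<inter> polydisc n (X E) (chart_radius E)"
      using ad DE by (auto simp: adapted_chart_def)
    have "X E \<in> chart_dom E"
      unfolding dom using XM[OF DE(2)] M pos[OF DE(2)] by (auto simp: polydisc_def)
    moreover have "chart_dom D \<inter> chart_dom E = {}" using \<D> DE unfolding la_index_def by blast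
    ultimately have "X E \<notin> polydisc n (X D) (chart_radius D)"
      unfolding dom using XM[OF DE(2)] by blast
    then show "\<exists>i<n. chart_radius D < vnorm (X E i - X D i)"
      using XM[OF DE(2)] M by (auto simp: polydisc_def not_le)
  qed (use P in blast)
  then obtain g where g: "g \<in> algebraic_functions \<iota> n" "\<forall>D\<in>J. Q D (\<lambda>y. g y - P D y) \<epsilon>" by blast
  have "chart_bounded \<iota> D (\<lambda>s. g (chart_inverse D s) - f (chart_inverse D s)) \<epsilon>" if D: "D \<in> J" for D
  proof -
    have "D \<in> \<D>" using D J by auto
    interpret ultra_bound "Q D" by (rule Q[OF \<open>D \<in> \<D>\<close>])
    have "Q D (\<lambda>y. f y - P D y) \<epsilon>" using P \<open>D \<in> \<D>\<close> by (simp add: Q_def)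
    from diff_triangle[OF bspec[OF g(2) D] diff_commute[OF this]] show ?thesis by (simp add: Q_def)
  qed
  then show ?thesis using g(1) by blast
qed

text \<open>A seminorm is controlled only on the step, so the error must be a convergent series in
  every chart, also in those outside \<open>J\<close>, where nothing is claimed about its size.
  There \<open>f\<close> is within norm 1 of a polynomial, and differences of polynomials have
  finite norm.\<close>

lemma density_on_index:
  assumes nt: "nontrivially_valued TYPE('q)"
    and \<D>: "la_index n (rational_points n I) \<D>"
    and good: "\<And>D. D \<in> \<D> \<Longrightarrow> \<exists>x\<in>rational_points n I. adapted_chart \<iota> n (rational_points n I) f x (chart_radius D) D"
    and f: "f \<in> C_la \<iota> n (rational_points n I)"
    and J: "finite J" "J \<subseteq> \<D>" and \<epsilon>: "0 < \<epsilon>"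
  shows "\<exists>g\<in>C_alg \<iota> n I. (\<lambda>x. g x - f x) \<in> la_step \<iota> (rational_points n I) \<D> \<and>
    (\<forall>D\<in>J. 0 \<le> chart_norm \<iota> D (\<lambda>x. g x - f x) \<and> chart_norm \<iota> D (\<lambda>x. g x - f x) \<le> \<epsilon>)"
proof -
  let ?M = "rational_points n I"
  have M: "?M \<subseteq> affine_points n" by (auto simp: rational_points_def)
  obtain G where G: "G \<in> algebraic_functions \<iota> n"
    "\<forall>D\<in>J. chart_bounded \<iota> D (\<lambda>s. G (chart_inverse D s) - f (chart_inverse D s)) \<epsilon>"
    using adapted_chart_approximation[where f = f, OF M \<D> _ J \<epsilon>] good by blast
  define g where "g x = (if x \<in> ?M then G x else 0)" for x
  have g: "g \<in> C_alg \<iota> n I" unfolding C_alg_eq g_def[abs_def] using G(1) by (rule imageI)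
  have gG: "g (chart_inverse D s) = G (chart_inverse D s)" if "D \<in> \<D>" "s \<in> chart_disc D" for D s
  proof -
    have img: "chart_map D ` chart_dom D = chart_disc D" and "chart_dom D \<subseteq> ?M"
      using \<D> that(1) by (auto simp: la_index_def is_ball_chart_def)
    moreover have "chart_inverse D s \<in> chart_dom D"
      by (rule inv_into_into) (simp only: img that(2))
    ultimately have "chart_inverse D s \<in> ?M" by blast
    then show ?thesis by (simp add: g_def)
  qed
  have bounded: "\<exists>C. chart_bounded \<iota> D ((\<lambda>x. g x - f x) \<circ> chart_inverse D) C" if D: "D \<in> \<D>" for D
  proof -
    obtain x where ad: "adapted_chart \<iota> n ?M f x (chart_radius D) D" using good[OF D] by blast
    then have "0 < chart_radius D" by (auto simp: adapted_chart_def is_ball_chart_def)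
    then interpret ultra_bound "chart_bounded \<iota> D" by (rule ultra_bound_gauss) simp
    have "0 < (1 :: real)" by simp
    from adapted_chart_approximable[OF ad this] obtain P where P: "P \<in> algebraic_functions \<iota> n"
      "chart_bounded \<iota> D (\<lambda>s. f (chart_inverse D s) - P (chart_inverse D s)) 1"
      by (elim bexE)
    obtain C where "chart_bounded \<iota> D (\<lambda>s. G (chart_inverse D s) - P (chart_inverse D s)) C"
      using adapted_chart_algebraic_bounded[OF ad algebraic_diff[OF G(1) P(1)]] by blast
    from add_max[OF this uminus[OF P(2)]]
    have "chart_bounded \<iota> D (\<lambda>s. G (chart_inverse D s) - f (chart_inverse D s)) (max C 1)" by simp
    then have "chart_bounded \<iota> D ((\<lambda>x. g x - f x) \<circ> chart_inverse D) (max C 1)"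
      by (rule gauss_bounded_cong) (simp add: gG[OF D])
    then show ?thesis ..
  qed
  have "\<exists>a. chart_expansion \<iota> D (\<lambda>x. g x - f x) a" if D: "D \<in> \<D>" for D
  proof -
    obtain C where "chart_bounded \<iota> D ((\<lambda>x. g x - f x) \<circ> chart_inverse D) C" using bounded[OF D] ..
    then show ?thesis unfolding chart_expansion_def by (rule gauss_bounded_imp_power_series)
  qed
  moreover have "g x - f x = 0" if "x \<notin> ?M" for x
    using f that by (simp add: g_def C_la_def)
  ultimately have "(\<lambda>x. g x - f x) \<in> la_step \<iota> ?M \<D>" by (simp add: la_step_def)
  moreover have "0 \<le> chart_norm \<iota> D (\<lambda>x. g x - f x) \<and> chart_norm \<iota> D (\<lambda>x. g x - f x) \<le> \<epsilon>" if "D \<in> J" for D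
  proof -
    have D: "D \<in> \<D>" using that J by auto
    have "is_ball_chart n ?M D" using \<D> D by (simp add: la_index_def)
    moreover have "chart_bounded \<iota> D ((\<lambda>x. g x - f x) \<circ> chart_inverse D) \<epsilon>"
      by (rule gauss_bounded_cong[OF bspec[OF G(2) that]]) (simp add: gG[OF D])
    ultimately show ?thesis using chart_norm_bounds[OF nt] by blast
  qed
  ultimately show ?thesis using g by blast
qed

text \<open>By the ultrametric inequality a subbasic set contains the set with the same seminorm and
  the same \<epsilon> around any of its elements, so recentring costs nothing. Finite intersections
  collect the seminorms and take the least \<epsilon>.\<close>

lemma la_topology_neighbourhood:
  assumes "openin (la_topology \<iota> n M) U" "f \<in> U"
  shows "\<exists>S \<epsilon>. finite S \<and> 0 < \<epsilon> \<and> (\<forall>q\<in>S. la_seminorm \<iota> n M q) \<and>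
    (\<forall>g\<in>C_la \<iota> n M. (\<forall>q\<in>S. q (\<lambda>x. g x - f x) < \<epsilon>) \<longrightarrow> g \<in> U)"
proof -
  let ?B = "{{g \<in> C_la \<iota> n M. q (\<lambda>x. g x - f x) < \<epsilon>} | q f \<epsilon>. la_seminorm \<iota> n M q \<and> f \<in> C_la \<iota> n M \<and> 0 < \<epsilon>}"
  have "generate_topology_on ?B U"
    using assms(1) unfolding la_topology_def openin_topology_generated_by_iff .
  then show ?thesis using assms(2)
  proof (induction arbitrary: f)
    case Empty
    then show ?case by simp
  next
    case (Int U V)
    obtain S \<epsilon> where S: "finite S" "0 < \<epsilon>" "\<forall>q\<in>S. la_seminorm \<iota> n M q"
      "\<forall>g\<in>C_la \<iota> n M. (\<forall>q\<in>S. q (\<lambda>x. g x - f x) < \<epsilon>) \<longrightarrow> g \<in> U"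
      using Int.IH(1)[of f] Int.prems by auto
    obtain T \<delta> where T: "finite T" "0 < \<delta>" "\<forall>q\<in>T. la_seminorm \<iota> n M q"
      "\<forall>g\<in>C_la \<iota> n M. (\<forall>q\<in>T. q (\<lambda>x. g x - f x) < \<delta>) \<longrightarrow> g \<in> V"
      using Int.IH(2)[of f] Int.prems by auto
    show ?case
      by (rule exI[of _ "S \<union> T"], rule exI[of _ "min \<epsilon> \<delta>"]) (use S T in auto)
  next
    case (UN K)
    then obtain W where W: "W \<in> K" "f \<in> W" by blast
    from UN.IH[OF W] show ?case using W(1) by blast
  next
    case (Basis W)
    then obtain q f0 \<epsilon> where W: "W = {g \<in> C_la \<iota> n M. q (\<lambda>x. g x - f0 x) < \<epsilon>}"
      and q: "la_seminorm \<iota> n M q" and f0: "f0 \<in> C_la \<iota> n M" and \<epsilon>: "0 < \<epsilon>" by blast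
    have f: "f \<in> C_la \<iota> n M" "q (\<lambda>x. f x - f0 x) < \<epsilon>" using Basis.prems W by auto
    have "g \<in> W" if g: "g \<in> C_la \<iota> n M" and qg: "q (\<lambda>x. g x - f x) < \<epsilon>" for g
    proof -
      have "q (\<lambda>x. (g x - f x) + (f x - f0 x)) \<le> max (q (\<lambda>x. g x - f x)) (q (\<lambda>x. f x - f0 x))"
      proof -
        have "\<forall>f\<in>C_la \<iota> n M. \<forall>g\<in>C_la \<iota> n M. q (\<lambda>x. f x + g x) \<le> max (q f) (q g)"
          using q unfolding la_seminorm_def nonarch_seminorm_on_def by (elim conjE)
        from bspec[OF bspec[OF this C_la_diff[OF g f(1)]] C_la_diff[OF f(1) f0]] show ?thesis .
      qed
      then have "q (\<lambda>x. g x - f0 x) < \<epsilon>" using f(2) qg by simp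
      then show ?thesis using g W by simp
    qed
    then show ?case using q \<epsilon> by (intro exI[of _ "{q}"] exI[of _ \<epsilon>]) simp
  qed
qed

end

theorem theorem7p4:
  fixes p n :: nat
    and \<iota> :: "'q::{nonarch_field, field_char_0, complete_space} \<Rightarrow> 'l::nonarch_field"
    and I :: "'q mpoly set"
  assumes "prime p"
    and "is_padic_field p TYPE('q)"
    and "finite_extension \<iota>"
    and "ideal I (poly_ring n)"
    and "smooth_scheme n I"
    and "rational_points_dense n I"
  shows "C_alg \<iota> n I \<subseteq> C_la \<iota> n (rational_points n I) \<and>
         la_topology \<iota> n (rational_points n I) closure_of C_alg \<iota> n I
           = C_la \<iota> n (rational_points n I)"
proof -
  let ?M = "rational_points n I"
  have emb: "isometric_embedding \<iota>" by (rule finite_extension_imp_isometric_embedding[OF assms(3)])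
  interpret isometric_embedding \<iota> by (rule emb)
  have nt: "nontrivially_valued TYPE('q)" by (rule nontrivially_valued_padic[OF assms(1,2)])
  have M: "?M \<subseteq> affine_points n" by (auto simp: rational_points_def)
  have "f \<in> la_topology \<iota> n ?M closure_of C_alg \<iota> n I" if f: "f \<in> C_la \<iota> n ?M" for f
    unfolding in_closure_of topspace_la_topology
  proof (intro conjI allI impI f)
    fix U assume U: "f \<in> U \<and> openin (la_topology \<iota> n ?M) U"
    obtain S \<epsilon> where S: "finite S" "\<forall>q\<in>S. la_seminorm \<iota> n ?M q" and \<epsilon>: "0 < \<epsilon>"
      and S_U: "\<forall>g\<in>C_la \<iota> n ?M. (\<forall>q\<in>S. q (\<lambda>x. g x - f x) < \<epsilon>) \<longrightarrow> g \<in> U"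
      using la_topology_neighbourhood[OF conjunct2[OF U] conjunct1[OF U]] by (elim exE conjE)
    \<comment> \<open>One partition, adapted to \<open>f\<close>, serves all seminorms in
      \<open>S\<close>.\<close>
    obtain \<D> where \<D>: "la_index n ?M \<D>"
      and good: "\<And>D. D \<in> \<D> \<Longrightarrow> \<exists>x\<in>?M. adapted_chart \<iota> n ?M f x (chart_radius D) D"
      by (rule adapted_partition[OF M adapted_chart_exists[OF emb assms(4,5) _ f]], assumption) (rule that)
    have "\<forall>q\<in>S. \<exists>JC. finite (fst JC) \<and> fst JC \<subseteq> \<D> \<and>
        (\<forall>f\<in>la_step \<iota> ?M \<D>. q f \<le> snd JC * (\<Sum>D\<in>fst JC. chart_norm \<iota> D f))"
    proof
      fix q assume "q \<in> S"
      from la_seminorm_bound[OF bspec[OF S(2) this] \<D>]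
      obtain J C where "finite J \<and> J \<subseteq> \<D> \<and> (\<forall>f\<in>la_step \<iota> ?M \<D>. q f \<le> C * (\<Sum>D\<in>J. chart_norm \<iota> D f))"
        by (elim exE)
      then show "\<exists>JC. finite (fst JC) \<and> fst JC \<subseteq> \<D> \<and>
          (\<forall>f\<in>la_step \<iota> ?M \<D>. q f \<le> snd JC * (\<Sum>D\<in>fst JC. chart_norm \<iota> D f))"
        by (intro exI[of _ "(J, C)"]) simp
    qed
    from bchoice[OF this] obtain JC where JC: "\<forall>q\<in>S. finite (fst (JC q)) \<and> fst (JC q) \<subseteq> \<D> \<and>
        (\<forall>f\<in>la_step \<iota> ?M \<D>. q f \<le> snd (JC q) * (\<Sum>D\<in>fst (JC q). chart_norm \<iota> D f))" ..
    \<comment> \<open>Each seminorm sees its own finite set of charts; the approximation is demanded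
      on their union.\<close>
    define J where "J = (\<Union>q\<in>S. fst (JC q))"
    have J: "finite J" "J \<subseteq> \<D>" using S(1) JC by (auto simp: J_def)
    \<comment> \<open>The seminorm of the error is at most |constant| times number of charts times
      \<delta>. Absolute values are taken since the constants may be negative; the added 1 makes the
      bound strict and keeps it positive for empty \<open>S\<close>.\<close>
    define B where "B = (\<Sum>q\<in>S. \<bar>snd (JC q)\<bar> * real (card (fst (JC q)))) + 1"
    have B: "0 < B" unfolding B_def by (intro add_nonneg_pos sum_nonneg) auto
    have B_ge: "\<bar>snd (JC q)\<bar> * real (card (fst (JC q))) < B" if "q \<in> S" for q
    proof -
      have "\<bar>snd (JC q)\<bar> * real (card (fst (JC q))) \<le> (\<Sum>q\<in>S. \<bar>snd (JC q)\<bar> * real (card (fst (JC q))))"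
        using S(1) that by (intro member_le_sum) auto
      then show ?thesis by (simp add: B_def)
    qed
    define \<delta> where "\<delta> = \<epsilon> / B"
    have \<delta>: "0 < \<delta>" "B * \<delta> = \<epsilon>" using \<epsilon> B by (auto simp: \<delta>_def)
    obtain g where g: "g \<in> C_alg \<iota> n I" "(\<lambda>x. g x - f x) \<in> la_step \<iota> ?M \<D>"
      and norm: "\<forall>D\<in>J. 0 \<le> chart_norm \<iota> D (\<lambda>x. g x - f x) \<and> chart_norm \<iota> D (\<lambda>x. g x - f x) \<le> \<delta>"
      using density_on_index[OF nt \<D> good f J \<delta>(1)] by blast
    have "q (\<lambda>x. g x - f x) < \<epsilon>" if q: "q \<in> S" for q
    proof -
      let ?s = "\<Sum>D\<in>fst (JC q). chart_norm \<iota> D (\<lambda>x. g x - f x)"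
      have nJ: "0 \<le> chart_norm \<iota> D (\<lambda>x. g x - f x)" "chart_norm \<iota> D (\<lambda>x. g x - f x) \<le> \<delta>" if "D \<in> fst (JC q)" for D
        using norm that q by (auto simp: J_def)
      have s: "0 \<le> ?s" "?s \<le> real (card (fst (JC q))) * \<delta>"
        using nJ sum_bounded_above[of "fst (JC q)" "\<lambda>D. chart_norm \<iota> D (\<lambda>x. g x - f x)" \<delta>]
        by (auto intro: sum_nonneg)
      have "q (\<lambda>x. g x - f x) \<le> snd (JC q) * ?s" using JC q g(2) by blast
      also have "\<dots> \<le> \<bar>snd (JC q)\<bar> * ?s" using s(1) by (intro mult_right_mono) auto
      also have "\<dots> \<le> \<bar>snd (JC q)\<bar> * (real (card (fst (JC q))) * \<delta>)" using s(2) by (intro mult_left_mono) auto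
      also have "\<dots> < B * \<delta>"
        unfolding mult.assoc[symmetric] using B_ge[OF q] \<delta>(1) by (intro mult_strict_right_mono)
      finally show ?thesis by (simp add: \<delta>(2))
    qed
    then have "g \<in> U" using S_U C_alg_subset_C_la g(1) by blast
    then show "\<exists>y. y \<in> C_alg \<iota> n I \<and> y \<in> U" using g(1) by blast
  qed
  moreover have "la_topology \<iota> n ?M closure_of C_alg \<iota> n I \<subseteq> C_la \<iota> n ?M"
    using closure_of_subset_topspace[of "la_topology \<iota> n ?M"] by (simp add: topspace_la_topology)
  ultimately show ?thesis using C_alg_subset_C_la by blast
qed

end
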